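(* Assume that $\bar u_\alpha$ is finite and continuous on $E\times E$ for some (equivalently, for all) $\alpha>0$. Let $U$ denote the unique mild solution to the stochastic heat equation $$\frac{\partial}{\partial t}U(t,x)=(\mathcal{L}U)(t,x)+\dot W(t,x)\quad(t>0,\ x\in E),\qquad U(0,x)=0,$$ where $\dot W$ is white noise on $\mathbf{R}_+\times E$ with control measure $\mathrm{d}t\times \mathrm{d}m$. Choose and fix $\alpha>0$ and $t>0$. Then there exists a space-time process $V_\alpha$ with the following properties: 1. For every compact set $A\subset E$, the law of $\{V_\alpha(t,x)\}_{x\in A}$ is mutually absolutely continuous with respect to the law of $\{U(t,x)\}_{x\in A}$. 2. There exists a process $\{S_\alpha(t,x)\}_{x\in E}$, independent of $V_\alpha(t,\cdot)$, such that $S_\alpha(t,\cdot)$ is smoother than $V_\alpha(t,\cdot)$ and $S_\alpha(t,\cdot)+V_\alpha(t,\cdot)$ has the same law as $\eta_\alpha$, the centered Gaussian process indexed by $E$ with covariance $\mathrm{Cov}(\eta_\alpha(x),\eta_\alpha(y))=\bar u_\alpha(x,y)$ for all $x,y\in E$ (the Gaussian process that Dynkin's isomorphism theorem associates to the local times of $\bar X$).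
   Context: Setting and standing assumptions. $E$ is a locally compact separable metric space, $m$ is a Radon measure on $E$, and $X=\{X_t\}_{t\ge0}$ is a Borel right process with values in $E$, with semigroup $\{P_t\}_{t\ge0}$ and regular transition functions $p_t(x,y)$ with respect to $m$: $(P_tf)(x)=\int_E p_t(x,y)f(y)\,m(\mathrm{d}y)$ for all Borel $f:E\to\mathbf{R}_+$, $t>0$, $x\in E$, and $p_{t+s}(x,y)=\int p_t(x,z)p_s(z,y)\,m(\mathrm{d}z)$ pointwise. Write $(g,h)=\int gh\,\mathrm{d}m$ and $\|f\|=(f,f)^{1/2}$ on $L^2(m)$. $\mathcal{L}$ is the $L^2(m)$-generator of $\{P_t\}$. It is assumed that $X$ has a dual process $X^*$ under $m$, so that the adjoint $P_t^*$ of $P_t$ is itself a Markov semigroup on $L^2(m)$ (in particular all $P_t,P_t^*$ are contractions on $L^2(m)$), and that $P_tP_s^*=P_s^*P_t$ for all $s,t\ge0$. Put $\bar P_t:=P_t^*P_t$; this is a symmetric Markovian semigroup on $L^2(m)$. It is assumed that $\{\bar P_t\}$ corresponds to a Borel right Markov process $\bar X=\{\bar X_t\}_{t\ge0}$ and that the domain of its $L^2(m)$-generator $\bar{\mathcal{L}}\phi:=\lim_{t\to0^+}(\bar P_t\phi-\phi)/t$ is dense in $L^2(m)$. $\{\bar P_t\}$ has regular symmetric transition functions $\bar p_t(x,y)=\int p_t(y,z)p_t(x,z)\,m(\mathrm{d}z)$, and $\bar u_\alpha(x,y):=\int_0^\infty e^{-\alpha s}\bar p_s(x,y)\,\mathrm{d}s$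 for $\alpha>0$. Mild solution: white noise with control measure $\mathrm{d}t\times\mathrm{d}m$ is the centered Gaussian noise whose Wiener integrals satisfy $\mathrm{E}[(\int f\,\mathrm{d}W)^2]=\int_0^\infty\int_E f(s,y)^2\,m(\mathrm{d}y)\,\mathrm{d}s$. The mild solution of the heat equation is the Gaussian random field $U(t,x)=\int_0^t\int_E p_{t-s}(x,y)\,W(\mathrm{d}y\,\mathrm{d}s)$. Mutual absolute continuity: the laws of two real-valued random fields $\{A_v\}_{v\in\Gamma}$ and $\{B_v\}_{v\in\Gamma}$ are mutually absolutely continuous if there is an almost surely strictly positive mean-one random variable $D$ such that $\mathrm{P}(\bigcap_{j=1}^n\{A_{v_j}\in\Sigma_j\})=\mathrm{E}(D;\bigcap_{j=1}^n\{B_{v_j}\in\Sigma_j\})$ for all $n$, $v_1,\dots,v_n\in\Gamma$ and Borel sets $\Sigma_1,\dots,\Sigma_n\subset\mathbf{R}$. Smoother than: for two $L^2(\mathrm{P})$-continuous (centered) Gaussian processes $G,G_*$ indexed by $E$, $G$ is smoother than $G_*$ if there is a finite constant $c$ such that $\mathrm{E}(|G(x)-G(y)|^2)\le c\,\mathrm{E}(|G_*(x)-G_*(y)|^2)$ for all $x,y\in E$. *)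

theory Defs
  imports "HOL-Probability.Probability"
begin

section \<open>The state space and \<open>L\<^sup>2\<close>\<close>

definition radon_measure :: "'a::topological_space measure \<Rightarrow> bool" where
  "radon_measure m \<longleftrightarrow>
     sets m = sets borel \<and>
     (\<forall>K. compact K \<longrightarrow> emeasure m K < \<infinity>) \<and>
     (\<forall>B\<in>sets borel. emeasure m B = (SUP K\<in>{K. compact K \<and> K \<subseteq> B}. emeasure m K))"

text \<open>Elements of \<open>L\<^sup>2\<close> are represented by measurable functions, and equality in \<open>L\<^sup>2\<close> by
  equality almost everywhere.\<close>

definition L2 :: "'b measure \<Rightarrow> ('b \<Rightarrow> real) set" where
  "L2 \<mu> = {f \<in> borel_measurable \<mu>. integrable \<mu> (\<lambda>x. (f x)\<^sup>2)}"

definition L2_norm :: "'b measure \<Rightarrow> ('b \<Rightarrow> real) \<Rightarrow> real" where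
  "L2_norm \<mu> f = sqrt (LINT x|\<mu>. (f x)\<^sup>2)"


section \<open>Transition semigroups and processes\<close>

text \<open>A semigroup is given by its sub-Markov kernels \<open>K t x\<close>, so that
  \<open>(P\<^sub>t f)(x) = \<integral> f d(K t x)\<close>. Mass smaller than one is allowed; it corresponds to a process with
  finite lifetime.\<close>

definition transition_semigroup :: "(real \<Rightarrow> 'a::topological_space \<Rightarrow> 'a measure) \<Rightarrow> bool" where
  "transition_semigroup K \<longleftrightarrow>
     (\<forall>t\<ge>0. K t \<in> borel \<rightarrow>\<^sub>M subprob_algebra borel) \<and>
     (\<forall>x. K 0 x = return borel x) \<and>
     (\<forall>s\<ge>0. \<forall>t\<ge>0. \<forall>x. K (s + t) x = K s x \<bind> K t)"

text \<open>The operator of a kernel on real functions. For \<open>f\<close> in \<open>L\<^sup>2(m)\<close> and the kernels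
  considered below, \<open>f\<close> is integrable with respect to \<open>\<kappa> x\<close> for \<open>m\<close>-almost every \<open>x\<close>.\<close>

definition kernel_op :: "('a \<Rightarrow> 'a measure) \<Rightarrow> ('a \<Rightarrow> real) \<Rightarrow> 'a \<Rightarrow> real" where
  "kernel_op \<kappa> f x = (LINT y|\<kappa> x. f y)"

text \<open>The data of a Markov process: the measurable space \<open>base\<close>, the filtration, the trajectories
  (\<open>None\<close> is the cemetery), the shift operators and the laws \<open>P\<^sup>x\<close>.\<close>

record ('o, 'a) markov_system =
  base :: "'o measure"
  filt :: "real \<Rightarrow> 'o measure"
  traj :: "real \<Rightarrow> 'o \<Rightarrow> 'a option"
  shift :: "real \<Rightarrow> 'o \<Rightarrow> 'o"
  law :: "'a \<Rightarrow> 'o measure"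

definition cem_ext :: "('a \<Rightarrow> ennreal) \<Rightarrow> 'a option \<Rightarrow> ennreal" where
  "cem_ext f z = (case z of None \<Rightarrow> 0 | Some y \<Rightarrow> f y)"

definition markov_process ::
  "(real \<Rightarrow> 'a::topological_space \<Rightarrow> 'a measure) \<Rightarrow> ('o, 'a) markov_system \<Rightarrow> bool" where
  "markov_process K X \<longleftrightarrow>
     transition_semigroup K \<and>
     (\<forall>x. prob_space (law X x) \<and> sets (law X x) = sets (base X)) \<and>
     (\<forall>t\<ge>0. subalgebra (base X) (filt X t)) \<and>
     (\<forall>s\<ge>0. \<forall>t\<ge>s. subalgebra (filt X t) (filt X s)) \<and>
     (\<forall>t\<ge>0. \<forall>B\<in>sets borel. {\<omega>\<in>space (base X). traj X t \<omega> \<in> Some ` B} \<in> sets (filt X t)) \<and>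
     (\<forall>\<omega>\<in>space (base X). \<forall>s\<ge>0. \<forall>t\<ge>s. traj X s \<omega> = None \<longrightarrow> traj X t \<omega> = None) \<and>
     (\<forall>\<omega>\<in>space (base X). \<forall>s\<ge>0. shift X s \<omega> \<in> space (base X) \<and>
        (\<forall>t\<ge>0. traj X t (shift X s \<omega>) = traj X (s + t) \<omega>)) \<and>
     (\<forall>x. AE \<omega> in law X x. traj X 0 \<omega> = Some x) \<and>
     (\<forall>x. \<forall>s\<ge>0. \<forall>t\<ge>0. \<forall>A\<in>sets (filt X s). \<forall>B\<in>sets borel.
        emeasure (law X x) {\<omega>\<in>A. traj X (s + t) \<omega> \<in> Some ` B} =
        (\<integral>\<^sup>+\<omega>\<in>A. cem_ext (\<lambda>y. emeasure (K t y) B) (traj X s \<omega>) \<partial>law X x))"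

definition excessive ::
  "(real \<Rightarrow> 'a::topological_space \<Rightarrow> 'a measure) \<Rightarrow> real \<Rightarrow> ('a \<Rightarrow> ennreal) \<Rightarrow> bool" where
  "excessive K \<alpha> f \<longleftrightarrow>
     f \<in> borel_measurable borel \<and>
     (\<forall>t\<ge>0. \<forall>x. ennreal (exp (- \<alpha> * t)) * (\<integral>\<^sup>+y. f y \<partial>K t x) \<le> f x) \<and>
     (\<forall>x. ((\<lambda>t. ennreal (exp (- \<alpha> * t)) * (\<integral>\<^sup>+y. f y \<partial>K t x)) \<longlongrightarrow> f x) (at_right 0))"

text \<open>Right continuity in \<open>E \<union> {\<Delta>}\<close> only has to be required before the lifetime, because the
  cemetery is absorbing. The last clause is the second of Meyer's right hypotheses
  (\<open>\<alpha>\<close>-excessive functions are almost surely right continuous along the paths, with \<open>f(\<Delta>) = 0\<close>).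
  For semigroups with transition functions with respect to a measure, as used here, every
  \<open>\<alpha>\<close>-excessive function is Borel, so nothing is lost by considering Borel ones.\<close>

definition borel_right_process ::
  "(real \<Rightarrow> 'a::topological_space \<Rightarrow> 'a measure) \<Rightarrow> ('o, 'a) markov_system \<Rightarrow> bool" where
  "borel_right_process K X \<longleftrightarrow>
     markov_process K X \<and>
     (\<forall>\<omega>\<in>space (base X). \<forall>t\<ge>0. \<forall>x. traj X t \<omega> = Some x \<longrightarrow>
        (\<forall>G. open G \<and> x \<in> G \<longrightarrow> (\<forall>\<^sub>F s in at_right t. traj X s \<omega> \<in> Some ` G))) \<and>
     (\<forall>\<alpha>>0. \<forall>f. excessive K \<alpha> f \<longrightarrow>
        (\<forall>x. AE \<omega> in law X x. \<forall>t\<ge>0.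
           ((\<lambda>s. cem_ext f (traj X s \<omega>)) \<longlongrightarrow> cem_ext f (traj X t \<omega>)) (at_right t)))"

definition regular_transition_functions ::
  "'a::topological_space measure \<Rightarrow> (real \<Rightarrow> 'a \<Rightarrow> 'a \<Rightarrow> ennreal) \<Rightarrow>
   (real \<Rightarrow> 'a \<Rightarrow> 'a measure) \<Rightarrow> bool" where
  "regular_transition_functions m q K \<longleftrightarrow>
     (\<lambda>(t, x, y). q t x y) \<in>
       borel_measurable (restrict_space borel {0<..} \<Otimes>\<^sub>M borel \<Otimes>\<^sub>M borel) \<and>
     (\<forall>t>0. \<forall>f\<in>borel_measurable borel. \<forall>x.
        (\<integral>\<^sup>+y. f y \<partial>K t x) = (\<integral>\<^sup>+y. q t x y * f y \<partial>m)) \<and>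
     (\<forall>s>0. \<forall>t>0. \<forall>x y. q (t + s) x y = (\<integral>\<^sup>+z. q t x z * q s z y \<partial>m))"

definition dual_semigroups ::
  "'a::topological_space measure \<Rightarrow> (real \<Rightarrow> 'a \<Rightarrow> 'a measure) \<Rightarrow>
   (real \<Rightarrow> 'a \<Rightarrow> 'a measure) \<Rightarrow> bool" where
  "dual_semigroups m P Q \<longleftrightarrow>
     (\<forall>t\<ge>0. \<forall>f\<in>borel_measurable borel. \<forall>g\<in>borel_measurable borel.
        (\<integral>\<^sup>+x. (\<integral>\<^sup>+y. f y \<partial>P t x) * g x \<partial>m) = (\<integral>\<^sup>+x. f x * (\<integral>\<^sup>+y. g y \<partial>Q t x) \<partial>m))"

definition commuting_semigroups ::
  "'a measure \<Rightarrow> (real \<Rightarrow> 'a \<Rightarrow> 'a measure) \<Rightarrow> (real \<Rightarrow> 'a \<Rightarrow> 'a measure) \<Rightarrow> bool" where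
  "commuting_semigroups m P Q \<longleftrightarrow>
     (\<forall>s\<ge>0. \<forall>t\<ge>0. \<forall>f\<in>L2 m. AE x in m.
        kernel_op (P t) (kernel_op (Q s) f) x = kernel_op (Q s) (kernel_op (P t) f) x)"

text \<open>The operators \<open>P\<^sub>t\<^sup>* P\<^sub>t\<close>, where \<open>Q\<close> are the kernels of the dual semigroup.\<close>

definition bar_op ::
  "(real \<Rightarrow> 'a \<Rightarrow> 'a measure) \<Rightarrow> (real \<Rightarrow> 'a \<Rightarrow> 'a measure) \<Rightarrow>
   real \<Rightarrow> ('a \<Rightarrow> real) \<Rightarrow> 'a \<Rightarrow> real" where
  "bar_op P Q t f = kernel_op (Q t) (kernel_op (P t) f)"

definition generator_domain ::
  "'a measure \<Rightarrow> (real \<Rightarrow> ('a \<Rightarrow> real) \<Rightarrow> 'a \<Rightarrow> real) \<Rightarrow> ('a \<Rightarrow> real) set" where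
  "generator_domain m T =
     {\<phi> \<in> L2 m. \<exists>g\<in>L2 m.
        ((\<lambda>t. L2_norm m (\<lambda>x. (T t \<phi> x - \<phi> x) / t - g x)) \<longlongrightarrow> 0) (at_right 0)}"

definition dense_in_L2 :: "'a measure \<Rightarrow> ('a \<Rightarrow> real) set \<Rightarrow> bool" where
  "dense_in_L2 m D \<longleftrightarrow>
     D \<subseteq> L2 m \<and> (\<forall>f\<in>L2 m. \<forall>\<epsilon>>0. \<exists>\<phi>\<in>D. L2_norm m (\<lambda>x. f x - \<phi> x) < \<epsilon>)"

definition pbar ::
  "'a measure \<Rightarrow> (real \<Rightarrow> 'a \<Rightarrow> 'a \<Rightarrow> real) \<Rightarrow> real \<Rightarrow> 'a \<Rightarrow> 'a \<Rightarrow> ennreal" where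
  "pbar m p t x y = (\<integral>\<^sup>+z. ennreal (p t y z) * ennreal (p t x z) \<partial>m)"

definition ubar ::
  "'a measure \<Rightarrow> (real \<Rightarrow> 'a \<Rightarrow> 'a \<Rightarrow> real) \<Rightarrow> real \<Rightarrow> 'a \<Rightarrow> 'a \<Rightarrow> ennreal" where
  "ubar m p \<alpha> x y = (\<integral>\<^sup>+s\<in>{0<..}. ennreal (exp (- \<alpha> * s)) * pbar m p s x y \<partial>lborel)"


section \<open>Gaussian processes and white noise\<close>

text \<open>The constant zero counts as a (degenerate) Gaussian variable.\<close>

definition centered_gaussian_rv :: "'w measure \<Rightarrow> ('w \<Rightarrow> real) \<Rightarrow> bool" where
  "centered_gaussian_rv M X \<longleftrightarrow>
     X \<in> borel_measurable M \<and>
     ((AE \<omega> in M. X \<omega> = 0) \<or> (\<exists>\<sigma>>0. distributed M lborel X (normal_density 0 \<sigma>)))"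

definition centered_gaussian_process ::
  "'w measure \<Rightarrow> 'i set \<Rightarrow> ('i \<Rightarrow> 'w \<Rightarrow> real) \<Rightarrow> bool" where
  "centered_gaussian_process M I G \<longleftrightarrow>
     prob_space M \<and>
     (\<forall>F a. finite F \<and> F \<subseteq> I \<longrightarrow> centered_gaussian_rv M (\<lambda>\<omega>. \<Sum>i\<in>F. a i * G i \<omega>))"

definition centered_gaussian_with_cov ::
  "'w measure \<Rightarrow> ('i \<Rightarrow> 'w \<Rightarrow> real) \<Rightarrow> ('i \<Rightarrow> 'i \<Rightarrow> real) \<Rightarrow> bool" where
  "centered_gaussian_with_cov M G C \<longleftrightarrow>
     centered_gaussian_process M UNIV G \<and> (\<forall>x y. (LINT \<omega>|M. G x \<omega> * G y \<omega>) = C x y)"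

text \<open>A white noise is given by its Wiener integrals \<open>W f = \<integral> f dW\<close>, \<open>f \<in> L\<^sup>2(\<mu>)\<close>, where \<open>\<mu>\<close> is
  the control measure; the values of \<open>W\<close> outside \<open>L\<^sup>2(\<mu>)\<close> have no meaning.\<close>

definition white_noise :: "'w measure \<Rightarrow> 'b measure \<Rightarrow> (('b \<Rightarrow> real) \<Rightarrow> 'w \<Rightarrow> real) \<Rightarrow> bool" where
  "white_noise M \<mu> W \<longleftrightarrow>
     centered_gaussian_process M (L2 \<mu>) W \<and>
     (\<forall>f\<in>L2 \<mu>. \<forall>g\<in>L2 \<mu>. \<forall>a b.
        AE \<omega> in M. W (\<lambda>z. a * f z + b * g z) \<omega> = a * W f \<omega> + b * W g \<omega>) \<and>
     (\<forall>f\<in>L2 \<mu>. (LINT \<omega>|M. (W f \<omega>)\<^sup>2) = (LINT z|\<mu>. (f z)\<^sup>2))"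

definition space_time :: "'a measure \<Rightarrow> (real \<times> 'a) measure" where
  "space_time m = restrict_space lborel {0..} \<Otimes>\<^sub>M m"

text \<open>Mild solution of \<open>\<partial>\<^sub>t U = \<L>U + dW\<close>, \<open>U(0,\<cdot>) = 0\<close>, where \<open>p\<close> are the transition functions
  of the semigroup generated by \<open>\<L>\<close>: the Wiener integral of \<open>p\<^sub>t\<^sub>-\<^sub>s(x,y) 1(0 < s < t)\<close> has to
  exist and to coincide with \<open>U(t,x)\<close>.\<close>

definition mild_solution ::
  "'w measure \<Rightarrow> 'a measure \<Rightarrow> (real \<Rightarrow> 'a \<Rightarrow> 'a \<Rightarrow> real) \<Rightarrow>
   ((real \<times> 'a \<Rightarrow> real) \<Rightarrow> 'w \<Rightarrow> real) \<Rightarrow> (real \<Rightarrow> 'a \<Rightarrow> 'w \<Rightarrow> real) \<Rightarrow> bool" where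
  "mild_solution M m p W U \<longleftrightarrow>
     (\<forall>t\<ge>0. \<forall>x.
        (\<lambda>(s, y). indicator {0<..<t} s * p (t - s) x y) \<in> L2 (space_time m) \<and>
        U t x \<in> borel_measurable M \<and>
        (AE \<omega> in M. U t x \<omega> = W (\<lambda>(s, y). indicator {0<..<t} s * p (t - s) x y) \<omega>))"


section \<open>Comparison of random fields\<close>

text \<open>The laws of \<open>{A\<^sub>v}\<close> (on \<open>M\<close>) and \<open>{B\<^sub>v}\<close> (on \<open>N\<close>), \<open>v \<in> \<Gamma>\<close>.\<close>

definition laws_mutually_abs_cont ::
  "'w measure \<Rightarrow> ('i \<Rightarrow> 'w \<Rightarrow> real) \<Rightarrow> 'v measure \<Rightarrow> ('i \<Rightarrow> 'v \<Rightarrow> real) \<Rightarrow> 'i set \<Rightarrow> bool" where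
  "laws_mutually_abs_cont M A N B \<Gamma> \<longleftrightarrow>
     prob_space M \<and> prob_space N \<and>
     (\<forall>v\<in>\<Gamma>. A v \<in> borel_measurable M \<and> B v \<in> borel_measurable N) \<and>
     (\<exists>D\<in>borel_measurable N.
        (AE \<omega> in N. 0 < D \<omega>) \<and> integrable N D \<and> (LINT \<omega>|N. D \<omega>) = 1 \<and>
        (\<forall>(n::nat) v S. (\<forall>j<n. v j \<in> \<Gamma> \<and> S j \<in> sets borel) \<longrightarrow>
           measure M {\<omega>\<in>space M. \<forall>j<n. A (v j) \<omega> \<in> S j} =
           (LINT \<omega>:{\<omega>\<in>space N. \<forall>j<n. B (v j) \<omega> \<in> S j}|N. D \<omega>)))"

definition L2_continuous :: "'w measure \<Rightarrow> ('a::topological_space \<Rightarrow> 'w \<Rightarrow> real) \<Rightarrow> bool" where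
  "L2_continuous M G \<longleftrightarrow> (\<forall>x. ((\<lambda>y. L2_norm M (\<lambda>\<omega>. G y \<omega> - G x \<omega>)) \<longlongrightarrow> 0) (at x))"

definition smoother_than ::
  "'w measure \<Rightarrow> ('a::topological_space \<Rightarrow> 'w \<Rightarrow> real) \<Rightarrow> ('a \<Rightarrow> 'w \<Rightarrow> real) \<Rightarrow> bool" where
  "smoother_than M G H \<longleftrightarrow>
     centered_gaussian_process M UNIV G \<and> L2_continuous M G \<and>
     centered_gaussian_process M UNIV H \<and> L2_continuous M H \<and>
     (\<exists>c. \<forall>x y. (LINT \<omega>|M. \<bar>G x \<omega> - G y \<omega>\<bar>\<^sup>2) \<le> c * (LINT \<omega>|M. \<bar>H x \<omega> - H y \<omega>\<bar>\<^sup>2))"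

text \<open>Laws and independence of random fields refer to the product \<open>\<sigma>\<close>-algebra.\<close>

definition field_law :: "'w measure \<Rightarrow> ('i \<Rightarrow> 'w \<Rightarrow> real) \<Rightarrow> ('i \<Rightarrow> real) measure" where
  "field_law M G = distr M (PiM UNIV (\<lambda>_. borel)) (\<lambda>\<omega> i. G i \<omega>)"

definition indep_fields ::
  "'w measure \<Rightarrow> ('i \<Rightarrow> 'w \<Rightarrow> real) \<Rightarrow> ('i \<Rightarrow> 'w \<Rightarrow> real) \<Rightarrow> bool" where
  "indep_fields M G H \<longleftrightarrow>
     prob_space.indep_var M (PiM UNIV (\<lambda>_. borel)) (\<lambda>\<omega> i. G i \<omega>)
       (PiM UNIV (\<lambda>_. borel)) (\<lambda>\<omega> i. H i \<omega>)"

end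

theory Submission
  imports Defs
begin

text \<open>
  \<open>V\<close> is the mild solution with the extra damping \<open>-\<alpha>/2\<close>: at time \<open>t\<close> it has covariance
  \<open>\<integral>\<^sub>0\<^sup>t e\<^sup>-\<^sup>\<alpha>\<^sup>s p\<^sub>s ds\<close> (\<open>p\<close> the symmetrized transition functions), while \<open>S\<close> is an independent field with
  covariance \<open>\<integral>\<^sub>t\<^sup>\<infinity> e\<^sup>-\<^sup>\<alpha>\<^sup>s p\<^sub>s ds\<close>, so \<open>S + V\<close> has the law of \<open>\<eta>\<close>. For a finitely supported signed measure
  \<open>\<mu>\<close> the energy \<open>s \<mapsto> \<integral>\<integral> p\<^sub>s d\<mu> d\<mu>\<close> is nonnegative and decreasing, so its integral over \<open>(0,t)\<close> controls
  the one over \<open>(0,\<infinity>)\<close> with any exponential weight; this gives the smoothness comparison.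

  On a compact set \<open>A\<close>, \<open>U\<close> has the law of \<open>V + R\<close> with \<open>R\<close> independent of \<open>V\<close>, of covariance
  \<open>\<integral>\<^sub>0\<^sup>t (1 - e\<^sup>-\<^sup>\<alpha>\<^sup>s) p\<^sub>s ds\<close>. If \<open>R\<close> lies in the Cameron-Martin space of \<open>V\<close>, the two laws are equivalent; for this
  it suffices that the trace of the covariance of \<open>R\<close> relative to that of \<open>V\<close> is bounded over the finite
  subsets of \<open>A\<close>. The form of \<open>R\<close> is dominated by \<open>\<integral> (u \<mu>)\<^sup>2 dm\<close> with \<open>u\<close> the resolvent density, so the trace is at
  most a multiple of \<open>\<integral> k dm\<close>, where \<open>k z\<close> is the squared length of the projection of \<open>\<delta>\<^sub>z\<close> onto the span of
  \<open>\<delta>\<^sub>x\<close>, \<open>x \<in> A\<close>. By the domination principle \<open>k\<close> lies below a multiple of an integrable potential that is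
  at least one on \<open>A\<close>.
\<close>

section \<open>Gaussian fields and their characteristic functions\<close>

text \<open>The obstacle: \<open>A\<close> may be uncountable and no eigenfunction expansion is at
  hand. Equivalence is therefore proved through estimates over finite sets of points, of the form
  P(D) \<le> \<epsilon> + l Q(D), where l depends on \<epsilon> but neither on the points nor on
  their number; in this form they survive the passage to the product sigma-algebra.

  The resolvent density enters because 1 - e^(-\<alpha>s) is of order s at 0, while s e^(-\<beta>s)
  is the time weight of the resolvent density composed with itself. Here \<beta> is the parameter at
  which continuity is assumed. It is unrelated to \<alpha>; since energies decrease in time, those
  at different parameters are comparable, and continuity at \<beta> serves all fields.

  As \<open>m\<close> may be infinite, bounding k on \<open>A\<close> is not enough: it has to decay
  away from \<open>A\<close>. The projection of the point mass at z has signed weights, so its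
  potential cannot be estimated term by term; the domination principle applies all the same, because
  the maximum principle behind it looks only at the places where the signed density is
  positive.\<close>

lemma finite_measure_eqI_char:
  fixes M N :: "real measure"
  assumes fin: "finite_measure M" "finite_measure N"
    and sets: "sets M = sets borel" "sets N = sets borel"
    and ch: "\<And>u. (CLINT x|M. iexp (u * x)) = (CLINT x|N. iexp (u * x))"
  shows "M = N"
proof -
  interpret M: finite_measure M by fact
  interpret N: finite_measure N by fact
  have spM: "space M = UNIV" "space N = UNIV"
    using sets[THEN sets_eq_imp_space_eq] by auto
  note [measurable_cong] = sets
  \<comment> \<open>The transform at 0 is the total mass, so one constant \<open>c\<close>
    normalises both measures and Levy's theorem for probability measures applies; mass zero is
    treated apart.\<close>
  define c where "c = measure M UNIV"
  have cN: "measure N UNIV = c"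
    using ch[of 0] spM by (simp add: c_def)
  have eM: "emeasure M UNIV = ennreal c" and eN: "emeasure N UNIV = ennreal c"
    using M.emeasure_eq_measure[of UNIV] N.emeasure_eq_measure[of UNIV] cN by (auto simp: c_def)
  show ?thesis
  proof (cases "c = 0")
    case True
    have "emeasure M A = 0" "emeasure N A = 0" for A
      using emeasure_space[of M A] emeasure_space[of N A] eM eN True spM by auto
    then show ?thesis by (intro measure_eqI) (auto simp: sets)
  next
    case False
    then have c: "c > 0" by (simp add: c_def less_le)
    define d where "d = (\<lambda>M::real measure. density M (\<lambda>_. ennreal (1 / c)))"
    have rd: "real_distribution (d L)" if "emeasure L UNIV = ennreal c" "sets L = sets borel" "space L = UNIV" for L
    proof -
      have "emeasure (d L) (space (d L)) = 1"
        using that c by (simp add: d_def emeasure_density_const ennreal_mult[symmetric])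
      then show ?thesis using that
        by (auto simp: real_distribution_def real_distribution_axioms_def d_def intro: prob_spaceI)
    qed
    have chd: "char (d L) u = (1 / c) *\<^sub>R (CLINT x|L. iexp (u * x))" if [measurable_cong]: "sets L = sets borel" for L u
      unfolding char_def d_def using c by (subst integral_density) auto
    have "d M = d N"
      by (rule Levy_uniqueness) (use spM eM eN sets in \<open>auto intro!: rd simp: chd ch fun_eq_iff simp del: of_real_mult\<close>)
    moreover have "emeasure L A = ennreal c * emeasure (d L) A" if "A \<in> sets L" for L A
      using that c
      by (simp add: d_def emeasure_density_const mult.assoc[symmetric] ennreal_mult[symmetric])
    ultimately show ?thesis
      by (intro measure_eqI) (auto simp: sets)
  qed
qed

lemma finite_measure_density_bounded:
  assumes "finite_measure M" and [measurable]: "f \<in> borel_measurable M"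
    and "\<And>x. f x \<le> c" "c < top"
  shows "finite_measure (density M f)"
proof -
  interpret finite_measure M by fact
  have "emeasure (density M f) (space M) = (\<integral>\<^sup>+x. f x \<partial>M)"
    by (subst emeasure_density) (auto intro!: nn_integral_cong)
  also have "\<dots> \<le> (\<integral>\<^sup>+x. c \<partial>M)"
    using assms(3) by (intro nn_integral_mono)
  also have "\<dots> < top" using assms(4) by (simp add: ennreal_mult_eq_top_iff less_top[symmetric] emeasure_finite)
  finally show ?thesis by (intro finite_measureI) auto
qed

text \<open>Induction on the index set. The weight \<open>1 + cos (Z + \<theta>)\<close>, \<open>Z\<close> a linear combination of the remaining
  coordinates, turns the law of one coordinate into a positive measure, to which the one-dimensional
  uniqueness theorem applies; varying \<open>\<theta>\<close> recovers \<open>exp (i Z)\<close> on the events of that coordinate.\<close>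

lemma cramer_wold_rect:
  fixes X :: "'i \<Rightarrow> 'w \<Rightarrow> real" and Y :: "'i \<Rightarrow> 'v \<Rightarrow> real"
  assumes "finite F" "finite_measure M" "finite_measure N"
    and "\<And>i. i \<in> F \<Longrightarrow> X i \<in> borel_measurable M" "\<And>i. i \<in> F \<Longrightarrow> Y i \<in> borel_measurable N"
    and "\<And>u. (CLINT \<omega>|M. iexp (\<Sum>i\<in>F. u i * X i \<omega>)) = (CLINT \<omega>|N. iexp (\<Sum>i\<in>F. u i * Y i \<omega>))"
    and "\<And>i. i \<in> F \<Longrightarrow> S i \<in> sets borel"
  shows "measure M {\<omega>\<in>space M. \<forall>i\<in>F. X i \<omega> \<in> S i} = measure N {\<omega>\<in>space N. \<forall>i\<in>F. Y i \<omega> \<in> S i}"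
  using assms
proof (induction F arbitrary: M N rule: finite_induct)
  case empty
  then show ?case by simp
next
  case (insert a F)
  interpret M: finite_measure M by fact
  interpret N: finite_measure N by fact
  have [measurable]: "X i \<in> borel_measurable M" "Y i \<in> borel_measurable N" "S i \<in> sets borel"
    if "i = a \<or> i \<in> F" for i using that insert.prems by auto
  have [measurable]: "X a \<in> borel_measurable M" "Y a \<in> borel_measurable N" "S a \<in> sets borel"
    by auto
  have ch: "(CLINT \<omega>|M. iexp (v * X a \<omega> + k * (\<Sum>i\<in>F. u i * X i \<omega>))) =
            (CLINT \<omega>|N. iexp (v * Y a \<omega> + k * (\<Sum>i\<in>F. u i * Y i \<omega>)))" for u v k
  proof -
    have eq: "(\<Sum>i\<in>insert a F. (if i = a then v else k * u i) * Z i) = v * Z a + k * (\<Sum>i\<in>F. u i * Z i)"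
      for Z :: "'i \<Rightarrow> real"
    proof -
      have "(\<Sum>i\<in>F. (if i = a then v else k * u i) * Z i) = (\<Sum>i\<in>F. k * (u i * Z i))"
        using insert.hyps by (intro sum.cong) auto
      then show ?thesis using insert.hyps by (simp add: sum_distrib_left)
    qed
    show ?thesis
      using insert.prems(5)[of "\<lambda>i. if i = a then v else k * u i"] unfolding eq .
  qed
  have int_iexp: "integrable M (\<lambda>\<omega>. iexp (f \<omega>))" if [measurable]: "f \<in> borel_measurable M" for f :: "'w \<Rightarrow> real"
    by (rule M.integrable_const_bound[where B=1]) auto
  have int_iexpN: "integrable N (\<lambda>\<omega>. iexp (f \<omega>))" if [measurable]: "f \<in> borel_measurable N" for f :: "'v \<Rightarrow> real"
    by (rule N.integrable_const_bound[where B=1]) auto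
  \<comment> \<open>Euler's formula: the tilted exponential is a combination of three pure ones,
    with factors 0, 1 and -1 in front of \<open>z\<close>. This is what the factor \<open>k\<close>
    in \<open>ch\<close> is for.\<close>
  have tilt: "iexp (v * x) * complex_of_real (1 + cos (z + \<theta>)) =
      iexp (v * x + 0 * z) + (iexp \<theta> / 2) * iexp (v * x + 1 * z) + (iexp (- \<theta>) / 2) * iexp (v * x + (-1) * z)"
    for v x z \<theta> :: real
    by (simp add: cos_exp_eq exp_of_real[symmetric] cos_of_real[symmetric] exp_add[symmetric] exp_minus field_simps)
  define ZX where "ZX u \<omega> = (\<Sum>i\<in>F. u i * X i \<omega>)" for u \<omega>
  define ZY where "ZY u \<omega> = (\<Sum>i\<in>F. u i * Y i \<omega>)" for u \<omega>
  have [measurable]: "ZX u \<in> borel_measurable M" "ZY u \<in> borel_measurable N" for u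
    unfolding ZX_def ZY_def by auto
  have dens: "(LINT \<omega>|M. indicator (S a) (X a \<omega>) * (1 + cos (ZX u \<omega> + \<theta>))) =
              (LINT \<omega>|N. indicator (S a) (Y a \<omega>) * (1 + cos (ZY u \<omega> + \<theta>)))" for u \<theta>
  proof -
    have nn: "0 \<le> 1 + cos r" for r :: real using cos_ge_minus_one[of r] by linarith
    define \<mu> where "\<mu> = distr (density M (\<lambda>\<omega>. ennreal (1 + cos (ZX u \<omega> + \<theta>)))) borel (X a)"
    define \<nu> where "\<nu> = distr (density N (\<lambda>\<omega>. ennreal (1 + cos (ZY u \<omega> + \<theta>)))) borel (Y a)"
    have le: "1 + cos r \<le> 2" for r :: real using cos_le_one[of r] by linarith
    have fin: "finite_measure \<mu>" "finite_measure \<nu>"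
      unfolding \<mu>_def \<nu>_def using insert.prems(1,2) le
      by (auto intro!: finite_measure.finite_measure_distr finite_measure_density_bounded[where c="ennreal 2"]
               intro: ennreal_leI)
    have "(CLINT x|\<mu>. iexp (v * x)) = (CLINT x|\<nu>. iexp (v * x))" for v
    proof -
      have "(CLINT x|\<mu>. iexp (v * x)) = (CLINT \<omega>|M. iexp (v * X a \<omega>) * complex_of_real (1 + cos (ZX u \<omega> + \<theta>)))"
        unfolding \<mu>_def using nn
        by (subst integral_distr; simp)
           (subst integral_density; simp add: scaleR_conv_of_real mult.commute)
      also have "\<dots> = (CLINT \<omega>|N. iexp (v * Y a \<omega>) * complex_of_real (1 + cos (ZY u \<omega> + \<theta>)))"
      proof -
        define f where "f k \<omega> = iexp (v * X a \<omega> + k * ZX u \<omega>)" for k :: real and \<omega>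
        define g where "g k \<omega> = iexp (v * Y a \<omega> + k * ZY u \<omega>)" for k :: real and \<omega>
        have "integrable M (f k)" "integrable N (g k)" for k
          unfolding f_def g_def by (rule int_iexp int_iexpN; measurable)+
        moreover have "integral\<^sup>L M (f k) = integral\<^sup>L N (g k)" for k
          unfolding f_def g_def using ch[of v k u] by (simp only: ZX_def ZY_def)
        ultimately show ?thesis
          unfolding tilt f_def[symmetric] g_def[symmetric] by simp
      qed
      also have "\<dots> = (CLINT x|\<nu>. iexp (v * x))"
        unfolding \<nu>_def using nn
        by (subst integral_distr; simp)
           (subst integral_density; simp add: scaleR_conv_of_real mult.commute)
      finally show ?thesis .
    qed
    then have "\<mu> = \<nu>"
      by (intro finite_measure_eqI_char fin) (auto simp: \<mu>_def \<nu>_def)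
    then have "(LINT x|\<mu>. indicator (S a) x) = (LINT x|\<nu>. indicator (S a) x :: real)" by simp
    moreover have "(LINT x|\<mu>. indicator (S a) x) = (LINT \<omega>|M. indicator (S a) (X a \<omega>) * (1 + cos (ZX u \<omega> + \<theta>)))"
      unfolding \<mu>_def using nn
      by (subst integral_distr, simp, simp, subst integral_density) (auto simp: mult.commute)
    moreover have "(LINT x|\<nu>. indicator (S a) x) = (LINT \<omega>|N. indicator (S a) (Y a \<omega>) * (1 + cos (ZY u \<omega> + \<theta>)))"
      unfolding \<nu>_def using nn
      by (subst integral_distr, simp, simp, subst integral_density) (auto simp: mult.commute)
    ultimately show ?thesis by simp
  qed
  have cosd: "(LINT \<omega>|M. indicator (S a) (X a \<omega>) * cos (ZX u \<omega> + \<theta>)) =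
              (LINT \<omega>|N. indicator (S a) (Y a \<omega>) * cos (ZY u \<omega> + \<theta>))" for u \<theta>
  proof -
    \<comment> \<open>With all weights and the phase equal to zero the tilt is the constant 2, which
      isolates the untilted integral to be subtracted.\<close>
    have one: "(LINT \<omega>|M. indicator (S a) (X a \<omega>)) = (LINT \<omega>|N. indicator (S a) (Y a \<omega>) :: real)"
      using dens[of "\<lambda>_. 0" 0] by (simp add: ZX_def ZY_def)
    have i1: "integrable M (\<lambda>\<omega>. indicator (S a) (X a \<omega>) :: real)"
      "integrable N (\<lambda>\<omega>. indicator (S a) (Y a \<omega>) :: real)"
      by (auto intro!: M.integrable_const_bound[where B=1] N.integrable_const_bound[where B=1]
               simp: indicator_def)
    have i2: "integrable M (\<lambda>\<omega>. indicator (S a) (X a \<omega>) * cos (ZX u \<omega> + \<theta>))"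
      "integrable N (\<lambda>\<omega>. indicator (S a) (Y a \<omega>) * cos (ZY u \<omega> + \<theta>))"
      by (auto intro!: M.integrable_const_bound[where B=1] N.integrable_const_bound[where B=1]
               simp: indicator_def)
    show ?thesis using dens[of u \<theta>] one i1 i2 by (simp add: distrib_left)
  qed
  \<comment> \<open>Restriction to the event of coordinate \<open>a\<close> loses mass; the
    induction therefore runs over all finite measures and not only over probability
    measures.\<close>
  define M' where "M' = density M (\<lambda>\<omega>. indicator (S a) (X a \<omega>))"
  define N' where "N' = density N (\<lambda>\<omega>. indicator (S a) (Y a \<omega>))"
  have ind: "(\<lambda>\<omega>. indicator (S a) (X a \<omega>) :: ennreal) = (\<lambda>\<omega>. ennreal (indicator (S a) (X a \<omega>)))"
    "(\<lambda>\<omega>. indicator (S a) (Y a \<omega>) :: ennreal) = (\<lambda>\<omega>. ennreal (indicator (S a) (Y a \<omega>)))"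
    by (auto simp: indicator_def)
  have meas': "measure M' A = measure M {\<omega>\<in>A. X a \<omega> \<in> S a}" if "A \<in> sets M" for A
    unfolding M'_def measure_def using that sets.sets_into_space[OF that]
    by (subst emeasure_density)
       (auto intro!: arg_cong[where f=enn2real] nn_integral_indicator[THEN trans] nn_integral_cong
             simp: indicator_def simp flip: nn_integral_indicator)
  have measN': "measure N' A = measure N {\<omega>\<in>A. Y a \<omega> \<in> S a}" if "A \<in> sets N" for A
    unfolding N'_def measure_def using that sets.sets_into_space[OF that]
    by (subst emeasure_density)
       (auto intro!: arg_cong[where f=enn2real] nn_integral_indicator[THEN trans] nn_integral_cong
             simp: indicator_def simp flip: nn_integral_indicator)
  have fin': "finite_measure M'" "finite_measure N'"
    unfolding M'_def N'_def
    using insert.prems(1,2) by (auto intro!: finite_measure_density_bounded[where c=1] simp: indicator_def)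
  have "(CLINT \<omega>|M'. iexp (ZX u \<omega>)) = (CLINT \<omega>|N'. iexp (ZY u \<omega>))" for u
  proof (rule complex_eqI)
    have ie: "integrable M' (\<lambda>\<omega>. iexp (ZX u \<omega>))" "integrable N' (\<lambda>\<omega>. iexp (ZY u \<omega>))"
      by (rule finite_measure.integrable_const_bound[OF fin'(1), where B=1]; simp add: M'_def)
         (rule finite_measure.integrable_const_bound[OF fin'(2), where B=1]; simp add: N'_def)
    have c1: "(LINT \<omega>|M'. cos (ZX u \<omega> + \<theta>)) = (LINT \<omega>|N'. cos (ZY u \<omega> + \<theta>))" for \<theta>
      using cosd[of u \<theta>] unfolding M'_def N'_def ind by (subst (1 2) integral_density) auto
    show "Re (CLINT \<omega>|M'. iexp (ZX u \<omega>)) = Re (CLINT \<omega>|N'. iexp (ZY u \<omega>))"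
      using c1[of 0] ie by (simp flip: integral_Re add: Re_exp)
    \<comment> \<open>The phase -pi/2 turns the cosine into the sine.\<close>
    show "Im (CLINT \<omega>|M'. iexp (ZX u \<omega>)) = Im (CLINT \<omega>|N'. iexp (ZY u \<omega>))"
      using c1[of "- (pi/2)"] ie by (simp flip: integral_Im add: Im_exp cos_diff)
  qed
  then have "measure M' {\<omega>\<in>space M'. \<forall>i\<in>F. X i \<omega> \<in> S i} = measure N' {\<omega>\<in>space N'. \<forall>i\<in>F. Y i \<omega> \<in> S i}"
    using insert.prems fin' by (intro insert.IH) (auto simp: M'_def N'_def ZX_def ZY_def)
  moreover have "{\<omega>\<in>space M. \<forall>i\<in>F. X i \<omega> \<in> S i} \<in> sets M" "{\<omega>\<in>space N. \<forall>i\<in>F. Y i \<omega> \<in> S i} \<in> sets N"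
    using insert.hyps by measurable
  ultimately show ?case
    using meas' measN' by (simp add: M'_def N'_def conj_ac cong: conj_cong)
qed

section \<open>Gaussian fields described by the quadratic forms of their covariances\<close>

definition qform :: "('i \<Rightarrow> 'i \<Rightarrow> real) \<Rightarrow> 'i set \<Rightarrow> ('i \<Rightarrow> real) \<Rightarrow> ('i \<Rightarrow> real) \<Rightarrow> real" where
  "qform k F c d = (\<Sum>x\<in>F. \<Sum>y\<in>F. c x * d y * k x y)"

text \<open>Gaussianity through transforms of finite linear combinations: degenerate combinations
  need no separate case, and the notion passes directly to sums of independent fields and to almost
  sure modifications.\<close>

definition gaussian_char :: "'w measure \<Rightarrow> 'i set \<Rightarrow> ('i \<Rightarrow> 'w \<Rightarrow> real) \<Rightarrow> ('i \<Rightarrow> 'i \<Rightarrow> real) \<Rightarrow> bool" where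
  "gaussian_char M I G C \<longleftrightarrow>
     prob_space M \<and> (\<forall>i\<in>I. G i \<in> borel_measurable M) \<and>
     (\<forall>F u. finite F \<and> F \<subseteq> I \<longrightarrow>
        (CLINT \<omega>|M. iexp (\<Sum>i\<in>F. u i * G i \<omega>)) = complex_of_real (exp (- qform C F u u / 2)))"

lemma gaussian_charD:
  assumes "gaussian_char M I G C"
  shows "prob_space M" "i \<in> I \<Longrightarrow> G i \<in> borel_measurable M"
    "finite F \<Longrightarrow> F \<subseteq> I \<Longrightarrow>
       (CLINT \<omega>|M. iexp (\<Sum>i\<in>F. u i * G i \<omega>)) = complex_of_real (exp (- qform C F u u / 2))"
  using assms by (auto simp: gaussian_char_def)

lemma gaussian_char_subset: "gaussian_char M I G C \<Longrightarrow> J \<subseteq> I \<Longrightarrow> gaussian_char M J G C"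
  unfolding gaussian_char_def by (meson subset_iff order_trans)

text \<open>By \<open>cramer_wold_rect\<close> the transforms determine the probabilities of
  finite-dimensional rectangles. These form an intersection-stable generator of the product
  sigma-algebra, so \<open>I\<close> may be uncountable.\<close>

lemma gaussian_char_law_eq:
  fixes I :: "'i set"
  assumes G: "gaussian_char M I G C" and H: "gaussian_char N I H C"
  shows "distr M (PiM I (\<lambda>_. borel)) (\<lambda>\<omega>. \<lambda>i\<in>I. G i \<omega>) = distr N (PiM I (\<lambda>_. borel)) (\<lambda>\<omega>. \<lambda>i\<in>I. H i \<omega>)"
proof (rule measure_eqI_PiM_infinite)
  interpret M: prob_space M using G by (rule gaussian_charD)
  interpret N: prob_space N using H by (rule gaussian_charD)
  note [measurable] = gaussian_charD(2)[OF G] gaussian_charD(2)[OF H]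
  have m1[measurable]: "(\<lambda>\<omega>. \<lambda>i\<in>I. G i \<omega>) \<in> measurable M (PiM I (\<lambda>_. borel))"
    by (rule measurable_restrict) (rule gaussian_charD(2)[OF G])
  have m2[measurable]: "(\<lambda>\<omega>. \<lambda>i\<in>I. H i \<omega>) \<in> measurable N (PiM I (\<lambda>_. borel))"
    by (rule measurable_restrict) (rule gaussian_charD(2)[OF H])
  show "finite_measure (distr M (PiM I (\<lambda>_. borel)) (\<lambda>\<omega>. \<lambda>i\<in>I. G i \<omega>))"
    by (rule M.finite_measure_distr) measurable
  fix A :: "'i \<Rightarrow> real set" and J assume J: "finite J" "J \<subseteq> I" and A: "\<And>i. i \<in> J \<Longrightarrow> A i \<in> sets borel"
  have S: "prod_emb I (\<lambda>_. borel) J (Pi\<^sub>E J A) \<in> sets (PiM I (\<lambda>_. borel))"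
    using J A by (intro sets_PiM_I) auto
  have "measure M {\<omega>\<in>space M. \<forall>i\<in>J. G i \<omega> \<in> A i} = measure N {\<omega>\<in>space N. \<forall>i\<in>J. H i \<omega> \<in> A i}"
    using J A gaussian_charD(3)[OF G J] gaussian_charD(3)[OF H J]
      gaussian_charD(2)[OF G] gaussian_charD(2)[OF H]
    by (intro cramer_wold_rect) (auto simp: M.finite_measure_axioms N.finite_measure_axioms)
  moreover have "(\<lambda>\<omega>. \<lambda>i\<in>I. G i \<omega>) -` prod_emb I (\<lambda>_. borel) J (Pi\<^sub>E J A) \<inter> space M
      = {\<omega>\<in>space M. \<forall>i\<in>J. G i \<omega> \<in> A i}"
    using J by (auto simp: prod_emb_def PiE_iff subset_iff)
  moreover have "(\<lambda>\<omega>. \<lambda>i\<in>I. H i \<omega>) -` prod_emb I (\<lambda>_. borel) J (Pi\<^sub>E J A) \<inter> space N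
      = {\<omega>\<in>space N. \<forall>i\<in>J. H i \<omega> \<in> A i}"
    using J by (auto simp: prod_emb_def PiE_iff subset_iff)
  ultimately show "emeasure (distr M (PiM I (\<lambda>_. borel)) (\<lambda>\<omega>. \<lambda>i\<in>I. G i \<omega>)) (prod_emb I (\<lambda>_. borel) J (Pi\<^sub>E J A))
     = emeasure (distr N (PiM I (\<lambda>_. borel)) (\<lambda>\<omega>. \<lambda>i\<in>I. H i \<omega>)) (prod_emb I (\<lambda>_. borel) J (Pi\<^sub>E J A))"
    using S by (simp add: emeasure_distr M.emeasure_eq_measure N.emeasure_eq_measure)
qed auto

lemma centered_gaussian_rv_char:
  assumes "prob_space M" "centered_gaussian_rv M X"
  shows "(CLINT \<omega>|M. iexp (X \<omega>)) = complex_of_real (exp (- (LINT \<omega>|M. (X \<omega>)\<^sup>2) / 2))"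
    and "integrable M (\<lambda>\<omega>. (X \<omega>)\<^sup>2)"
proof -
  interpret prob_space M by fact
  have X[measurable]: "X \<in> borel_measurable M" using assms(2) by (simp add: centered_gaussian_rv_def)
  consider "AE \<omega> in M. X \<omega> = 0" | \<sigma> where "\<sigma> > 0" "distributed M lborel X (normal_density 0 \<sigma>)"
    using assms(2) by (auto simp: centered_gaussian_rv_def)
  then have "(CLINT \<omega>|M. iexp (X \<omega>)) = complex_of_real (exp (- (LINT \<omega>|M. (X \<omega>)\<^sup>2) / 2))
    \<and> integrable M (\<lambda>\<omega>. (X \<omega>)\<^sup>2)"
  proof cases
    case 1
    have "(LINT \<omega>|M. (X \<omega>)\<^sup>2) = (LINT \<omega>|M. 0)" using 1 by (intro integral_cong_AE) auto
    moreover have "(CLINT \<omega>|M. iexp (X \<omega>)) = (CLINT \<omega>|M. 1)" using 1 by (intro integral_cong_AE) auto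
    moreover have "integrable M (\<lambda>\<omega>. (X \<omega>)\<^sup>2) = integrable M (\<lambda>\<omega>. 0::real)"
      using 1 by (intro integrable_cong_AE) auto
    ultimately show ?thesis by (simp add: prob_space)
  next
    case 2
    have var: "(LINT \<omega>|M. (X \<omega>)\<^sup>2) = \<sigma>\<^sup>2"
      using normal_distributed_variance[OF 2] normal_distributed_expectation[OF 2] by simp
    \<comment> \<open>A nonintegrable function has integral 0, so the positive variance forces
      integrability.\<close>
    then have int: "integrable M (\<lambda>\<omega>. (X \<omega>)\<^sup>2)"
      using 2(1) not_integrable_integral_eq[of M "\<lambda>\<omega>. (X \<omega>)\<^sup>2"] by auto
    have "distributed M lborel (\<lambda>x. X x / \<sigma>) std_normal_density"
      using 2 normal_standard_normal_convert[OF 2(1), of X 0] by simp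
    then have eq: "distr M borel (\<lambda>x. X x / \<sigma>) = std_normal_distribution"
      using distributed_distr_eq_density[of M lborel "\<lambda>x. X x / \<sigma>" std_normal_density]
      by (simp cong: distr_cong)
    have "(CLINT \<omega>|M. iexp (X \<omega>)) = char (distr M borel (\<lambda>x. X x / \<sigma>)) \<sigma>"
      unfolding char_def using 2(1) by (subst integral_distr) auto
    also have "\<dots> = complex_of_real (exp (- \<sigma>\<^sup>2 / 2))"
      unfolding eq char_std_normal_distribution ..
    finally show ?thesis using var int by simp
  qed
  then show "(CLINT \<omega>|M. iexp (X \<omega>)) = complex_of_real (exp (- (LINT \<omega>|M. (X \<omega>)\<^sup>2) / 2))"
    "integrable M (\<lambda>\<omega>. (X \<omega>)\<^sup>2)" by auto
qed

lemma integrable_mult_of_squares: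
  fixes f g :: "'w \<Rightarrow> real"
  assumes [measurable]: "f \<in> borel_measurable M" "g \<in> borel_measurable M"
    and "integrable M (\<lambda>x. (f x)\<^sup>2)" "integrable M (\<lambda>x. (g x)\<^sup>2)"
  shows "integrable M (\<lambda>x. f x * g x)"
proof (rule Bochner_Integration.integrable_bound)
  show "integrable M (\<lambda>x. (f x)\<^sup>2 + (g x)\<^sup>2)" using assms by simp
  have "\<bar>a * b\<bar> \<le> a\<^sup>2 + b\<^sup>2" for a b :: real
  proof -
    have "2 * \<bar>a\<bar> * \<bar>b\<bar> \<le> a\<^sup>2 + b\<^sup>2" using sum_squares_bound[of "\<bar>a\<bar>" "\<bar>b\<bar>"] by simp
    moreover have "0 \<le> \<bar>a\<bar> * \<bar>b\<bar>" by simp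
    ultimately show ?thesis unfolding abs_mult by linarith
  qed
  then show "AE x in M. norm (f x * g x) \<le> norm ((f x)\<^sup>2 + (g x)\<^sup>2)"
    by auto
qed measurable

lemma sum_square_expand:
  fixes u g :: "'i \<Rightarrow> real"
  shows "(\<Sum>i\<in>F. u i * g i)\<^sup>2 = (\<Sum>i\<in>F. \<Sum>j\<in>F. u i * u j * (g i * g j))"
  unfolding power2_eq_square sum_product by (intro sum.cong refl) simp

text \<open>The form of a Gram matrix is the squared norm of the combination. It serves both for
  random fields over the probability space and for kernels over \<open>m\<close>.\<close>

lemma qform_square_integral:
  fixes f :: "'i \<Rightarrow> 'b \<Rightarrow> real"
  assumes "\<And>x. x \<in> F \<Longrightarrow> f x \<in> borel_measurable M" "\<And>x. x \<in> F \<Longrightarrow> integrable M (\<lambda>z. (f x z)\<^sup>2)"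
    and "\<And>x y. x \<in> F \<Longrightarrow> y \<in> F \<Longrightarrow> (LINT z|M. f x z * f y z) = k x y"
  shows "integrable M (\<lambda>z. (\<Sum>x\<in>F. c x * f x z)\<^sup>2)"
    and "(LINT z|M. (\<Sum>x\<in>F. c x * f x z)\<^sup>2) = qform k F c c"
proof -
  have i: "integrable M (\<lambda>z. c x * c y * (f x z * f y z))" if "x \<in> F" "y \<in> F" for x y
    using assms that by (intro integrable_mult_right integrable_mult_of_squares)
  show "integrable M (\<lambda>z. (\<Sum>x\<in>F. c x * f x z)\<^sup>2)"
    unfolding sum_square_expand by (intro Bochner_Integration.integrable_sum i)
  have "(LINT z|M. (\<Sum>x\<in>F. c x * f x z)\<^sup>2) = (\<Sum>x\<in>F. LINT z|M. (\<Sum>y\<in>F. c x * c y * (f x z * f y z)))"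
    unfolding sum_square_expand by (intro Bochner_Integration.integral_sum Bochner_Integration.integrable_sum i)
  also have "\<dots> = (\<Sum>x\<in>F. \<Sum>y\<in>F. LINT z|M. c x * c y * (f x z * f y z))"
    by (intro sum.cong refl Bochner_Integration.integral_sum i)
  also have "\<dots> = qform k F c c"
    unfolding qform_def using assms(3) by (intro sum.cong refl) simp
  finally show "(LINT z|M. (\<Sum>x\<in>F. c x * f x z)\<^sup>2) = qform k F c c" .
qed

lemma centered_gaussian_process_square_integrable:
  assumes "centered_gaussian_process M I G" "i \<in> I"
  shows "G i \<in> borel_measurable M" "integrable M (\<lambda>\<omega>. (G i \<omega>)\<^sup>2)"
proof -
  have "finite {i} \<and> {i} \<subseteq> I" using assms(2) by simp
  with assms(1) have "centered_gaussian_rv M (\<lambda>\<omega>. \<Sum>i\<in>{i}. 1 * G i \<omega>)"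
    unfolding centered_gaussian_process_def by (elim conjE allE[of _ "{i}"] allE[of _ "\<lambda>_. 1"]) simp
  then have *: "centered_gaussian_rv M (G i)" by simp
  then show "G i \<in> borel_measurable M" by (simp add: centered_gaussian_rv_def)
  show "integrable M (\<lambda>\<omega>. (G i \<omega>)\<^sup>2)"
    using assms * by (intro centered_gaussian_rv_char(2)) (auto simp: centered_gaussian_process_def)
qed

lemma centered_gaussian_processD:
  assumes "centered_gaussian_process M I G"
  shows "prob_space M"
    "finite F \<Longrightarrow> F \<subseteq> I \<Longrightarrow> centered_gaussian_rv M (\<lambda>\<omega>. \<Sum>i\<in>F. a i * G i \<omega>)"
  using assms by (simp_all add: centered_gaussian_process_def)

lemma centered_gaussian_process_char:
  assumes "centered_gaussian_process M I G"
    and cov: "\<And>i j. i \<in> I \<Longrightarrow> j \<in> I \<Longrightarrow> (LINT \<omega>|M. G i \<omega> * G j \<omega>) = C i j"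
  shows "gaussian_char M I G C"
  unfolding gaussian_char_def
proof (intro conjI allI ballI impI)
  show "prob_space M" using assms by (simp add: centered_gaussian_process_def)
  note sq = centered_gaussian_process_square_integrable[OF assms(1)]
  show "G i \<in> borel_measurable M" if "i \<in> I" for i using sq that by auto
  fix F u assume F: "finite F \<and> F \<subseteq> I"
  have "(LINT \<omega>|M. (\<Sum>i\<in>F. u i * G i \<omega>)\<^sup>2) = qform C F u u"
    using F sq cov by (intro qform_square_integral(2)) (auto simp: subset_iff)
  moreover have "prob_space M" "centered_gaussian_rv M (\<lambda>\<omega>. \<Sum>i\<in>F. u i * G i \<omega>)"
    using F by (simp_all only: centered_gaussian_processD[OF assms(1)])
  ultimately show "(CLINT \<omega>|M. iexp (\<Sum>i\<in>F. u i * G i \<omega>)) = complex_of_real (exp (- qform C F u u / 2))"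
    by (simp only: centered_gaussian_rv_char(1))
qed

text \<open>\<open>\<kappa>\<close> need not be injective, since different indices may carry the
  same integrand; the coefficients are collected over its fibres.\<close>

lemma centered_gaussian_process_reindex:
  assumes "centered_gaussian_process M J G" and \<kappa>: "\<And>i. i \<in> I \<Longrightarrow> \<kappa> i \<in> J"
  shows "centered_gaussian_process M I (\<lambda>i. G (\<kappa> i))"
  unfolding centered_gaussian_process_def
proof (intro conjI allI impI)
  show "prob_space M" using assms by (simp add: centered_gaussian_process_def)
  fix F a assume F: "finite F \<and> F \<subseteq> I"
  have "(\<lambda>\<omega>. \<Sum>i\<in>F. a i * G (\<kappa> i) \<omega>) = (\<lambda>\<omega>. \<Sum>k\<in>\<kappa> ` F. (\<Sum>i\<in>{i\<in>F. \<kappa> i = k}. a i) * G k \<omega>)"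
  proof
    fix \<omega>
    have "(\<Sum>i\<in>F. a i * G (\<kappa> i) \<omega>) = (\<Sum>k\<in>\<kappa> ` F. \<Sum>i\<in>{i\<in>F. \<kappa> i = k}. a i * G (\<kappa> i) \<omega>)"
      using F by (intro sum.image_gen) simp
    also have "\<dots> = (\<Sum>k\<in>\<kappa> ` F. (\<Sum>i\<in>{i\<in>F. \<kappa> i = k}. a i) * G k \<omega>)"
      unfolding sum_distrib_right by (intro sum.cong refl) simp
    finally show "(\<Sum>i\<in>F. a i * G (\<kappa> i) \<omega>) = (\<Sum>k\<in>\<kappa> ` F. (\<Sum>i\<in>{i\<in>F. \<kappa> i = k}. a i) * G k \<omega>)" .
  qed
  moreover have "finite (\<kappa> ` F) \<and> \<kappa> ` F \<subseteq> J" using F \<kappa> by auto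
  then have "centered_gaussian_rv M (\<lambda>\<omega>. \<Sum>k\<in>\<kappa> ` F. (\<Sum>i\<in>{i\<in>F. \<kappa> i = k}. a i) * G k \<omega>)"
    by (intro centered_gaussian_processD(2)[OF assms(1)]) auto
  ultimately show "centered_gaussian_rv M (\<lambda>\<omega>. \<Sum>i\<in>F. a i * G (\<kappa> i) \<omega>)" by simp
qed

section \<open>Mixed moments of Wiener integrals\<close>

lemma L2_add:
  assumes "f \<in> L2 \<mu>" "g \<in> L2 \<mu>"
  shows "(\<lambda>z. a * f z + b * g z) \<in> L2 \<mu>" "integrable \<mu> (\<lambda>z. f z * g z)"
proof -
  have [measurable]: "f \<in> borel_measurable \<mu>" "g \<in> borel_measurable \<mu>"
    and i: "integrable \<mu> (\<lambda>x. (f x)\<^sup>2)" "integrable \<mu> (\<lambda>x. (g x)\<^sup>2)" using assms by (auto simp: L2_def)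
  show fg: "integrable \<mu> (\<lambda>z. f z * g z)" using i by (intro integrable_mult_of_squares) auto
  have "(a * f z + b * g z)\<^sup>2 = a\<^sup>2 * (f z)\<^sup>2 + (2 * a * b) * (f z * g z) + b\<^sup>2 * (g z)\<^sup>2" for z
    by (simp add: power2_eq_square algebra_simps)
  then show "(\<lambda>z. a * f z + b * g z) \<in> L2 \<mu>" using i fg by (simp add: L2_def)
qed

text \<open>Polarization: the isometry is given for single integrands only, and almost sure
  linearity on \<open>f + g\<close> recovers the mixed moments.\<close>

lemma white_noise_covariance:
  assumes W: "white_noise M \<mu> W" and f: "f \<in> L2 \<mu>" and g: "g \<in> L2 \<mu>"
  shows "(LINT \<omega>|M. W f \<omega> * W g \<omega>) = (LINT z|\<mu>. f z * g z)"
proof -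
  have cg: "centered_gaussian_process M (L2 \<mu>) W"
    and lin: "\<And>a b. AE \<omega> in M. W (\<lambda>z. a * f z + b * g z) \<omega> = a * W f \<omega> + b * W g \<omega>"
    and iso: "\<And>h. h \<in> L2 \<mu> \<Longrightarrow> (LINT \<omega>|M. (W h \<omega>)\<^sup>2) = (LINT z|\<mu>. (h z)\<^sup>2)"
    using W f g by (auto simp: white_noise_def)
  note sq = centered_gaussian_process_square_integrable[OF cg]
  note [measurable] = sq(1)[OF f] sq(1)[OF g]
  have fg: "(\<lambda>z. 1 * f z + 1 * g z) \<in> L2 \<mu>" using f g by (rule L2_add)
  note [measurable] = sq(1)[OF fg]
  have i: "integrable M (\<lambda>\<omega>. W f \<omega> * W g \<omega>)"
    using sq f g by (intro integrable_mult_of_squares) auto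
  have "(LINT \<omega>|M. (W f \<omega>)\<^sup>2) + 2 * (LINT \<omega>|M. W f \<omega> * W g \<omega>) + (LINT \<omega>|M. (W g \<omega>)\<^sup>2)
     = (LINT \<omega>|M. (W f \<omega>)\<^sup>2 + 2 * (W f \<omega> * W g \<omega>) + (W g \<omega>)\<^sup>2)"
    using i sq(2)[OF f] sq(2)[OF g] by simp
  also have "\<dots> = (LINT \<omega>|M. (W (\<lambda>z. 1 * f z + 1 * g z) \<omega>)\<^sup>2)"
  proof (intro integral_cong_AE)
    show "AE \<omega> in M. (W f \<omega>)\<^sup>2 + 2 * (W f \<omega> * W g \<omega>) + (W g \<omega>)\<^sup>2 = (W (\<lambda>z. 1 * f z + 1 * g z) \<omega>)\<^sup>2"
      using lin[of 1 1] by eventually_elim (simp add: power2_eq_square algebra_simps)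
  qed measurable
  also have "\<dots> = (LINT z|\<mu>. (f z)\<^sup>2 + 2 * (f z * g z) + (g z)\<^sup>2)"
    unfolding iso[OF fg] by (intro Bochner_Integration.integral_cong) (auto simp: power2_eq_square algebra_simps)
  also have "\<dots> = (LINT z|\<mu>. (f z)\<^sup>2) + 2 * (LINT z|\<mu>. f z * g z) + (LINT z|\<mu>. (g z)\<^sup>2)"
    using f g L2_add(2)[OF f g] by (simp add: L2_def)
  finally show ?thesis using iso[OF f] iso[OF g] by simp
qed

section \<open>Independence of uncorrelated jointly Gaussian fields\<close>

lemma char_pair_prod:
  fixes f :: "'w \<Rightarrow> real" and g :: "'v \<Rightarrow> real"
  assumes "prob_space M" "prob_space N" and [measurable]: "f \<in> borel_measurable M" "g \<in> borel_measurable N"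
  shows "(CLINT z|M \<Otimes>\<^sub>M N. iexp (f (fst z) + g (snd z))) = (CLINT x|M. iexp (f x)) * (CLINT y|N. iexp (g y))"
proof -
  interpret M: prob_space M by fact
  interpret N: prob_space N by fact
  interpret P: pair_prob_space M N ..
  have "integrable (M \<Otimes>\<^sub>M N) (\<lambda>(x, y). iexp (f x + g y))"
    by (rule P.integrable_const_bound[where B=1]) (auto simp: norm_exp_i_times simp del: of_real_add)
  from P.integral_fst'[OF this]
  have "(CLINT z|M \<Otimes>\<^sub>M N. iexp (f (fst z) + g (snd z))) = (CLINT x|M. (CLINT y|N. iexp (f x + g y)))"
    by (simp add: split_beta')
  also have "\<dots> = (CLINT x|M. (CLINT y|N. iexp (f x) * iexp (g y)))"
    by (simp add: exp_add[symmetric] distrib_left)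
  also have "\<dots> = (CLINT x|M. iexp (f x) * (CLINT y|N. iexp (g y)))"
    by simp
  finally show ?thesis by simp
qed

lemma sum_bool_Times:
  fixes f :: "bool \<times> 'a \<Rightarrow> 'b::comm_monoid_add"
  assumes "finite F"
  shows "(\<Sum>i\<in>F. f i) = (\<Sum>x\<in>{x. (True, x) \<in> F}. f (True, x)) + (\<Sum>x\<in>{x. (False, x) \<in> F}. f (False, x))"
proof -
  define A where "A b = Pair b ` {x. (b, x) \<in> F}" for b
  have F: "F = A True \<union> A False" 
  proof (intro equalityI subsetI)
    fix i assume "i \<in> F"
    then show "i \<in> A True \<union> A False" by (cases i; cases "fst i") (auto simp: A_def)
  qed (auto simp: A_def)
  have "A b \<subseteq> F" for b by (auto simp: A_def)
  then have "finite (A b)" for b using assms finite_subset by blast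
  moreover have "A True \<inter> A False = {}" by (auto simp: A_def)
  ultimately have "(\<Sum>i\<in>F. f i) = (\<Sum>i\<in>A True. f i) + (\<Sum>i\<in>A False. f i)"
    by (subst F) (rule sum.union_disjoint)
  then show ?thesis by (simp add: A_def sum.reindex inj_on_def)
qed

lemma finite_bool_Times_section: "finite F \<Longrightarrow> finite {x. (b, x) \<in> F}"
  by (rule finite_subset[of _ "snd ` F"]) (auto intro: rev_image_eqI)

lemma qform_bool_Times:
  assumes "finite F"
    and "\<And>x y. k (True, x) (True, y) = k1 x y" "\<And>x y. k (False, x) (False, y) = k2 x y"
      "\<And>x y. k (True, x) (False, y) = 0" "\<And>x y. k (False, x) (True, y) = 0"
  shows "qform k F u u =
    qform k1 {x. (True, x) \<in> F} (\<lambda>x. u (True, x)) (\<lambda>x. u (True, x)) +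
    qform k2 {x. (False, x) \<in> F} (\<lambda>x. u (False, x)) (\<lambda>x. u (False, x))"
  unfolding qform_def sum_bool_Times[OF assms(1)] by (simp add: assms)

text \<open>The tag in \<open>bool\<close> merges both fields into one, whose form splits into the
  two diagonal blocks of \<open>C\<close>. The same form belongs to independent copies on a product
  space, so the joint law is that of an independent pair.\<close>

lemma gaussian_char_uncorrelated_indep:
  fixes S V :: "'i \<Rightarrow> 'w \<Rightarrow> real"
  assumes S: "gaussian_char M UNIV S CS" and V: "gaussian_char M UNIV V CV"
    and H: "gaussian_char M UNIV (\<lambda>i. if fst i then S (snd i) else V (snd i)) C"
    and C: "\<And>x y. C (True, x) (True, y) = CS x y" "\<And>x y. C (False, x) (False, y) = CV x y"
      "\<And>x y. C (True, x) (False, y) = 0" "\<And>x y. C (False, x) (True, y) = 0"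
  shows "indep_fields M S V"
proof -
  interpret prob_space M using S by (rule gaussian_charD)
  interpret MM: pair_prob_space M M ..
  have [measurable]: "S x \<in> borel_measurable M" "V x \<in> borel_measurable M" for x
    using gaussian_charD(2)[OF S] gaussian_charD(2)[OF V] by auto
  define H' where "H' i = (if fst i then (\<lambda>z. S (snd i) (fst z)) else (\<lambda>z. V (snd i) (snd z)))" for i
  have "gaussian_char (M \<Otimes>\<^sub>M M) UNIV H' C"
    unfolding gaussian_char_def
  proof (intro conjI allI ballI impI)
    show "prob_space (M \<Otimes>\<^sub>M M)" by (rule MM.prob_space_axioms)
    show "H' i \<in> borel_measurable (M \<Otimes>\<^sub>M M)" for i by (simp add: H'_def)
    fix F :: "(bool \<times> 'i) set" and u assume "finite F \<and> F \<subseteq> UNIV"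
    then have F: "finite F" by simp
    let ?F1 = "{x. (True, x) \<in> F}" and ?F2 = "{x. (False, x) \<in> F}"
    have fin: "finite ?F1" "finite ?F2" using F by (rule finite_bool_Times_section)+
    have "(CLINT z|M \<Otimes>\<^sub>M M. iexp (\<Sum>i\<in>F. u i * H' i z)) =
      (CLINT z|M \<Otimes>\<^sub>M M. iexp ((\<Sum>x\<in>?F1. u (True, x) * S x (fst z)) + (\<Sum>x\<in>?F2. u (False, x) * V x (snd z))))"
      unfolding sum_bool_Times[OF F] by (simp add: H'_def)
    also have "\<dots> = (CLINT \<omega>|M. iexp (\<Sum>x\<in>?F1. u (True, x) * S x \<omega>)) * (CLINT \<omega>|M. iexp (\<Sum>x\<in>?F2. u (False, x) * V x \<omega>))"
      by (rule char_pair_prod) (auto intro: prob_space_axioms)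
    also have "\<dots> = complex_of_real (exp (- qform C F u u / 2))"
      unfolding gaussian_charD(3)[OF S fin(1) subset_UNIV, of "\<lambda>x. u (True, x)"]
        gaussian_charD(3)[OF V fin(2) subset_UNIV, of "\<lambda>x. u (False, x)"]
        qform_bool_Times[where k=C, OF F C] of_real_mult[symmetric] exp_add[symmetric]
      by (simp add: add_divide_distrib)
    finally show "(CLINT z|M \<Otimes>\<^sub>M M. iexp (\<Sum>i\<in>F. u i * H' i z)) = complex_of_real (exp (- qform C F u u / 2))" .
  qed
  from gaussian_char_law_eq[OF H this]
  have law: "distr M (PiM UNIV (\<lambda>_. borel)) (\<lambda>\<omega> i. if fst i then S (snd i) \<omega> else V (snd i) \<omega>) =
      distr (M \<Otimes>\<^sub>M M) (PiM UNIV (\<lambda>_. borel)) (\<lambda>z i. H' i z)"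
    by (simp add: restrict_def if_distrib[of "\<lambda>f. f _"])
  define P where "P = (PiM UNIV (\<lambda>_. borel) :: ('i \<Rightarrow> real) measure)"
  \<comment> \<open>Undoes the merging: the equality of laws over the tagged index set becomes one
    for pairs of fields.\<close>
  define \<Phi> where "\<Phi> h = ((\<lambda>x. h (True, x)), (\<lambda>x. h (False, x)))" for h :: "bool \<times> 'i \<Rightarrow> real"
  have \<Phi>[measurable]: "\<Phi> \<in> measurable (PiM UNIV (\<lambda>_. borel)) (P \<Otimes>\<^sub>M P)"
    unfolding \<Phi>_def P_def by (intro measurable_Pair measurable_PiM_single') (auto simp: space_PiM)
  have mS[measurable]: "(\<lambda>\<omega> x. S x \<omega>) \<in> measurable M P" and mV[measurable]: "(\<lambda>\<omega> x. V x \<omega>) \<in> measurable M P"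
    unfolding P_def by (intro measurable_PiM_single'; simp add: space_PiM)+
  have mH: "(\<lambda>\<omega> i. if fst i then S (snd i) \<omega> else V (snd i) \<omega>) \<in> measurable M (PiM UNIV (\<lambda>_. borel))"
    by (intro measurable_PiM_single') (auto simp: space_PiM)
  have mH': "(\<lambda>z i. H' i z) \<in> measurable (M \<Otimes>\<^sub>M M) (PiM UNIV (\<lambda>_. borel))"
    by (intro measurable_PiM_single') (auto simp: space_PiM H'_def)
  have "distr M (P \<Otimes>\<^sub>M P) (\<lambda>\<omega>. ((\<lambda>x. S x \<omega>), (\<lambda>x. V x \<omega>))) =
      distr (distr M (PiM UNIV (\<lambda>_. borel)) (\<lambda>\<omega> i. if fst i then S (snd i) \<omega> else V (snd i) \<omega>)) (P \<Otimes>\<^sub>M P) \<Phi>"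
    by (subst distr_distr[OF \<Phi> mH]) (simp add: comp_def \<Phi>_def)
  also have "\<dots> = distr (M \<Otimes>\<^sub>M M) (P \<Otimes>\<^sub>M P) (\<lambda>(\<omega>, \<omega>'). ((\<lambda>x. S x \<omega>), (\<lambda>x. V x \<omega>')))"
    unfolding law by (subst distr_distr[OF \<Phi> mH']) (simp add: comp_def \<Phi>_def H'_def split_beta')
  also have "\<dots> = distr M P (\<lambda>\<omega> x. S x \<omega>) \<Otimes>\<^sub>M distr M P (\<lambda>\<omega> x. V x \<omega>)"
    by (rule pair_measure_distr[symmetric, OF mS mV])
       (intro prob_space_imp_sigma_finite prob_space_distr mV)
  finally show ?thesis
    unfolding indep_fields_def indep_var_distribution_eq P_def[symmetric] using mS mV by simp
qed

section \<open>Orthonormal systems for positive semidefinite kernels\<close>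

text \<open>Symmetry is demanded separately: over the reals it does not follow from the form being
  nonnegative.\<close>

definition psd_on :: "('i \<Rightarrow> 'i \<Rightarrow> real) \<Rightarrow> 'i set \<Rightarrow> bool" where
  "psd_on k F \<longleftrightarrow> (\<forall>x\<in>F. \<forall>y\<in>F. k x y = k y x) \<and> (\<forall>c. 0 \<le> qform k F c c)"

lemma qform_alt: "qform k F c d = (\<Sum>y\<in>F. d y * (\<Sum>x\<in>F. c x * k x y))"
  unfolding qform_def by (subst sum.swap) (simp add: sum_distrib_left algebra_simps)

lemma qform_commute: "psd_on k F \<Longrightarrow> qform k F c d = qform k F d c"
  unfolding qform_def psd_on_def by (subst sum.swap) (intro sum.cong refl, simp add: mult.commute)

lemma qform_add_left: "qform k F (\<lambda>x. c x + c' x) d = qform k F c d + qform k F c' d"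
  by (simp add: qform_def algebra_simps sum.distrib)

lemma qform_scale_left: "qform k F (\<lambda>x. a * c x) d = a * qform k F c d"
  by (simp add: qform_def sum_distrib_left algebra_simps)

lemma qform_add_right: "qform k F c (\<lambda>x. d x + d' x) = qform k F c d + qform k F c d'"
  by (simp add: qform_def algebra_simps sum.distrib)

lemma qform_scale_right: "qform k F c (\<lambda>x. a * d x) = a * qform k F c d"
  by (simp add: qform_def sum_distrib_left algebra_simps)

lemma qform_sum_left: "qform k F (\<lambda>x. \<Sum>i\<in>I. a i * c i x) d = (\<Sum>i\<in>I. a i * qform k F (c i) d)"
proof (induction I rule: infinite_finite_induct)
  case (insert i I)
  then show ?case by (simp add: qform_add_left qform_scale_left)
qed (simp_all add: qform_def)

lemma qform_sum_right: "qform k F d (\<lambda>x. \<Sum>i\<in>I. a i * c i x) = (\<Sum>i\<in>I. a i * qform k F d (c i))"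
proof (induction I rule: infinite_finite_induct)
  case (insert i I)
  then show ?case by (simp add: qform_add_right qform_scale_right)
qed (simp_all add: qform_def)

lemma qform_diff_left: "qform k F (\<lambda>x. c x - c' x) d = qform k F c d - qform k F c' d"
  by (simp add: qform_def algebra_simps sum_subtractf)

lemma qform_diff_right: "qform k F c (\<lambda>x. d x - d' x) = qform k F c d - qform k F c d'"
  by (simp add: qform_def algebra_simps sum_subtractf)

lemma sum_of_bool_eq_mult:
  fixes g :: "'i \<Rightarrow> real"
  assumes "finite F" "y \<in> F"
  shows "(\<Sum>z\<in>F. of_bool (z = y) * g z) = g y"
  using assms by (simp add: of_bool_def if_distrib[of "\<lambda>a. a * _"] cong: if_cong)

lemma qform_unit: "finite F \<Longrightarrow> y \<in> F \<Longrightarrow> qform k F c (\<lambda>x. of_bool (x = y)) = (\<Sum>x\<in>F. c x * k x y)"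
  by (simp only: qform_alt sum_of_bool_eq_mult)

lemma qform_Cauchy_Schwarz:
  assumes "psd_on k F"
  shows "(qform k F c d)\<^sup>2 \<le> qform k F c c * qform k F d d"
proof -
  let ?A = "qform k F c c" and ?B = "qform k F c d" and ?D = "qform k F d d"
  have pos: "0 \<le> a\<^sup>2 * ?A + 2 * a * b * ?B + b\<^sup>2 * ?D" for a b
  proof -
    have "0 \<le> qform k F (\<lambda>x. a * c x + b * d x) (\<lambda>x. a * c x + b * d x)"
      using assms by (simp add: psd_on_def)
    then show ?thesis
      using qform_commute[OF assms, of d c]
      by (simp add: qform_add_left qform_add_right qform_scale_left qform_scale_right power2_eq_square algebra_simps)
  qed
  have A: "0 \<le> ?A" using assms by (simp add: psd_on_def)
  show ?thesis
  proof (cases "?A = 0")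
    case True
    have "?B = 0"
    proof (rule ccontr)
      assume B: "?B \<noteq> 0"
      \<comment> \<open>The multiple of \<open>c\<close> is chosen so that the expression equals
        -1.\<close>
      have "0 \<le> 2 * (- (?D + 1) / (2 * ?B)) * ?B + ?D" using pos[of "- (?D + 1) / (2 * ?B)" 1] True by simp
      then show False using B by (simp add: field_simps)
    qed
    then show ?thesis using True by simp
  next
    case False
    have "0 \<le> ?B\<^sup>2 * ?A + 2 * ?B * (- ?A) * ?B + ?A\<^sup>2 * ?D" using pos[of ?B "- ?A"] by simp
    then have "0 \<le> ?A * (?A * ?D - ?B\<^sup>2)" by (simp add: power2_eq_square algebra_simps)
    then show ?thesis using A False by (simp add: zero_le_mult_iff)
  qed
qed

lemma psd_on_subset:
  assumes "psd_on k G" "F \<subseteq> G" "finite G"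
  shows "psd_on k F"
proof -
  have "0 \<le> qform k F c c" for c
  proof -
    let ?c = "\<lambda>x. if x \<in> F then c x else 0"
    have "qform k G ?c ?c = qform k F c c"
      unfolding qform_def using assms
      by (intro sum.mono_neutral_cong_right) (auto intro!: sum.neutral sum.mono_neutral_cong_right)
    then show ?thesis using assms(1) unfolding psd_on_def by metis
  qed
  then show ?thesis using assms unfolding psd_on_def by (meson subsetD)
qed

text \<open>Equality in Bessel's inequality: \<open>c\<close> is the point mass at \<open>x\<close>
  minus its projection on the orthonormal system, and its squared length is \<open>k x x\<close>
  minus the sum of the squared coefficients \<open>h i\<close>. The form may be degenerate, so
  \<open>c\<close> itself need not vanish.\<close>

lemma qform_residual:
  assumes fin: "finite G" and psd: "psd_on k G" and x: "x \<in> G"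
    and on: "\<And>i j. i < n \<Longrightarrow> j < n \<Longrightarrow> qform k G (e i) (e j) = of_bool (i = j)"
    and h: "\<And>i. i < n \<Longrightarrow> (\<Sum>z\<in>G. e i z * k z x) = h i"
    and rep: "k x x = (\<Sum>i<n. h i * h i)"
    and c: "c = (\<lambda>z. of_bool (z = x) - (\<Sum>i<n::nat. h i * e i z))"
  shows "qform k G c c = 0"
proof -
  have xx: "qform k G (\<lambda>y. of_bool (y = x)) (\<lambda>y. of_bool (y = x)) = k x x"
    by (simp only: qform_unit[OF fin x] sum_of_bool_eq_mult[OF fin x])
  have qh: "qform k G (e i) (\<lambda>y. of_bool (y = x)) = h i" if "i < n" for i
    unfolding h[OF that, symmetric] by (rule qform_unit[OF fin x])
  have hx: "qform k G (\<lambda>y. of_bool (y = x)) (e i) = h i" if "i < n" for i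
    using qh[OF that] qform_commute[OF psd] by simp
  have "qform k G c c = k x x - 2 * (\<Sum>i<n. h i * h i) + (\<Sum>i<n. h i * (\<Sum>j<n. h j * of_bool (i = j)))"
    unfolding c
    by (simp add: qform_diff_left qform_diff_right qform_sum_left qform_sum_right xx hx qh on del: of_bool_eq_0_iff)
  also have "(\<Sum>i<n. h i * (\<Sum>j<n. h j * of_bool (i = j))) = (\<Sum>i<n. h i * h i)"
    using sum_of_bool_eq_mult[of "{..<n}" _ "\<lambda>j. h j"]
    by (intro sum.cong refl arg_cong2[where f="(*)"]) (simp add: mult.commute eq_commute)
  finally show ?thesis using rep by simp
qed

text \<open>Parseval's identity at the single point \<open>x\<close> is enough: the residual there
  is a null vector, hence by Cauchy-Schwarz orthogonal to the point mass at any \<open>z\<close> in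
  \<open>G\<close>, also at a \<open>z\<close> outside the span of the system.\<close>

lemma qform_representation:
  assumes fin: "finite G" and psd: "psd_on k G" and x: "x \<in> G" and z: "z \<in> G"
    and on: "\<And>i j. i < n \<Longrightarrow> j < n \<Longrightarrow> qform k G (e i) (e j) = of_bool (i = j)"
    and rep: "k x x = (\<Sum>i<n. (\<Sum>w\<in>G. e i w * k w x) * (\<Sum>w\<in>G. e i w * k w x))"
  shows "k x z = (\<Sum>i<n::nat. (\<Sum>w\<in>G. e i w * k w x) * (\<Sum>w\<in>G. e i w * k w z))"
proof -
  define h where "h i y = (\<Sum>w\<in>G. e i w * k w y)" for i y
  define c where "c = (\<lambda>w. of_bool (w = x) - (\<Sum>i<n. h i x * e i w))"
  have "qform k G c c = 0"
    by (rule qform_residual[OF fin psd x on h_def[symmetric] _ c_def]) (simp_all add: rep h_def)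
  then have "(qform k G c (\<lambda>y. of_bool (y = z)))\<^sup>2 \<le> 0"
    using qform_Cauchy_Schwarz[OF psd, of c "\<lambda>y. of_bool (y = z)"] by simp
  then have "0 = qform k G c (\<lambda>y. of_bool (y = z))" by simp
  also have "\<dots> = k x z - (\<Sum>i<n. h i x * h i z)"
    unfolding c_def qform_diff_left qform_sum_left qform_unit[OF fin z] sum_of_bool_eq_mult[OF fin x] h_def ..
  finally show ?thesis by (simp add: h_def)
qed

text \<open>The kernel may be singular, so \<open>n\<close> may be smaller than the number of
  points. The vectors are weights on \<open>F\<close>; that they span everything up to null vectors
  is recorded as the factorisation of \<open>k\<close> in the last clause.\<close>

lemma gram_schmidt:
  assumes "finite F" "psd_on k F"
  shows "\<exists>n e. (\<forall>i<n. \<forall>j<n. qform k F (e i) (e j) = of_bool (i = j)) \<and>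
     (\<forall>i<n. \<forall>z. z \<notin> F \<longrightarrow> e i z = 0) \<and>
     (\<forall>x\<in>F. \<forall>y\<in>F. k x y = (\<Sum>i<n::nat. (\<Sum>z\<in>F. e i z * k z x) * (\<Sum>z\<in>F. e i z * k z y)))"
  using assms
proof (induction F rule: finite_induct)
  case empty
  then show ?case by (intro exI[of _ 0]) simp
next
  case (insert a F)
  let ?G = "insert a F"
  have psd: "psd_on k ?G" and fin: "finite ?G" using insert by auto
  have sym: "k x y = k y x" if "x \<in> ?G" "y \<in> ?G" for x y using psd that by (auto simp: psd_on_def)
  have "psd_on k F" using psd_on_subset[OF psd _ fin] by auto
  then obtain n :: nat and e where
    on: "\<And>i j. i < n \<Longrightarrow> j < n \<Longrightarrow> qform k F (e i) (e j) = of_bool (i = j)"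
    and supp: "\<And>i z. i < n \<Longrightarrow> z \<notin> F \<Longrightarrow> e i z = 0"
    and rep: "\<And>x y. x \<in> F \<Longrightarrow> y \<in> F \<Longrightarrow> k x y = (\<Sum>i<n. (\<Sum>z\<in>F. e i z * k z x) * (\<Sum>z\<in>F. e i z * k z y))"
    using insert.IH by blast
  define h where "h i x = (\<Sum>z\<in>?G. e i z * k z x)" for i x
  have ea: "e i a = 0" if "i < n" for i using supp that insert.hyps by blast
  have hF: "(\<Sum>z\<in>F. e i z * k z x) = h i x" if "i < n" for i x
    using ea[OF that] insert.hyps by (simp add: h_def)
  have onG: "qform k ?G (e i) (e j) = of_bool (i = j)" if "i < n" "j < n" for i j
    using on[OF that] ea that insert.hyps by (simp add: qform_def)
  have repF: "k x y = (\<Sum>i<n. h i x * h i y)" if "x \<in> F" "y \<in> F" for x y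
    using rep[OF that] by (simp add: hF)
  have qh: "qform k ?G (e i) (\<lambda>y. of_bool (y = x)) = h i x" if "x \<in> ?G" for i x
    unfolding h_def by (rule qform_unit[OF fin that])
  \<comment> \<open>The entries of the new column at old points are already represented by the old
    vectors; only the entry at \<open>a\<close> itself can require a new one.\<close>
  have repa: "k x a = (\<Sum>i<n. h i x * h i a)" if x: "x \<in> F" for x
    unfolding h_def
    by (rule qform_representation[OF fin psd _ _ onG]) (use x repF in \<open>simp_all add: h_def\<close>)
  define d where "d z = of_bool (z = a) - (\<Sum>i<n. h i a * e i z)" for z
  define hd where "hd x = (\<Sum>z\<in>?G. d z * k z x)" for x
  have hd_eq: "hd x = k a x - (\<Sum>i<n. h i a * h i x)" if "x \<in> ?G" for x
  proof -
    have "hd x = qform k ?G d (\<lambda>y. of_bool (y = x))" unfolding hd_def by (rule qform_unit[symmetric, OF fin that])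
    also have "\<dots> = k a x - (\<Sum>i<n. h i a * h i x)"
    proof -
      have "qform k ?G (\<lambda>y. of_bool (y = a)) (\<lambda>y. of_bool (y = x)) = k a x"
        by (simp only: qform_unit[OF fin that] sum_of_bool_eq_mult[OF fin insertI1])
      then show ?thesis
        unfolding d_def using that
        by (simp add: qform_diff_left qform_sum_left qh)
    qed
    finally show ?thesis .
  qed
  have hdF: "hd x = 0" if "x \<in> F" for x
    using hd_eq[of x] repa[OF that] that sym[of x a] by (simp add: mult.commute)
  have qd: "qform k ?G d c = c a * hd a" for c
    unfolding qform_alt hd_def[symmetric] using insert.hyps by (simp add: hdF)
  have da: "d a = 1" by (simp add: d_def ea)
  have s: "qform k ?G d d = hd a" using qd[of d] da by simp
  then have s0: "0 \<le> hd a" using psd unfolding psd_on_def by metis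
  show ?case
  proof (cases "hd a = 0")
    case True
    have "k x y = (\<Sum>i<n. h i x * h i y)" if "x \<in> ?G" "y \<in> ?G" for x y
      using that repF[of x y] repa[of x] repa[of y] sym[of a y] hd_eq[of a] True
      by (auto simp: mult.commute)
    then show ?thesis
      using onG supp unfolding h_def by (intro exI[of _ n] exI[of _ e]) auto
  next
    case False
    with s0 have s0: "hd a > 0" by simp
    define e' where "e' i z = (if i < n then e i z else (1 / sqrt (hd a)) * d z)" for i z
    have e': "e' i = e i" if "i < n" for i using that by (simp add: e'_def fun_eq_iff)
    have e'n: "e' n = (\<lambda>z. (1 / sqrt (hd a)) * d z)" by (simp add: e'_def fun_eq_iff)
    have qe: "qform k ?G (e' n) (e i) = 0" if "i < n" for i
      unfolding e'n qform_scale_left qd using ea[OF that] by simp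
    have "qform k ?G (e' i) (e' j) = of_bool (i = j)" if ij: "i < Suc n" "j < Suc n" for i j
    proof -
      consider "i < n" "j < n" | "i < n" "j = n" | "i = n" "j < n" | "i = n" "j = n"
        using ij unfolding less_Suc_eq by blast
      then show ?thesis
      proof cases
        case 4
        then show ?thesis using s s0 by (simp add: e'n qform_scale_left[of k ?G "1 / sqrt (hd a)", simplified] qform_scale_right[of k ?G _ "1 / sqrt (hd a)", simplified] flip: power2_eq_square)
      qed (use qe qform_commute[OF psd, of "e' n"] in \<open>auto simp: e' onG\<close>)
    qed
    moreover have "e' i z = 0" if "i < Suc n" "z \<notin> ?G" for i z
      using that supp by (auto simp: e'_def d_def)
    moreover have "k x y = (\<Sum>i<Suc n. (\<Sum>z\<in>?G. e' i z * k z x) * (\<Sum>z\<in>?G. e' i z * k z y))" if "x \<in> ?G" "y \<in> ?G" for x y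
    proof -
      have 1: "(\<Sum>z\<in>?G. e' n z * k z x) = hd x / sqrt (hd a)" for x
        unfolding e'n hd_def by (simp only: sum_distrib_left sum_divide_distrib) (simp add: algebra_simps)
      have "hd x / sqrt (hd a) * (hd y / sqrt (hd a)) = hd x * hd y / hd a"
        using s0 by simp
      also have "\<dots> = (if x = a \<and> y = a then hd a else 0)" using that hdF s0 by auto
      finally have 2: "(\<Sum>i<Suc n. (\<Sum>z\<in>?G. e' i z * k z x) * (\<Sum>z\<in>?G. e' i z * k z y))
        = (\<Sum>i<n. h i x * h i y) + (if x = a \<and> y = a then hd a else 0)"
        unfolding sum.lessThan_Suc 1 by (simp add: e' h_def)
      show ?thesis
        unfolding 2 using that repF[of x y] repa[of x] repa[of y] sym[of a y] hd_eq[of a] insert.hyps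
        by (auto simp: mult.commute)
    qed
    ultimately show ?thesis by (intro exI[of _ "Suc n"] exI[of _ e']) blast
  qed
qed

section \<open>Equivalence of Gaussian laws\<close>

abbreviation std_gauss :: "'i set \<Rightarrow> ('i \<Rightarrow> real) measure" where
  "std_gauss J \<equiv> PiM J (\<lambda>_. std_normal_distribution)"

lemma sets_std_gauss: "sets (std_gauss J) = sets (PiM J (\<lambda>_. borel))"
  by (intro sets_PiM_cong) auto

lemma prob_space_std_gauss: "prob_space (std_gauss J)"
  by (intro prob_space_PiM prob_space_normal_density) simp

lemma std_normal_shift:
  assumes [measurable]: "g \<in> borel_measurable borel"
  shows "(\<integral>\<^sup>+x. g (x + r) \<partial>std_normal_distribution) =
    (\<integral>\<^sup>+x. ennreal (exp (r * x - r\<^sup>2 / 2)) * g x \<partial>std_normal_distribution)"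
proof -
  have "(\<integral>\<^sup>+x. g (x + r) \<partial>std_normal_distribution) = (\<integral>\<^sup>+x. ennreal (std_normal_density x) * g (x + r) \<partial>lborel)"
    by (subst nn_integral_density) auto
  also have "\<dots> = (\<integral>\<^sup>+x. ennreal (std_normal_density (x - r)) * g x \<partial>lborel)"
    by (subst (2) nn_integral_real_affine[where c=1 and t=r]) (auto simp: add.commute)
  also have "\<dots> = (\<integral>\<^sup>+x. ennreal (std_normal_density x) * (ennreal (exp (r * x - r\<^sup>2 / 2)) * g x) \<partial>lborel)"
  proof (intro nn_integral_cong)
    fix x :: real
    have "- (x - r)\<^sup>2 / 2 = - x\<^sup>2 / 2 + (r * x - r\<^sup>2 / 2)"
      by (simp add: power2_eq_square field_simps)
    then have "std_normal_density (x - r) = std_normal_density x * exp (r * x - r\<^sup>2 / 2)"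
      by (simp add: std_normal_density_def exp_add[symmetric])
    then show "ennreal (std_normal_density (x - r)) * g x = ennreal (std_normal_density x) * (ennreal (exp (r * x - r\<^sup>2 / 2)) * g x)"
      by (simp add: ennreal_mult mult.assoc)
  qed
  also have "\<dots> = (\<integral>\<^sup>+x. ennreal (exp (r * x - r\<^sup>2 / 2)) * g x \<partial>std_normal_distribution)"
    by (subst nn_integral_density) auto
  finally show ?thesis .
qed

text \<open>The coordinates are shifted one at a time by \<open>std_normal_shift\<close>, and the
  exponents of the one-dimensional densities add up.\<close>

lemma std_gauss_shift:
  assumes "finite J" "g \<in> borel_measurable (PiM J (\<lambda>_. borel))"
  shows "(\<integral>\<^sup>+x. g (\<lambda>i\<in>J. x i + r i) \<partial>std_gauss J) =
    (\<integral>\<^sup>+x. ennreal (exp (\<Sum>i\<in>J. r i * x i - (r i)\<^sup>2 / 2)) * g x \<partial>std_gauss J)"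
  using assms
proof (induction J arbitrary: g rule: finite_induct)
  case empty
  have "(\<lambda>i\<in>{}. x i + r i) = x" if "x \<in> space (std_gauss {})" for x
    using that by (simp add: space_PiM restrict_def fun_eq_iff)
  then show ?case by (intro nn_integral_cong) simp
next
  case (insert a J)
  interpret product_sigma_finite "\<lambda>_. std_normal_distribution"
    by standard (rule sigma_finite_measure.sigma_finite_countable[OF prob_space_imp_sigma_finite], simp add: prob_space_normal_density)
  note meas = insert.prems
  have [measurable_cong]: "sets (std_gauss K) = sets (PiM K (\<lambda>_. borel))" for K :: "'a set"
    by (rule sets_std_gauss)
  note [measurable] = meas
  have up: "(\<lambda>z. (fst z)(a := snd z)) \<in> measurable (PiM J (\<lambda>_. borel) \<Otimes>\<^sub>M borel) (PiM (insert a J) (\<lambda>_. borel))"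
    by (rule measurable_fun_upd[where J=J]) auto
  have g2[measurable]: "(\<lambda>z. g ((fst z)(a := snd z))) \<in> borel_measurable (PiM J (\<lambda>_. borel) \<Otimes>\<^sub>M borel)"
    by (rule measurable_compose[OF up meas])
  have gx: "(\<lambda>y. g (x(a := y))) \<in> borel_measurable borel" if "x \<in> space (PiM J (\<lambda>_. borel))" for x
    using measurable_compose[OF measurable_Pair1'[OF that] g2] by simp
  have shiftm: "(\<lambda>x. \<lambda>i\<in>K. x i + r i) \<in> measurable (PiM K (\<lambda>_. borel)) (PiM K (\<lambda>_. borel))" for K :: "'a set"
    by (intro measurable_restrict) measurable
  define G where "G x = (\<integral>\<^sup>+y. ennreal (exp (r a * y - (r a)\<^sup>2 / 2)) * g (x(a := y)) \<partial>std_normal_distribution)" for x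
  have G: "G \<in> borel_measurable (PiM J (\<lambda>_. borel))"
  proof -
    interpret sigma_finite_measure std_normal_distribution
      by (rule prob_space_imp_sigma_finite) (simp add: prob_space_normal_density)
    have "(\<lambda>(x, y). ennreal (exp (r a * y - (r a)\<^sup>2 / 2)) * g (x(a := y)))
        \<in> borel_measurable (PiM J (\<lambda>_. borel) \<Otimes>\<^sub>M std_normal_distribution)"
      using g2 unfolding split_beta' by measurable
    then show ?thesis unfolding G_def by (rule borel_measurable_nn_integral)
  qed
  have "(\<integral>\<^sup>+x. g (\<lambda>i\<in>insert a J. x i + r i) \<partial>std_gauss (insert a J)) =
     (\<integral>\<^sup>+x. (\<integral>\<^sup>+y. g (\<lambda>i\<in>insert a J. (x(a := y)) i + r i) \<partial>std_normal_distribution) \<partial>std_gauss J)"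
    using measurable_compose[OF shiftm[of "insert a J"] meas] insert.hyps
    by (intro product_nn_integral_insert) auto
  also have "\<dots> = (\<integral>\<^sup>+x. G (\<lambda>i\<in>J. x i + r i) \<partial>std_gauss J)"
  proof (intro nn_integral_cong)
    fix x assume "x \<in> space (std_gauss J)"
    have sp: "(\<lambda>i\<in>J. x i + r i) \<in> space (PiM J (\<lambda>_. borel))" by (simp add: space_PiM)
    have "(\<lambda>i\<in>insert a J. (x(a := y)) i + r i) = (\<lambda>i\<in>J. x i + r i)(a := y + r a)" for y
      using insert.hyps by (auto simp: fun_eq_iff)
    then show "(\<integral>\<^sup>+y. g (\<lambda>i\<in>insert a J. (x(a := y)) i + r i) \<partial>std_normal_distribution) = G (\<lambda>i\<in>J. x i + r i)"
      unfolding G_def using std_normal_shift[OF gx[OF sp], of "r a"] by simp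
  qed
  also have "\<dots> = (\<integral>\<^sup>+x. ennreal (exp (\<Sum>i\<in>J. r i * x i - (r i)\<^sup>2 / 2)) * G x \<partial>std_gauss J)"
    by (rule insert.IH[OF G])
  also have "\<dots> = (\<integral>\<^sup>+x. (\<integral>\<^sup>+y. ennreal (exp (\<Sum>i\<in>insert a J. r i * (x(a := y)) i - (r i)\<^sup>2 / 2)) * g (x(a := y)) \<partial>std_normal_distribution) \<partial>std_gauss J)"
  proof (intro nn_integral_cong)
    fix x assume "x \<in> space (std_gauss J)"
    then have sp: "x \<in> space (PiM J (\<lambda>_. borel))" by (simp add: space_PiM)
    note [measurable] = gx[OF sp]
    have "(\<Sum>i\<in>insert a J. r i * (x(a := y)) i - (r i)\<^sup>2 / 2) = (r a * y - (r a)\<^sup>2 / 2) + (\<Sum>i\<in>J. r i * x i - (r i)\<^sup>2 / 2)" for y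
    proof -
      have "(\<Sum>i\<in>J. r i * (x(a := y)) i - (r i)\<^sup>2 / 2) = (\<Sum>i\<in>J. r i * x i - (r i)\<^sup>2 / 2)"
        using insert.hyps by (intro sum.cong refl) auto
      then show ?thesis by (simp only: sum.insert[OF insert.hyps] fun_upd_same)
    qed
    then show "ennreal (exp (\<Sum>i\<in>J. r i * x i - (r i)\<^sup>2 / 2)) * G x =
       (\<integral>\<^sup>+y. ennreal (exp (\<Sum>i\<in>insert a J. r i * (x(a := y)) i - (r i)\<^sup>2 / 2)) * g (x(a := y)) \<partial>std_normal_distribution)"
      unfolding G_def by (simp add: nn_integral_cmult[symmetric] exp_add ennreal_mult mult_ac)
  qed
  also have "\<dots> = (\<integral>\<^sup>+x. ennreal (exp (\<Sum>i\<in>insert a J. r i * x i - (r i)\<^sup>2 / 2)) * g x \<partial>std_gauss (insert a J))"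
    using insert.hyps by (intro product_nn_integral_insert[symmetric]) (auto simp: measurable_cong_sets[OF sets_std_gauss refl])
  finally show ?case .
qed

text \<open>The density \<open>E\<close> of the shifted law satisfies E \<le> l + E^2 / l, and its
  second moment is the exponential of the squared length of the shift. The bound sees the shift only
  through this length and not the number of coordinates, which later makes it uniform over finite
  sets of points.\<close>

lemma std_gauss_shift_bound:
  assumes J: "finite J" and C: "C \<in> sets (PiM J (\<lambda>_. borel))" and l: "0 < l"
  shows "measure (std_gauss J) {x\<in>space (std_gauss J). (\<lambda>i\<in>J. x i + r i) \<in> C} \<le>
    l * measure (std_gauss J) C + exp (\<Sum>i\<in>J. (r i)\<^sup>2) / l"
proof -
  interpret prob_space "std_gauss J" by (rule prob_space_std_gauss)
  have [measurable_cong]: "sets (std_gauss J) = sets (PiM J (\<lambda>_. borel))"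
    by (rule sets_std_gauss)
  note [measurable] = C
  define E where "E x = exp (\<Sum>i\<in>J. r i * x i - (r i)\<^sup>2 / 2)" for x
  have E[measurable]: "E \<in> borel_measurable (PiM J (\<lambda>_. borel))" unfolding E_def by measurable
  have shiftm: "(\<lambda>x. \<lambda>i\<in>J. x i + r i) \<in> measurable (std_gauss J) (std_gauss J)"
    by (intro measurable_restrict) (auto simp: measurable_cong_sets[OF sets_std_gauss refl])
  have "ennreal (measure (std_gauss J) {x\<in>space (std_gauss J). (\<lambda>i\<in>J. x i + r i) \<in> C}) =
      (\<integral>\<^sup>+x. indicator C (\<lambda>i\<in>J. x i + r i) \<partial>std_gauss J)"
  proof -
    let ?B = "{x\<in>space (std_gauss J). (\<lambda>i\<in>J. x i + r i) \<in> C}"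
    have "?B = (\<lambda>x. \<lambda>i\<in>J. x i + r i) -` C \<inter> space (std_gauss J)" by auto
    then have B: "?B \<in> sets (std_gauss J)"
      using measurable_sets[OF shiftm, of C] C by (simp add: sets_std_gauss)
    have "(\<integral>\<^sup>+x. indicator C (\<lambda>i\<in>J. x i + r i) \<partial>std_gauss J) = (\<integral>\<^sup>+x. indicator ?B x \<partial>std_gauss J)"
      by (intro nn_integral_cong) (simp add: indicator_def)
    then show ?thesis using B by (simp add: emeasure_eq_measure)
  qed
  also have "\<dots> = (\<integral>\<^sup>+x. ennreal (E x) * indicator C x \<partial>std_gauss J)"
    unfolding E_def by (rule std_gauss_shift[OF J]) simp
  also have "\<dots> \<le> (\<integral>\<^sup>+x. ennreal l * indicator C x + ennreal (1 / l) * ennreal ((E x)\<^sup>2) \<partial>std_gauss J)"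
  proof (intro nn_integral_mono)
    fix x
    have "E x \<le> l + (1 / l) * (E x)\<^sup>2"
    proof (cases "E x \<le> l")
      case True
      then show ?thesis using l by (smt (verit) zero_le_power2 divide_nonneg_pos mult_nonneg_nonneg)
    next
      case False
      then have "l * E x \<le> E x * E x" using l by (intro mult_right_mono) auto
      then show ?thesis using l by (simp add: field_simps power2_eq_square) (smt (verit) mult_pos_pos)
    qed
    then have "ennreal (E x) \<le> ennreal l + ennreal (1 / l) * ennreal ((E x)\<^sup>2)"
      using l by (simp add: ennreal_mult[symmetric] ennreal_plus[symmetric] del: ennreal_plus)
    then show "ennreal (E x) * indicator C x \<le> ennreal l * indicator C x + ennreal (1 / l) * ennreal ((E x)\<^sup>2)"
      by (auto simp: indicator_def)
  qed
  also have "\<dots> = ennreal l * emeasure (std_gauss J) C + ennreal (1 / l) * (\<integral>\<^sup>+x. ennreal ((E x)\<^sup>2) \<partial>std_gauss J)"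
    using C by (simp add: nn_integral_add nn_integral_cmult sets_std_gauss)
  also have "(\<integral>\<^sup>+x. ennreal ((E x)\<^sup>2) \<partial>std_gauss J) = ennreal (exp (\<Sum>i\<in>J. (r i)\<^sup>2))"
  proof -
    \<comment> \<open>Up to a constant, the square of the density for the shift \<open>r\<close> is
      the density for the shift \<open>2 * r\<close>, whose integral is 1.\<close>
    have "(E x)\<^sup>2 = exp (\<Sum>i\<in>J. (r i)\<^sup>2) * exp (\<Sum>i\<in>J. (2 * r i) * x i - (2 * r i)\<^sup>2 / 2)" for x
      by (simp add: E_def power2_eq_square exp_add[symmetric] sum.distrib[symmetric] mult.assoc)
    then have "(\<integral>\<^sup>+x. ennreal ((E x)\<^sup>2) \<partial>std_gauss J) = ennreal (exp (\<Sum>i\<in>J. (r i)\<^sup>2)) *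
        (\<integral>\<^sup>+x. ennreal (exp (\<Sum>i\<in>J. (2 * r i) * x i - (2 * r i)\<^sup>2 / 2)) * 1 \<partial>std_gauss J)"
      by (simp add: ennreal_mult nn_integral_cmult)
    also have "(\<integral>\<^sup>+x. ennreal (exp (\<Sum>i\<in>J. (2 * r i) * x i - (2 * r i)\<^sup>2 / 2)) * 1 \<partial>std_gauss J) = 1"
      using std_gauss_shift[OF J, of "\<lambda>_. 1" "\<lambda>i. 2 * r i"] emeasure_space_1 by simp
    finally show ?thesis by simp
  qed
  also have "ennreal l * emeasure (std_gauss J) C + ennreal (1 / l) * ennreal (exp (\<Sum>i\<in>J. (r i)\<^sup>2)) =
     ennreal (l * measure (std_gauss J) C + exp (\<Sum>i\<in>J. (r i)\<^sup>2) / l)"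
    using l by (simp add: emeasure_eq_measure ennreal_mult[symmetric] ennreal_plus[symmetric] del: ennreal_plus)
  finally show ?thesis using l by (subst (asm) ennreal_le_iff) (auto intro!: add_nonneg_nonneg)
qed

section \<open>Comparison of Gaussian laws on finite index sets\<close>

lemma gaussian_char_std_gauss:
  assumes F: "finite F"
    and k: "\<And>x y. x \<in> F \<Longrightarrow> y \<in> F \<Longrightarrow> k x y = (\<Sum>i<n. h i x * h i y)"
  shows "gaussian_char (std_gauss {..<n::nat}) F (\<lambda>x \<xi>. \<Sum>i<n. h i x * \<xi> i) k"
  unfolding gaussian_char_def
proof (intro conjI allI ballI impI)
  show "prob_space (std_gauss {..<n})" by (rule prob_space_std_gauss)
  have [measurable_cong]: "sets (std_gauss {..<n}) = sets (PiM {..<n} (\<lambda>_. borel))" by (rule sets_std_gauss)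
  show "(\<lambda>\<xi>. \<Sum>i<n. h i x * \<xi> i) \<in> borel_measurable (std_gauss {..<n})" for x by measurable
  interpret product_sigma_finite "\<lambda>_::nat. std_normal_distribution"
    by standard (rule sigma_finite_measure.sigma_finite_countable[OF prob_space_imp_sigma_finite], simp add: prob_space_normal_density)
  fix G u assume "finite G \<and> G \<subseteq> F"
  then have G: "finite G" "G \<subseteq> F" by auto
  define b where "b i = (\<Sum>x\<in>G. u x * h i x)" for i
  have "(\<Sum>x\<in>G. u x * (\<Sum>i<n. h i x * \<xi> i)) = (\<Sum>i<n. b i * \<xi> i)" for \<xi> :: "nat \<Rightarrow> real"
    unfolding b_def sum_distrib_left sum_distrib_right by (subst sum.swap) (simp add: mult.assoc)
  then have "(CLINT \<xi>|std_gauss {..<n}. iexp (\<Sum>x\<in>G. u x * (\<Sum>i<n. h i x * \<xi> i)))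
      = (CLINT \<xi>|std_gauss {..<n}. (\<Prod>i<n. iexp (b i * \<xi> i)))"
    by (simp add: exp_sum sum_distrib_left)
  also have "\<dots> = (\<Prod>i<n. CLINT z|std_normal_distribution. iexp (b i * z))"
  proof (rule product_integral_prod)
    fix i
    interpret prob_space std_normal_distribution by (rule prob_space_normal_density) simp
    show "integrable std_normal_distribution (\<lambda>z. iexp (b i * z))"
      by (rule integrable_const_bound[where B=1]) auto
  qed simp
  also have "\<dots> = (\<Prod>i<n. complex_of_real (exp (- (b i)\<^sup>2 / 2)))"
    using char_std_normal_distribution unfolding char_def fun_eq_iff by simp
  also have "\<dots> = complex_of_real (exp (\<Sum>i<n. - (b i)\<^sup>2 / 2))"
    by (simp add: exp_sum)
  also have "(\<Sum>i<n. - (b i)\<^sup>2 / 2) = - qform k G u u / 2"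
  proof -
    have "(\<Sum>i<n. (b i)\<^sup>2) = (\<Sum>i<n. \<Sum>x\<in>G. \<Sum>y\<in>G. u x * u y * (h i x * h i y))"
      unfolding b_def sum_square_expand ..
    also have "\<dots> = (\<Sum>x\<in>G. \<Sum>y\<in>G. \<Sum>i<n. u x * u y * (h i x * h i y))"
      by (subst sum.swap, rule sum.cong[OF refl], rule sum.swap)
    also have "\<dots> = qform k G u u"
      unfolding qform_def sum_distrib_left[symmetric] using G k by (intro sum.cong refl) (auto simp: subset_iff)
    finally show ?thesis by (simp add: sum_negf sum_divide_distrib[symmetric])
  qed
  finally show "(CLINT \<xi>|std_gauss {..<n}. iexp (\<Sum>x\<in>G. u x * (\<Sum>i<n. h i x * \<xi> i))) = complex_of_real (exp (- qform k G u u / 2))" .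
qed

text \<open>The exceptional null set may depend on the index, because each linear combination
  involves finitely many indices.\<close>

lemma gaussian_char_cong_AE:
  assumes G: "gaussian_char M I G C" and "\<And>i. i \<in> I \<Longrightarrow> H i \<in> borel_measurable M"
    and ae: "\<And>i. i \<in> I \<Longrightarrow> AE \<omega> in M. G i \<omega> = H i \<omega>"
  shows "gaussian_char M I H C"
  unfolding gaussian_char_def
proof (intro conjI allI ballI impI)
  show "prob_space M" using G by (rule gaussian_charD)
  show H: "i \<in> I \<Longrightarrow> H i \<in> borel_measurable M" for i by fact
  note [measurable] = gaussian_charD(2)[OF G]
  fix F u assume F: "finite F \<and> F \<subseteq> I"
  then have [measurable]: "G i \<in> borel_measurable M" "H i \<in> borel_measurable M" if "i \<in> F" for i
    using that H by auto
  have "AE \<omega> in M. \<forall>i\<in>F. G i \<omega> = H i \<omega>" using F ae by (intro AE_finite_allI) auto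
  then have "(CLINT \<omega>|M. iexp (\<Sum>i\<in>F. u i * H i \<omega>)) = (CLINT \<omega>|M. iexp (\<Sum>i\<in>F. u i * G i \<omega>))"
    by (intro integral_cong_AE) (measurable, auto)
  then show "(CLINT \<omega>|M. iexp (\<Sum>i\<in>F. u i * H i \<omega>)) = complex_of_real (exp (- qform C F u u / 2))"
    using gaussian_charD(3)[OF G] F by metis
qed

lemma gaussian_char_add_indep:
  assumes G: "gaussian_char M I G C" and H: "gaussian_char N I H C'"
  shows "gaussian_char (M \<Otimes>\<^sub>M N) I (\<lambda>i z. G i (fst z) + H i (snd z)) (\<lambda>x y. C x y + C' x y)"
  unfolding gaussian_char_def
proof (intro conjI allI ballI impI)
  interpret M: prob_space M using G by (rule gaussian_charD)
  interpret N: prob_space N using H by (rule gaussian_charD)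
  interpret pair_prob_space M N ..
  show "prob_space (M \<Otimes>\<^sub>M N)" by (rule prob_space_axioms)
  have m[measurable]: "G i \<in> borel_measurable M" "H i \<in> borel_measurable N" if "i \<in> I" for i
    using that gaussian_charD(2)[OF G] gaussian_charD(2)[OF H] by auto
  show "i \<in> I \<Longrightarrow> (\<lambda>z. G i (fst z) + H i (snd z)) \<in> borel_measurable (M \<Otimes>\<^sub>M N)" for i by simp
  fix F u assume F: "finite F \<and> F \<subseteq> I"
  have "(CLINT z|M \<Otimes>\<^sub>M N. iexp (\<Sum>i\<in>F. u i * (G i (fst z) + H i (snd z)))) =
      (CLINT z|M \<Otimes>\<^sub>M N. iexp ((\<Sum>i\<in>F. u i * G i (fst z)) + (\<Sum>i\<in>F. u i * H i (snd z))))"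
    by (simp add: distrib_left sum.distrib)
  also have "\<dots> = (CLINT \<omega>|M. iexp (\<Sum>i\<in>F. u i * G i \<omega>)) * (CLINT \<omega>|N. iexp (\<Sum>i\<in>F. u i * H i \<omega>))"
    using F m by (intro char_pair_prod M.prob_space_axioms N.prob_space_axioms borel_measurable_sum borel_measurable_times) auto
  also have "\<dots> = complex_of_real (exp (- qform (\<lambda>x y. C x y + C' x y) F u u / 2))"
  proof -
    have "qform (\<lambda>x y. C x y + C' x y) F u u = qform C F u u + qform C' F u u"
      by (simp add: qform_def distrib_left sum.distrib)
    then show ?thesis
      using gaussian_charD(3)[OF G] gaussian_charD(3)[OF H] F
      by (simp add: of_real_mult[symmetric] exp_add[symmetric] add_divide_distrib del: of_real_mult of_real_sum)
  qed
  finally show "(CLINT z|M \<Otimes>\<^sub>M N. iexp (\<Sum>i\<in>F. u i * (G i (fst z) + H i (snd z)))) =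
    complex_of_real (exp (- qform (\<lambda>x y. C x y + C' x y) F u u / 2))" .
qed

abbreviation cylinder :: "'w measure \<Rightarrow> 'i set \<Rightarrow> ('i \<Rightarrow> 'w \<Rightarrow> real) \<Rightarrow> ('i \<Rightarrow> real) set \<Rightarrow> 'w set" where
  "cylinder M F X D \<equiv> {\<omega>\<in>space M. (\<lambda>x\<in>F. X x \<omega>) \<in> D}"

lemma gaussian_char_cylinder_eq:
  assumes "gaussian_char M F G C" "gaussian_char N F H C" "D \<in> sets (PiM F (\<lambda>_. borel))"
  shows "measure M (cylinder M F G D) = measure N (cylinder N F H D)"
proof -
  have "(\<lambda>\<omega>. \<lambda>x\<in>F. G x \<omega>) \<in> measurable M (PiM F (\<lambda>_. borel))" "(\<lambda>\<omega>. \<lambda>x\<in>F. H x \<omega>) \<in> measurable N (PiM F (\<lambda>_. borel))"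
    using gaussian_charD(2)[OF assms(1)] gaussian_charD(2)[OF assms(2)] by (auto intro!: measurable_restrict)
  then have "measure (distr M (PiM F (\<lambda>_. borel)) (\<lambda>\<omega>. \<lambda>x\<in>F. G x \<omega>)) D = measure M (cylinder M F G D)"
    "measure (distr N (PiM F (\<lambda>_. borel)) (\<lambda>\<omega>. \<lambda>x\<in>F. H x \<omega>)) D = measure N (cylinder N F H D)"
    using assms(3) by (auto simp: measure_distr vimage_def Int_def conj_commute)
  then show ?thesis using gaussian_char_law_eq[OF assms(1,2)] by simp
qed

text \<open>\<open>U\<close> has the law of \<open>V\<close> shifted by an independent copy of \<open>R\<close>. In \<open>v\<close>-orthonormal coordinates the shift has
  squared length \<open>N\<close> with expectation at most \<open>T\<close>; the Cameron-Martin bound is used where \<open>N \<le> K\<close>, and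
  Markov's inequality elsewhere.\<close>

lemma gaussian_finite_comparison:
  fixes v r :: "'i \<Rightarrow> 'i \<Rightarrow> real"
  assumes F: "finite F" and psd: "psd_on v F"
    and dom: "\<And>c. qform r F c c \<le> C0 * qform v F c c"
    and V: "gaussian_char M F V v" and U: "gaussian_char M F U (\<lambda>x y. v x y + r x y)"
    and R: "centered_gaussian_process M F R" "\<And>x y. x \<in> F \<Longrightarrow> y \<in> F \<Longrightarrow> (LINT \<omega>|M. R x \<omega> * R y \<omega>) = r x y"
    and T: "\<And>(n::nat) e. (\<And>i j. i < n \<Longrightarrow> j < n \<Longrightarrow> qform v F (e i) (e j) = of_bool (i = j)) \<Longrightarrow>
        (\<Sum>i<n. qform r F (e i) (e i)) \<le> T"
    and K: "0 < K" and l: "0 < l" and D: "D \<in> sets (PiM F (\<lambda>_. borel))"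
  shows "measure M (cylinder M F U D) \<le>
       T / K + exp K / l + l * measure M (cylinder M F V D)"
    and "measure M (cylinder M F V D) \<le>
       T / K + exp K / l + l * measure M (cylinder M F U D)"
proof -
  interpret M: prob_space M using V by (rule gaussian_charD)
  obtain n :: nat and e where
    on: "\<And>i j. i < n \<Longrightarrow> j < n \<Longrightarrow> qform v F (e i) (e j) = of_bool (i = j)"
    and rep: "\<And>x y. x \<in> F \<Longrightarrow> y \<in> F \<Longrightarrow> v x y = (\<Sum>i<n. (\<Sum>z\<in>F. e i z * v z x) * (\<Sum>z\<in>F. e i z * v z y))"
    using gram_schmidt[OF F psd] by blast
  define h where "h i x = (\<Sum>z\<in>F. e i z * v z x)" for i x
  let ?J = "{..<n}"
  let ?\<gamma> = "std_gauss ?J"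
  interpret \<gamma>: prob_space ?\<gamma> by (rule prob_space_std_gauss)
  interpret P: pair_prob_space ?\<gamma> M ..
  have [measurable_cong]: "sets ?\<gamma> = sets (PiM ?J (\<lambda>_. borel))" by (rule sets_std_gauss)
  define L where "L x \<xi> = (\<Sum>i<n. h i x * \<xi> i)" for x and \<xi> :: "nat \<Rightarrow> real"
  have VL: "gaussian_char ?\<gamma> F L v"
    unfolding L_def[abs_def] by (rule gaussian_char_std_gauss[OF F]) (simp add: rep h_def)
  note sqR = centered_gaussian_process_square_integrable[OF R(1)]
  note [measurable] = sqR(1)
  have ER1: "integrable M (\<lambda>\<omega>. (\<Sum>x\<in>F. c x * R x \<omega>)\<^sup>2)" for c
    by (rule qform_square_integral(1)[where k=r]) (simp_all add: sqR R(2))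
  have ER2: "(LINT \<omega>|M. (\<Sum>x\<in>F. c x * R x \<omega>)\<^sup>2) = qform r F c c" for c
    by (rule qform_square_integral(2)) (simp_all add: sqR R(2))
  note ER = ER1 ER2
  define \<rho> where "\<rho> i \<omega> = (\<Sum>z\<in>F. e i z * R z \<omega>)" for i \<omega>
  have [measurable]: "\<rho> i \<in> borel_measurable M" for i unfolding \<rho>_def by measurable
  \<comment> \<open>Here the domination \<open>dom\<close> of \<open>r\<close> by \<open>v\<close>
    is used: a combination that is null for \<open>v\<close> is null for \<open>r\<close>, so
    \<open>R\<close> is recovered almost surely from its finitely many coordinates
    \<open>\<rho>\<close>.\<close>
  have RL: "AE \<omega> in M. R x \<omega> = L x (\<lambda>i. \<rho> i \<omega>)" if x: "x \<in> F" for x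
  proof -
    define c where "c = (\<lambda>z. of_bool (z = x) - (\<Sum>i<n. h i x * e i z))"
    have "qform v F c c = 0"
      by (rule qform_residual[where k=v and h="\<lambda>i. h i x" and e=e and n=n and x=x])
         (use F psd x on rep in \<open>auto simp: h_def c_def\<close>)
    then have "qform r F c c \<le> 0" using dom[of c] by simp
    moreover have eq: "(\<Sum>z\<in>F. c z * R z \<omega>) = R x \<omega> - L x (\<lambda>i. \<rho> i \<omega>)" for \<omega>
    proof -
      have "(\<Sum>z\<in>F. (\<Sum>i<n. h i x * e i z) * R z \<omega>) = L x (\<lambda>i. \<rho> i \<omega>)"
        unfolding L_def \<rho>_def sum_distrib_left sum_distrib_right by (subst sum.swap) (simp add: mult.assoc)
      then show ?thesis
        unfolding c_def left_diff_distrib sum_subtractf using sum_of_bool_eq_mult[OF F x] by simp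
    qed
    ultimately have "(LINT \<omega>|M. (R x \<omega> - L x (\<lambda>i. \<rho> i \<omega>))\<^sup>2) \<le> 0" using ER(2)[of c] by simp
    moreover have "0 \<le> (LINT \<omega>|M. (R x \<omega> - L x (\<lambda>i. \<rho> i \<omega>))\<^sup>2)" by simp
    ultimately have "(LINT \<omega>|M. (R x \<omega> - L x (\<lambda>i. \<rho> i \<omega>))\<^sup>2) = 0" by simp
    then have "AE \<omega> in M. (R x \<omega> - L x (\<lambda>i. \<rho> i \<omega>))\<^sup>2 = 0"
      using ER(1)[of c] by (subst (asm) integral_nonneg_eq_0_iff_AE) (auto simp: eq)
    then show ?thesis by eventually_elim simp
  qed
  have "gaussian_char M F R r" using R by (rule centered_gaussian_process_char)
  then have R': "gaussian_char M F (\<lambda>x \<omega>. L x (\<lambda>i. \<rho> i \<omega>)) r"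
    by (rule gaussian_char_cong_AE) (use RL in \<open>auto simp: L_def\<close>)
  have UL: "gaussian_char (?\<gamma> \<Otimes>\<^sub>M M) F (\<lambda>x z. L x (fst z) + L x (\<lambda>i. \<rho> i (snd z))) (\<lambda>x y. v x y + r x y)"
    using VL R' by (rule gaussian_char_add_indep)
  define C where "C = {\<xi>\<in>space ?\<gamma>. (\<lambda>x\<in>F. L x \<xi>) \<in> D}"
  have mL[measurable]: "(\<lambda>\<xi>. \<lambda>x\<in>F. L x \<xi>) \<in> measurable (PiM ?J (\<lambda>_. borel)) (PiM F (\<lambda>_. borel))"
    unfolding L_def by (intro measurable_restrict) measurable
  have C: "C \<in> sets (PiM ?J (\<lambda>_. borel))"
    using measurable_sets[OF mL D] unfolding C_def by (simp add: space_PiM vimage_def Int_def conj_commute)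
  have PV: "measure M (cylinder M F V D) = measure ?\<gamma> C"
    unfolding C_def by (rule gaussian_char_cylinder_eq[OF V VL D])
  \<comment> \<open>The probability of the event for a fixed value of the shift; its mean is the
    probability of the event for \<open>U\<close>.\<close>
  define \<phi> where "\<phi> \<omega> = measure ?\<gamma> {\<xi>\<in>space ?\<gamma>. (\<lambda>i\<in>?J. \<xi> i + \<rho> i \<omega>) \<in> C}" for \<omega>
  define B where "B = {z\<in>space (?\<gamma> \<Otimes>\<^sub>M M). (\<lambda>i\<in>?J. fst z i + \<rho> i (snd z)) \<in> C}"
  have Bm: "B \<in> sets (?\<gamma> \<Otimes>\<^sub>M M)"
  proof -
    have "(\<lambda>z. \<lambda>i\<in>?J. fst z i + \<rho> i (snd z)) \<in> measurable (?\<gamma> \<Otimes>\<^sub>M M) (PiM ?J (\<lambda>_. borel))"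
      by (intro measurable_restrict) measurable
    from measurable_sets[OF this C] show ?thesis
      unfolding B_def by (simp add: vimage_def Int_def conj_commute)
  qed
  have Beq: "{z\<in>space (?\<gamma> \<Otimes>\<^sub>M M). (\<lambda>x\<in>F. L x (fst z) + L x (\<lambda>i. \<rho> i (snd z))) \<in> D} = B"
    by (auto simp: B_def C_def L_def space_PiM space_pair_measure distrib_left sum.distrib)
  have PU: "measure M (cylinder M F U D) = measure (?\<gamma> \<Otimes>\<^sub>M M) B"
    unfolding Beq[symmetric] by (rule gaussian_char_cylinder_eq[OF U UL D])
  have \<phi>m[measurable]: "\<phi> \<in> borel_measurable M"
    and \<phi>int: "(\<integral>\<^sup>+\<omega>. ennreal (\<phi> \<omega>) \<partial>M) = ennreal (measure (?\<gamma> \<Otimes>\<^sub>M M) B)"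
  proof -
    have sec: "(\<lambda>\<xi>. (\<xi>, \<omega>)) -` B = {\<xi>\<in>space ?\<gamma>. (\<lambda>i\<in>?J. \<xi> i + \<rho> i \<omega>) \<in> C}" if "\<omega> \<in> space M" for \<omega>
      using that by (auto simp: B_def space_pair_measure)
    have "(\<lambda>\<omega>. measure ?\<gamma> ((\<lambda>\<xi>. (\<xi>, \<omega>)) -` B)) \<in> borel_measurable M"
      unfolding measure_def using P.measurable_emeasure_Pair2[OF Bm] by measurable
    then show "\<phi> \<in> borel_measurable M" by (rule measurable_cong[THEN iffD1, rotated]) (simp add: \<phi>_def sec)
    have "emeasure (?\<gamma> \<Otimes>\<^sub>M M) B = (\<integral>\<^sup>+\<omega>. emeasure ?\<gamma> ((\<lambda>\<xi>. (\<xi>, \<omega>)) -` B) \<partial>M)"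
      by (rule P.emeasure_pair_measure_alt2[OF Bm])
    also have "\<dots> = (\<integral>\<^sup>+\<omega>. ennreal (\<phi> \<omega>) \<partial>M)"
      by (intro nn_integral_cong) (simp add: \<phi>_def sec \<gamma>.emeasure_eq_measure)
    finally show "(\<integral>\<^sup>+\<omega>. ennreal (\<phi> \<omega>) \<partial>M) = ennreal (measure (?\<gamma> \<Otimes>\<^sub>M M) B)"
      by (simp add: P.emeasure_eq_measure)
  qed
  have \<phi>01: "0 \<le> \<phi> \<omega>" "\<phi> \<omega> \<le> 1" for \<omega> by (simp_all add: \<phi>_def)
  have \<phi>i: "integrable M \<phi>" by (rule M.integrable_const_bound[where B=1]) (use \<phi>01 in auto)
  have \<phi>E: "(LINT \<omega>|M. \<phi> \<omega>) = measure (?\<gamma> \<Otimes>\<^sub>M M) B"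
    using \<phi>int \<phi>01 by (subst integral_eq_nn_integral) auto
  define N where "N \<omega> = (\<Sum>i<n. (\<rho> i \<omega>)\<^sup>2)" for \<omega>
  have Ni: "integrable M N" unfolding N_def \<rho>_def by (intro Bochner_Integration.integrable_sum ER(1))
  have "(LINT \<omega>|M. N \<omega>) = (\<Sum>i<n. qform r F (e i) (e i))"
    unfolding N_def \<rho>_def by (subst Bochner_Integration.integral_sum) (auto simp: ER)
  then have NE: "(LINT \<omega>|M. N \<omega>) \<le> T" using T[of n e] on by simp
  have N0: "0 \<le> N \<omega>" for \<omega> unfolding N_def by (intro sum_nonneg) simp
  have b0: "0 \<le> N \<omega> / K" for \<omega> using N0 K by simp
  have bad: "1 \<le> N \<omega> / K" if "\<not> N \<omega> \<le> K" for \<omega> using that K by simp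
  have good: "exp (N \<omega>) / l \<le> exp K / l" if "N \<omega> \<le> K" for \<omega> using that l by (simp add: divide_right_mono)
  have g0: "0 \<le> exp K / l" using l by simp
  have m0: "0 \<le> l * measure ?\<gamma> C" using l by simp
  have up: "\<phi> \<omega> \<le> N \<omega> / K + (exp K / l + l * measure ?\<gamma> C)" for \<omega>
  proof (cases "N \<omega> \<le> K")
    case True
    have "\<phi> \<omega> \<le> l * measure ?\<gamma> C + exp (N \<omega>) / l"
      unfolding \<phi>_def N_def by (rule std_gauss_shift_bound[OF finite_lessThan C l])
    then show ?thesis using good[OF True] b0[of \<omega>] by linarith
  next
    case False
    then show ?thesis using bad[OF False] \<phi>01[of \<omega>] g0 m0 by linarith
  qed
  have down: "measure ?\<gamma> C \<le> N \<omega> / K + (exp K / l + l * \<phi> \<omega>)" for \<omega>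
  proof (cases "N \<omega> \<le> K")
    case True
    \<comment> \<open>For the reverse bound, \<open>C\<close> is recovered from its translate
      \<open>C'\<close> by the opposite shift, which has the same length.\<close>
    define C' where "C' = {\<xi>\<in>space ?\<gamma>. (\<lambda>i\<in>?J. \<xi> i + \<rho> i \<omega>) \<in> C}"
    have "(\<lambda>\<xi>. \<lambda>i\<in>?J. \<xi> i + \<rho> i \<omega>) \<in> measurable (PiM ?J (\<lambda>_. borel)) (PiM ?J (\<lambda>_. borel))"
      by (intro measurable_restrict) measurable
    from measurable_sets[OF this C] have C': "C' \<in> sets (PiM ?J (\<lambda>_. borel))"
      unfolding C'_def by (simp add: space_PiM vimage_def Int_def conj_commute)
    have "{\<xi>\<in>space ?\<gamma>. (\<lambda>i\<in>?J. \<xi> i + - \<rho> i \<omega>) \<in> C'} = C"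
    proof -
      have "(\<lambda>i\<in>?J. (\<lambda>i\<in>?J. \<xi> i + - \<rho> i \<omega>) i + \<rho> i \<omega>) = \<xi>" if "\<xi> \<in> space ?\<gamma>" for \<xi>
        using that by (auto simp: space_PiM fun_eq_iff PiE_iff extensional_def)
      moreover have "C \<subseteq> space ?\<gamma>" by (auto simp: C_def)
      ultimately show ?thesis by (auto simp: C'_def space_PiM)
    qed
    then have "measure ?\<gamma> C \<le> l * measure ?\<gamma> C' + exp (N \<omega>) / l"
      using std_gauss_shift_bound[OF finite_lessThan C' l, of "\<lambda>i. - \<rho> i \<omega>"] unfolding N_def by simp
    then show ?thesis using good[OF True] b0[of \<omega>] unfolding C'_def \<phi>_def by linarith
  next
    case False
    have "0 \<le> l * \<phi> \<omega>" using l \<phi>01 by simp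
    then show ?thesis using bad[OF False] g0 \<gamma>.prob_le_1[of C] by linarith
  qed
  have NK: "(LINT \<omega>|M. N \<omega> / K) \<le> T / K" using NE K by (simp add: divide_right_mono)
  have "measure (?\<gamma> \<Otimes>\<^sub>M M) B \<le> (LINT \<omega>|M. N \<omega> / K + (exp K / l + l * measure ?\<gamma> C))"
    unfolding \<phi>E[symmetric] using Ni up by (intro integral_mono \<phi>i) auto
  also have "\<dots> = (LINT \<omega>|M. N \<omega> / K) + (exp K / l + l * measure ?\<gamma> C)" using Ni M.prob_space by simp
  finally show "measure M (cylinder M F U D) \<le>
       T / K + exp K / l + l * measure M (cylinder M F V D)"
    unfolding PU PV using NK by linarith
  have "(LINT \<omega>|M. measure ?\<gamma> C) \<le> (LINT \<omega>|M. N \<omega> / K + (exp K / l + l * \<phi> \<omega>))"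
    using Ni \<phi>i down by (intro integral_mono) auto
  also have "\<dots> = (LINT \<omega>|M. N \<omega> / K) + (exp K / l + l * (LINT \<omega>|M. \<phi> \<omega>))" using Ni \<phi>i M.prob_space by simp
  finally show "measure M (cylinder M F V D) \<le>
       T / K + exp K / l + l * measure M (cylinder M F U D)"
    unfolding PU PV \<phi>E using NK M.prob_space by simp
qed

section \<open>From cylinder sets to the product sigma-algebra\<close>

lemma sigma_algebra_approx:
  assumes alg: "algebra \<Omega> \<A>" and P: "finite_measure P" and Q: "finite_measure Q"
    and sets: "sets P = sigma_sets \<Omega> \<A>" "sets Q = sigma_sets \<Omega> \<A>"
    and X: "X \<in> sigma_sets \<Omega> \<A>" and "0 < (d::real)"
  shows "\<exists>C\<in>\<A>. measure P (X - C \<union> (C - X)) < d \<and> measure Q (X - C \<union> (C - X)) < d"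
  using X \<open>0 < d\<close>
\<comment> \<open>The sets that one and the same member of the algebra approximates in both measures
  form a sigma-algebra. A common approximant is essential, as the inequality to be transferred
  relates the two measures of one set.\<close>
proof (induction X arbitrary: d)
  case (Basic a)
  then show ?case by (intro bexI[of _ a]) auto
next
  case Empty
  interpret algebra \<Omega> \<A> by fact
  show ?case using Empty by (intro bexI[of _ "{}"]) auto
next
  case (Compl a)
  interpret algebra \<Omega> \<A> by fact
  obtain C where C: "C \<in> \<A>" "measure P (a - C \<union> (C - a)) < d" "measure Q (a - C \<union> (C - a)) < d"
    using Compl.IH[OF Compl.prems] by auto
  have "a \<subseteq> \<Omega>" using sigma_sets_into_sp[OF _ Compl.hyps] space_closed by auto
  moreover have "C \<subseteq> \<Omega>" using C(1) space_closed by auto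
  ultimately have "(\<Omega> - a) - (\<Omega> - C) \<union> ((\<Omega> - C) - (\<Omega> - a)) = a - C \<union> (C - a)" by blast
  then show ?case using C by (intro bexI[of _ "\<Omega> - C"]) auto
next
  case (Union a)
  interpret algebra \<Omega> \<A> by fact
  have aP: "a i \<in> sets P" and aQ: "a i \<in> sets Q" for i using Union.hyps sets by auto
  \<comment> \<open>These errors add up to less than \<open>d / 2\<close>; the other half of
    \<open>d\<close> pays for cutting the union off at a finite stage.\<close>
  have d2: "0 < d / 2 ^ (i + 2)" for i :: nat using Union.prems by simp
  obtain C where C: "\<And>i. C i \<in> \<A>"
    and CP: "\<And>i. measure P (a i - C i \<union> (C i - a i)) < d / 2 ^ (i + 2)"
    and CQ: "\<And>i. measure Q (a i - C i \<union> (C i - a i)) < d / 2 ^ (i + 2)"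
  proof -
    have "\<exists>C. C \<in> \<A> \<and> measure P (a i - C \<union> (C - a i)) < d / 2 ^ (i + 2) \<and> measure Q (a i - C \<union> (C - a i)) < d / 2 ^ (i + 2)" for i
      using Union.IH[OF d2, of i i] by blast
    then show ?thesis using that by metis
  qed
  have CC: "C i \<in> sigma_sets \<Omega> \<A>" for i using C by auto
  have tail: "\<exists>n0. \<forall>n\<ge>n0. measure R ((\<Union>i. a i) - (\<Union>i<n. a i)) < d / 2"
    if "finite_measure R" and s: "sets R = sigma_sets \<Omega> \<A>" for R
  proof -
    interpret R: finite_measure R by fact
    have aR: "a i \<in> sets R" for i using Union.hyps s by auto
    have "(\<lambda>n. measure R (\<Union>i<n. a i)) \<longlonglongrightarrow> measure R (\<Union>n. \<Union>i<n. a i)"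
      using aR by (intro R.finite_Lim_measure_incseq) (auto intro!: incseq_SucI simp: less_Suc_eq)
    moreover have "(\<Union>n. \<Union>i<n. a i) = (\<Union>i. a i)" by blast
    ultimately have "(\<lambda>n. measure R (\<Union>i<n. a i)) \<longlonglongrightarrow> measure R (\<Union>i. a i)" by simp
    from LIMSEQ_D[OF this, of "d / 2"] Union.prems obtain n0 where
      n0: "\<And>n. n \<ge> n0 \<Longrightarrow> \<bar>measure R (\<Union>i<n. a i) - measure R (\<Union>i. a i)\<bar> < d / 2" by auto
    have "measure R ((\<Union>i. a i) - (\<Union>i<n. a i)) < d / 2" if "n \<ge> n0" for n
    proof -
      have "measure R ((\<Union>i. a i) - (\<Union>i<n. a i)) = measure R (\<Union>i. a i) - measure R (\<Union>i<n. a i)"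
        using aR by (intro R.finite_measure_Diff) auto
      then show ?thesis using n0[OF that] by linarith
    qed
    then show ?thesis by blast
  qed
  obtain n1 n2 where n1: "\<And>n. n \<ge> n1 \<Longrightarrow> measure P ((\<Union>i. a i) - (\<Union>i<n. a i)) < d / 2"
    and n2: "\<And>n. n \<ge> n2 \<Longrightarrow> measure Q ((\<Union>i. a i) - (\<Union>i<n. a i)) < d / 2"
    using tail[OF P sets(1)] tail[OF Q sets(2)] by auto
  define n where "n = max n1 n2"
  let ?X = "\<Union>i. a i" and ?C = "\<Union>i<n. C i"
  have est: "measure R (?X - ?C \<union> (?C - ?X)) < d"
    if "finite_measure R" and s: "sets R = sigma_sets \<Omega> \<A>"
      and CR: "\<And>i. measure R (a i - C i \<union> (C i - a i)) < d / 2 ^ (i + 2)"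
      and nR: "measure R (?X - (\<Union>i<n. a i)) < d / 2" for R
  proof -
    interpret R: finite_measure R by fact
    have [simp, measurable]: "a i \<in> sets R" "C i \<in> sets R" for i using Union.hyps CC s by auto
    let ?D = "\<lambda>i. a i - C i \<union> (C i - a i)"
    have "measure R (?X - ?C \<union> (?C - ?X)) \<le> measure R ((?X - (\<Union>i<n. a i)) \<union> (\<Union>i<n. ?D i))"
      by (rule R.finite_measure_mono) (blast, auto)
    also have "\<dots> \<le> measure R (?X - (\<Union>i<n. a i)) + measure R (\<Union>i<n. ?D i)"
      by (rule measure_Un_le) auto
    also have "measure R (\<Union>i<n. ?D i) \<le> (\<Sum>i<n. measure R (?D i))"
      by (rule R.finite_measure_subadditive_finite) auto
    also have "\<dots> \<le> (\<Sum>i<n. d / 2 ^ (i + 2))" by (intro sum_mono less_imp_le CR)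
    also have "(\<Sum>i<n. d / 2 ^ (i + 2)) = d / 2 - d / 2 ^ (n + 1)"
      by (induction n) (simp_all add: field_simps)
    also have "\<dots> \<le> d / 2" using Union.prems by simp
    finally show ?thesis using nR by simp
  qed
  show ?case
    using est[OF P sets(1) CP n1] est[OF Q sets(2) CQ n2] C by (intro bexI[of _ ?C]) (auto simp: n_def)
qed

text \<open>\<open>X\<close> is replaced by a cylinder set that is close to it for both measures;
  the two errors cost \<open>d'\<close> and \<open>l * d'\<close>, and \<open>d\<close> is
  arbitrary.\<close>

lemma cylinder_bound_extend:
  assumes P: "finite_measure P" and Q: "finite_measure Q"
    and sets: "sets P = sets (PiM \<Gamma> (\<lambda>_. borel :: real measure))" "sets Q = sets (PiM \<Gamma> (\<lambda>_. borel :: real measure))"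
    and l: "0 \<le> l"
    and bd: "\<And>F D. finite F \<Longrightarrow> F \<subseteq> \<Gamma> \<Longrightarrow> D \<in> sets (PiM F (\<lambda>_. borel)) \<Longrightarrow>
      measure P (prod_emb \<Gamma> (\<lambda>_. borel) F D) \<le> \<epsilon> + l * measure Q (prod_emb \<Gamma> (\<lambda>_. borel) F D)"
    and X: "X \<in> sets P"
  shows "measure P X \<le> \<epsilon> + l * measure Q X"
proof (rule field_le_epsilon)
  fix d :: real assume d: "0 < d"
  \<comment> \<open>The Dirac measures are dummies: what is taken from this product is its algebra
    \<open>pp.generator\<close> of cylinder sets, which depends on the factors only through their
    measurable sets.\<close>
  interpret pp: product_prob_space "\<lambda>_. return borel (0::real)" \<Gamma>
    by (auto simp: product_prob_space_def product_sigma_finite_def product_prob_space_axioms_def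
        intro!: prob_space_return prob_space_imp_sigma_finite)
  interpret P: finite_measure P by fact
  interpret Q: finite_measure Q by fact
  have seq: "sets (PiM F (\<lambda>_. return borel (0::real))) = sets (PiM F (\<lambda>_. borel))" for F :: "'a set"
    by (intro sets_PiM_cong) auto
  have emb: "prod_emb \<Gamma> (\<lambda>_. return borel (0::real)) F D = prod_emb \<Gamma> (\<lambda>_. borel) F D" for F :: "'a set" and D
    by (simp add: prod_emb_def)
  let ?\<Omega> = "space (PiM \<Gamma> (\<lambda>_. return borel (0::real)))"
  have s: "sets P = sigma_sets ?\<Omega> pp.generator" "sets Q = sigma_sets ?\<Omega> pp.generator"
    using sets pp.sets_PiM_generator by (auto simp: seq)
  define d' where "d' = d / (1 + l)"
  have d': "0 < d'" using d l by (simp add: d'_def)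
  have "d' * (1 + l) = d" using l by (simp add: d'_def)
  then have d'l: "d' + l * d' = d" by (simp add: algebra_simps)
  obtain C where C: "C \<in> pp.generator" "measure P (X - C \<union> (C - X)) < d'" "measure Q (X - C \<union> (C - X)) < d'"
    using sigma_algebra_approx[OF pp.algebra_generator P Q s _ d', of X] X s by auto
  obtain F D where FD: "finite F" "F \<subseteq> \<Gamma>" "D \<in> sets (PiM F (\<lambda>_. borel))" "C = prod_emb \<Gamma> (\<lambda>_. borel) F D"
    using C(1) by (auto elim!: pp.generator.cases simp: seq emb)
  have Cs: "C \<in> sets P" "C \<in> sets Q" "X \<in> sets Q" using C(1) X s by auto
  have "measure P X \<le> measure P (C \<union> (X - C \<union> (C - X)))"
    using Cs X by (intro P.finite_measure_mono) auto
  also have "\<dots> \<le> measure P C + measure P (X - C \<union> (C - X))"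
    using Cs X by (intro measure_Un_le) auto
  finally have 1: "measure P X \<le> measure P C + d'" using C by simp
  have "measure Q C \<le> measure Q (X \<union> (X - C \<union> (C - X)))"
    using Cs X by (intro Q.finite_measure_mono) auto
  also have "\<dots> \<le> measure Q X + measure Q (X - C \<union> (C - X))"
    using Cs X by (intro measure_Un_le) auto
  finally have 2: "measure Q C \<le> measure Q X + d'" using C by simp
  have "measure P C \<le> \<epsilon> + l * measure Q C" using bd[OF FD(1-3)] FD(4) by simp
  also have "\<dots> \<le> \<epsilon> + l * (measure Q X + d')" using 2 l by (intro add_left_mono mult_left_mono)
  finally show "measure P X \<le> \<epsilon> + l * measure Q X + d" using 1 d'l by (simp add: distrib_left)
qed

text \<open>As \<open>l\<close> depends on \<epsilon> but not on \<open>F\<close>, the bounds extend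
  to the product sigma-algebra, where they say that the null sets of either law are null for the
  other. The density is the Radon-Nikodym derivative of the laws, evaluated along the field
  \<open>B\<close>.\<close>

lemma laws_mutually_abs_cont_of_cylinder_bounds:
  fixes A :: "'i \<Rightarrow> 'w \<Rightarrow> real" and B :: "'i \<Rightarrow> 'v \<Rightarrow> real"
  assumes M: "prob_space M" and N: "prob_space N"
    and A: "\<And>v. v \<in> \<Gamma> \<Longrightarrow> A v \<in> borel_measurable M" and B: "\<And>v. v \<in> \<Gamma> \<Longrightarrow> B v \<in> borel_measurable N"
    and bd: "\<And>\<epsilon>. 0 < \<epsilon> \<Longrightarrow> \<exists>l\<ge>0. \<forall>F D. finite F \<and> F \<subseteq> \<Gamma> \<and> D \<in> sets (PiM F (\<lambda>_. borel)) \<longrightarrow>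
       measure M (cylinder M F A D) \<le> \<epsilon> + l * measure N (cylinder N F B D) \<and>
       measure N (cylinder N F B D) \<le> \<epsilon> + l * measure M (cylinder M F A D)"
  shows "laws_mutually_abs_cont M A N B \<Gamma>"
proof -
  interpret M: prob_space M by fact
  interpret N: prob_space N by fact
  let ?P = "PiM \<Gamma> (\<lambda>_. borel :: real measure)"
  have mA[measurable]: "(\<lambda>\<omega>. \<lambda>x\<in>\<Gamma>. A x \<omega>) \<in> measurable M ?P" using A by (rule measurable_restrict)
  have mB[measurable]: "(\<lambda>\<omega>. \<lambda>x\<in>\<Gamma>. B x \<omega>) \<in> measurable N ?P" using B by (rule measurable_restrict)
  define QA where "QA = distr M ?P (\<lambda>\<omega>. \<lambda>x\<in>\<Gamma>. A x \<omega>)"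
  define QB where "QB = distr N ?P (\<lambda>\<omega>. \<lambda>x\<in>\<Gamma>. B x \<omega>)"
  interpret QA: prob_space QA unfolding QA_def by (rule M.prob_space_distr) measurable
  interpret QB: prob_space QB unfolding QB_def by (rule N.prob_space_distr) measurable
  have sets[simp, measurable_cong]: "sets QA = sets ?P" "sets QB = sets ?P" by (auto simp: QA_def QB_def)
  have embA: "measure QA (prod_emb \<Gamma> (\<lambda>_. borel) F D) = measure M (cylinder M F A D)"
    if "finite F" "F \<subseteq> \<Gamma>" "D \<in> sets (PiM F (\<lambda>_. borel))" for F D
  proof -
    have "(\<lambda>\<omega>. \<lambda>x\<in>\<Gamma>. A x \<omega>) -` prod_emb \<Gamma> (\<lambda>_. borel) F D \<inter> space M = (cylinder M F A D)"
      using that(2) by (auto simp: prod_emb_def Int_absorb1 inf.absorb2)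
    then show ?thesis unfolding QA_def using that by (subst measure_distr) (auto intro: measurable_prod_emb)
  qed
  have embB: "measure QB (prod_emb \<Gamma> (\<lambda>_. borel) F D) = measure N (cylinder N F B D)"
    if "finite F" "F \<subseteq> \<Gamma>" "D \<in> sets (PiM F (\<lambda>_. borel))" for F D
  proof -
    have "(\<lambda>\<omega>. \<lambda>x\<in>\<Gamma>. B x \<omega>) -` prod_emb \<Gamma> (\<lambda>_. borel) F D \<inter> space N = (cylinder N F B D)"
      using that(2) by (auto simp: prod_emb_def Int_absorb1 inf.absorb2)
    then show ?thesis unfolding QB_def using that by (subst measure_distr) (auto intro: measurable_prod_emb)
  qed
  have ext: "\<exists>l\<ge>0. \<forall>X\<in>sets ?P. measure QA X \<le> \<epsilon> + l * measure QB X \<and> measure QB X \<le> \<epsilon> + l * measure QA X"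
    if eps: "0 < \<epsilon>" for \<epsilon>
  proof -
    obtain l where l: "l \<ge> 0" and b: "\<forall>F D. finite F \<and> F \<subseteq> \<Gamma> \<and> D \<in> sets (PiM F (\<lambda>_. borel)) \<longrightarrow>
       measure M (cylinder M F A D) \<le> \<epsilon> + l * measure N (cylinder N F B D) \<and>
       measure N (cylinder N F B D) \<le> \<epsilon> + l * measure M (cylinder M F A D)"
      using bd[OF eps] by (elim exE conjE)
    have "measure QA X \<le> \<epsilon> + l * measure QB X" if X: "X \<in> sets ?P" for X
    proof (rule cylinder_bound_extend[where \<Gamma>=\<Gamma>, OF QA.finite_measure_axioms QB.finite_measure_axioms _ _ l])
      fix F D assume FD: "finite F" "F \<subseteq> \<Gamma>" "D \<in> sets (PiM F (\<lambda>_. borel :: real measure))"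
      show "measure QA (prod_emb \<Gamma> (\<lambda>_. borel) F D) \<le> \<epsilon> + l * measure QB (prod_emb \<Gamma> (\<lambda>_. borel) F D)"
        unfolding embA[OF FD] embB[OF FD] using b FD by (elim allE[of _ F] allE[of _ D]) (simp only: simp_thms)
    qed (simp_all add: X)
    moreover have "measure QB X \<le> \<epsilon> + l * measure QA X" if X: "X \<in> sets ?P" for X
    proof (rule cylinder_bound_extend[where \<Gamma>=\<Gamma>, OF QB.finite_measure_axioms QA.finite_measure_axioms _ _ l])
      fix F D assume FD: "finite F" "F \<subseteq> \<Gamma>" "D \<in> sets (PiM F (\<lambda>_. borel :: real measure))"
      show "measure QB (prod_emb \<Gamma> (\<lambda>_. borel) F D) \<le> \<epsilon> + l * measure QA (prod_emb \<Gamma> (\<lambda>_. borel) F D)"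
        unfolding embA[OF FD] embB[OF FD] using b FD by (elim allE[of _ F] allE[of _ D]) (simp only: simp_thms)
    qed (simp_all add: X)
    ultimately show ?thesis using l by (intro exI[of _ l] conjI ballI) simp_all
  qed
  have nullA: "measure QA X = 0" if X: "X \<in> sets ?P" "measure QB X = 0" for X
  proof -
    have "measure QA X \<le> 0 + \<epsilon>" if eps: "0 < \<epsilon>" for \<epsilon>
    proof -
      obtain l where "\<forall>X\<in>sets ?P. measure QA X \<le> \<epsilon> + l * measure QB X \<and> measure QB X \<le> \<epsilon> + l * measure QA X"
        using ext[OF eps] by (elim exE conjE)
      from bspec[OF this X(1)] X(2) show ?thesis by simp
    qed
    then show ?thesis by (rule antisym[OF field_le_epsilon measure_nonneg])
  qed
  have nullB: "measure QB X = 0" if X: "X \<in> sets ?P" "measure QA X = 0" for X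
  proof -
    have "measure QB X \<le> 0 + \<epsilon>" if eps: "0 < \<epsilon>" for \<epsilon>
    proof -
      obtain l where "\<forall>X\<in>sets ?P. measure QA X \<le> \<epsilon> + l * measure QB X \<and> measure QB X \<le> \<epsilon> + l * measure QA X"
        using ext[OF eps] by (elim exE conjE)
      from bspec[OF this X(1)] X(2) show ?thesis by simp
    qed
    then show ?thesis by (rule antisym[OF field_le_epsilon measure_nonneg])
  qed
  have ac: "absolutely_continuous QB QA"
    unfolding absolutely_continuous_def
    by (auto simp: null_sets_def QA.emeasure_eq_measure QB.emeasure_eq_measure nullA)
  define R where "R = RN_deriv QB QA"
  have R[measurable]: "R \<in> borel_measurable ?P"
    unfolding R_def using borel_measurable_RN_deriv[of QB QA] by (simp add: measurable_cong_sets[OF sets(2) refl])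
  have dens: "density QB R = QA" unfolding R_def by (rule QB.density_RN_deriv[OF ac]) simp
  have Rint: "(\<integral>\<^sup>+x. R x * indicator X x \<partial>QB) = emeasure QA X" if "X \<in> sets ?P" for X
    using that by (subst dens[symmetric], subst emeasure_density) auto
  have one: "(\<integral>\<^sup>+x. R x \<partial>QB) = 1"
  proof -
    have "(\<integral>\<^sup>+x. R x \<partial>QB) = (\<integral>\<^sup>+x. R x * indicator (space ?P) x \<partial>QB)"
      by (intro nn_integral_cong) (simp add: QB_def)
    then show ?thesis using Rint[of "space ?P"] QA.emeasure_space_1 by (simp add: QA_def)
  qed
  have Rfin: "AE x in QB. R x \<noteq> \<infinity>"
    by (rule nn_integral_PInf_AE) (use one in auto)
  \<comment> \<open>Positivity of the density comes from the reverse bound: the zero set of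
    \<open>R\<close> is null for \<open>QA\<close>, hence for \<open>QB\<close>.\<close>
  have Rpos: "AE x in QB. R x \<noteq> 0"
  proof -
    let ?Z = "{x\<in>space ?P. R x = 0}"
    have Z: "?Z \<in> sets ?P" by measurable
    have "emeasure QA ?Z = (\<integral>\<^sup>+x. R x * indicator ?Z x \<partial>QB)" using Rint[OF Z] by simp
    also have "\<dots> = (\<integral>\<^sup>+x. 0 \<partial>QB)" by (intro nn_integral_cong) (auto simp: indicator_def)
    finally have "measure QA ?Z = 0" by (simp add: measure_def)
    then have "measure QB ?Z = 0" by (rule nullB[OF Z])
    then have "?Z \<in> null_sets QB" using Z by (simp add: null_sets_def QB.emeasure_eq_measure)
    then show ?thesis by (rule AE_I') (auto simp: QB_def)
  qed
  define Y where "Y \<omega> = (\<lambda>x\<in>\<Gamma>. B x \<omega>)" for \<omega>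
  have Y[measurable]: "Y \<in> measurable N ?P" unfolding Y_def by (rule mB)
  have QBY: "QB = distr N ?P Y" unfolding QB_def Y_def ..
  define D where "D \<omega> = enn2real (R (Y \<omega>))" for \<omega>
  have Dm[measurable]: "D \<in> borel_measurable N" unfolding D_def by measurable
  have AEfin: "AE \<omega> in N. R (Y \<omega>) \<noteq> \<infinity>" and AEpos: "AE \<omega> in N. R (Y \<omega>) \<noteq> 0"
    using Rfin Rpos unfolding QBY by (auto dest: AE_distrD[OF Y])
  have Deq: "AE \<omega> in N. ennreal (D \<omega>) = R (Y \<omega>)"
    using AEfin by eventually_elim (simp add: D_def less_top[symmetric])
  have Dint: "(\<integral>\<^sup>+\<omega>. ennreal (D \<omega>) * indicator X (Y \<omega>) \<partial>N) = emeasure QA X" if [measurable]: "X \<in> sets ?P" for X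
  proof -
    have "(\<integral>\<^sup>+\<omega>. ennreal (D \<omega>) * indicator X (Y \<omega>) \<partial>N) = (\<integral>\<^sup>+\<omega>. R (Y \<omega>) * indicator X (Y \<omega>) \<partial>N)"
      using Deq by (intro nn_integral_cong_AE) (auto elim: eventually_mono)
    also have "\<dots> = (\<integral>\<^sup>+x. R x * indicator X x \<partial>QB)" unfolding QBY by (subst nn_integral_distr) auto
    finally show ?thesis using Rint[OF that] by simp
  qed
  have D0: "0 \<le> D \<omega>" for \<omega> by (simp add: D_def)
  have Dtot: "(\<integral>\<^sup>+\<omega>. ennreal (D \<omega>) \<partial>N) = 1"
  proof -
    have "(\<integral>\<^sup>+\<omega>. ennreal (D \<omega>) \<partial>N) = (\<integral>\<^sup>+\<omega>. ennreal (D \<omega>) * indicator (space ?P) (Y \<omega>) \<partial>N)"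
      using measurable_space[OF Y] by (intro nn_integral_cong) simp
    then show ?thesis using Dint[of "space ?P"] QA.emeasure_space_1 by (simp add: QA_def)
  qed
  show ?thesis
    unfolding laws_mutually_abs_cont_def
  proof (intro conjI ballI bexI[of _ D] allI impI)
    show "AE \<omega> in N. 0 < D \<omega>"
      using AEfin AEpos by eventually_elim (simp add: D_def enn2real_positive_iff less_top zero_less_iff_neq_zero)
    show "integrable N D" by (rule integrableI_nonneg) (use D0 Dtot in auto)
    show "(LINT \<omega>|N. D \<omega>) = 1" using Dtot D0 by (subst integral_eq_nn_integral) auto
    fix n :: nat and v :: "nat \<Rightarrow> 'i" and S :: "nat \<Rightarrow> real set" assume vS: "\<forall>j<n. v j \<in> \<Gamma> \<and> S j \<in> sets borel"
    \<comment> \<open>The points \<open>v j\<close> may repeat, so the event is an intersection over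
      \<open>j\<close> and not a rectangle over points.\<close>
    define X where "X = {f\<in>space ?P. \<forall>j\<in>{..<n}. f (v j) \<in> S j}"
    have X[measurable]: "X \<in> sets ?P"
    proof -
      have "{f\<in>space ?P. f (v j) \<in> S j} \<in> sets ?P" if "j < n" for j
      proof -
        have "(\<lambda>f. f (v j)) \<in> measurable ?P borel" and "S j \<in> sets borel"
          using vS that by (auto intro: measurable_component_singleton)
        then have "(\<lambda>f. f (v j)) -` S j \<inter> space ?P \<in> sets ?P" by (rule measurable_sets)
        then show ?thesis by (simp only: vimage_def Int_def mem_Collect_eq conj_commute)
      qed
      then show ?thesis unfolding X_def by (intro sets.sets_Collect_finite_All) simp_all
    qed
    have vA: "(\<lambda>x\<in>\<Gamma>. A x \<omega>) \<in> X \<longleftrightarrow> (\<forall>j<n. A (v j) \<omega> \<in> S j)" for \<omega>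
      using vS by (auto simp: X_def space_PiM)
    have vB: "Y \<omega> \<in> X \<longleftrightarrow> (\<forall>j<n. B (v j) \<omega> \<in> S j)" for \<omega>
      using vS by (auto simp: X_def Y_def space_PiM)
    have "measure M {\<omega>\<in>space M. \<forall>j<n. A (v j) \<omega> \<in> S j} = measure QA X"
      unfolding QA_def measure_distr[OF mA X]
      by (rule arg_cong[where f="measure M"]) (simp only: vimage_def Int_def mem_Collect_eq vA conj_commute)
    also have "\<dots> = enn2real (\<integral>\<^sup>+\<omega>. ennreal (D \<omega>) * indicator X (Y \<omega>) \<partial>N)"
      unfolding Dint[OF X] measure_def ..
    also have "\<dots> = (LINT \<omega>|N. D \<omega> * indicator X (Y \<omega>))"
      using D0 by (subst integral_eq_nn_integral)
        (auto intro!: arg_cong[where f=enn2real] nn_integral_cong simp: indicator_def)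
    also have "\<dots> = (LINT \<omega>:{\<omega>\<in>space N. \<forall>j<n. B (v j) \<omega> \<in> S j}|N. D \<omega>)"
      unfolding set_lebesgue_integral_def
      by (intro Bochner_Integration.integral_cong refl) (simp add: indicator_def vB)
    finally show "measure M {\<omega>\<in>space M. \<forall>j<n. A (v j) \<omega> \<in> S j} =
      (LINT \<omega>:{\<omega>\<in>space N. \<forall>j<n. B (v j) \<omega> \<in> S j}|N. D \<omega>)" .
  qed (use A B M N in auto)
qed

section \<open>The symmetrized semigroup\<close>

text \<open>On (0,t) the exponential is at most 1. After \<open>t\<close> the function is at most
  \<open>G t\<close>, which by monotonicity is at most its average over (0,t), while the exponential
  integrates to at most 1 / a.\<close>

lemma nn_integral_exp_decay_bound:
  fixes G :: "real \<Rightarrow> ennreal"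
  assumes [measurable]: "G \<in> borel_measurable borel"
    and dec: "\<And>s s'. 0 < s \<Longrightarrow> s \<le> s' \<Longrightarrow> G s' \<le> G s" and a: "0 < a" and t: "0 < t"
  shows "(\<integral>\<^sup>+s. ennreal (exp (- a * s)) * G s * indicator {0<..} s \<partial>lborel) \<le>
    ennreal (1 + 1 / (a * t)) * (\<integral>\<^sup>+s. G s * indicator {0<..<t} s \<partial>lborel)"
proof -
  let ?I = "\<integral>\<^sup>+s. G s * indicator {0<..<t} s \<partial>lborel"
  have "(\<integral>\<^sup>+s. ennreal (exp (- a * s)) * G s * indicator {0<..} s \<partial>lborel) \<le>
    (\<integral>\<^sup>+s. G s * indicator {0<..<t} s + G t * (ennreal (exp (- s * a)) * indicator {0..} s) \<partial>lborel)"
  proof (intro nn_integral_mono)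
    fix s :: real
    consider "s \<le> 0" | "0 < s" "s < t" | "t \<le> s" "0 < s" by linarith
    then show "ennreal (exp (- a * s)) * G s * indicator {0<..} s \<le>
      G s * indicator {0<..<t} s + G t * (ennreal (exp (- s * a)) * indicator {0..} s)"
    proof cases
      case 2
      have "ennreal (exp (- a * s)) * G s \<le> 1 * G s"
        using a 2 by (intro mult_right_mono) auto
      then show ?thesis using 2 by (simp add: add_increasing2)
    next
      case 3
      then show ?thesis using mult_left_mono[OF dec[OF t 3(1)], of "ennreal (exp (- a * s))"]
        by (simp add: mult.commute)
    qed simp
  qed
  also have "\<dots> = ?I + G t * (\<integral>\<^sup>+s. ennreal (exp (- s * a)) * indicator {0..} s \<partial>lborel)"
    by (simp add: nn_integral_add nn_integral_cmult)
  also have "(\<integral>\<^sup>+s. ennreal (exp (- s * a)) * indicator {0..} s \<partial>lborel) = ennreal (1 / a)"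
  proof -
    let ?J = "\<integral>\<^sup>+s. ennreal (exp (- s * a)) * indicator {0..} s \<partial>lborel"
    have "(\<integral>\<^sup>+s. ennreal (exp (- s)) * indicator {0..} s \<partial>lborel) = ennreal a * ?J"
      using a nn_integral_real_affine[of "\<lambda>s. ennreal (exp (- s)) * indicator {0..} s" a 0]
      by (simp add: indicator_def zero_le_mult_iff mult.commute cong: if_cong)
    then have "ennreal a * ?J = 1" using nn_intergal_power_times_exp_Ici[of 0] by simp
    then have "ennreal (1 / a) * (ennreal a * ?J) = ennreal (1 / a)" by simp
    then show ?thesis using a by (simp add: mult.assoc[symmetric] ennreal_mult[symmetric])
  qed
  finally have A: "(\<integral>\<^sup>+s. ennreal (exp (- a * s)) * G s * indicator {0<..} s \<partial>lborel) \<le> ?I + G t * ennreal (1 / a)" .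
  have B: "G t \<le> ennreal (1 / t) * ?I"
  proof -
    have "ennreal t * G t = (\<integral>\<^sup>+s. G t * indicator {0<..<t} s \<partial>lborel)"
      using t by (simp add: nn_integral_cmult mult.commute)
    also have "\<dots> \<le> ?I"
      using dec by (intro nn_integral_mono) (auto simp: indicator_def)
    finally have "ennreal (1 / t) * (ennreal t * G t) \<le> ennreal (1 / t) * ?I" by (rule mult_left_mono) simp
    then show ?thesis using t by (simp add: mult.assoc[symmetric] ennreal_mult[symmetric])
  qed
  have "ennreal (1 / (a * t)) = ennreal (1 / t) * ennreal (1 / a)"
    using a t by (simp add: ennreal_mult[symmetric])
  then have E: "?I + ennreal (1 / t) * ?I * ennreal (1 / a) = ennreal (1 + 1 / (a * t)) * ?I"
    using a t by (simp add: ennreal_plus distrib_right mult_ac)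
  have C: "?I + G t * ennreal (1 / a) \<le> ?I + ennreal (1 / t) * ?I * ennreal (1 / a)"
    by (intro add_left_mono mult_right_mono B) simp
  show ?thesis using order_trans[OF A C] unfolding E .
qed

text \<open>The analytic data extracted from the processes. \<open>\<beta>\<close> is the parameter
  at which the resolvent density is assumed continuous; the exponent \<alpha> of the theorem comes
  in later, through time weights.\<close>

locale bar_semigroup =
  fixes m :: "'a::{metric_space, second_countable_topology} measure" and p :: "real \<Rightarrow> 'a \<Rightarrow> 'a \<Rightarrow> real"
    and \<beta> :: real
  assumes sets_m [measurable_cong, simp]: "sets m = sets borel"
    and sigma_finite_m: "sigma_finite_measure m"
    and p_nonneg: "\<And>s x y. 0 < s \<Longrightarrow> 0 \<le> p s x y"
    and p_meas: "(\<lambda>(s, x, y). ennreal (p s x y)) \<in>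
       borel_measurable (restrict_space borel {0<..} \<Otimes>\<^sub>M borel \<Otimes>\<^sub>M borel)"
    and q_meas: "(\<lambda>(s, x, y). pbar m p s x y) \<in>
       borel_measurable (restrict_space borel {0<..} \<Otimes>\<^sub>M borel \<Otimes>\<^sub>M borel)"
    and q_CK: "\<And>s r x y. 0 < s \<Longrightarrow> 0 < r \<Longrightarrow> pbar m p (s + r) x y = (\<integral>\<^sup>+z. pbar m p s x z * pbar m p r z y \<partial>m)"
    and q_mass: "\<And>s x. 0 < s \<Longrightarrow> (\<integral>\<^sup>+y. pbar m p s x y \<partial>m) \<le> 1"
    and q_pos: "\<And>x. \<exists>s>0. 0 < pbar m p s x x"
    and open_pos: "\<And>G x. open G \<Longrightarrow> x \<in> G \<Longrightarrow> 0 < emeasure m G"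
    and locally_finite: "\<And>x. \<exists>r>0. emeasure m (ball x r) < \<infinity>"
    and \<beta>_pos: "0 < \<beta>"
    and ubar_finite: "\<And>x y. ubar m p \<beta> x y < \<infinity>"
    and ubar_cont: "continuous_on UNIV (\<lambda>(x, y). enn2real (ubar m p \<beta> x y))"
begin

sublocale m: sigma_finite_measure m by (rule sigma_finite_m)

text \<open>Extended by zero to nonpositive times, in order to be jointly measurable.\<close>

definition q :: "real \<Rightarrow> 'a \<Rightarrow> 'a \<Rightarrow> ennreal" where
  "q s x y = (if 0 < s then pbar m p s x y else 0)"

definition p0 :: "real \<Rightarrow> 'a \<Rightarrow> 'a \<Rightarrow> real" where
  "p0 s x y = (if 0 < s then p s x y else 0)"

lemma p0_nonneg: "0 \<le> p0 s x y"
  by (simp add: p0_def p_nonneg)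

lemma q_meas': "(\<lambda>(s, x, y). q s x y) \<in> borel_measurable (borel \<Otimes>\<^sub>M borel \<Otimes>\<^sub>M borel)"
  and p0_meas': "(\<lambda>(s, x, y). p0 s x y) \<in> borel_measurable (borel \<Otimes>\<^sub>M borel \<Otimes>\<^sub>M borel)"
proof -
  let ?M = "borel \<Otimes>\<^sub>M borel \<Otimes>\<^sub>M borel :: (real \<times> 'a \<times> 'a) measure"
  have ext: "(\<lambda>(s, x, y). if 0 < s then f s x y else 0) \<in> borel_measurable ?M"
    if f: "(\<lambda>(s, x, y). f s x y) \<in> borel_measurable (restrict_space borel {0<..} \<Otimes>\<^sub>M borel \<Otimes>\<^sub>M borel)"
    for f :: "real \<Rightarrow> 'a \<Rightarrow> 'a \<Rightarrow> ennreal"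
  proof -
    have S: "{z\<in>space ?M. 0 < fst z} \<in> sets ?M" by measurable
    have "(\<lambda>z. (fst z, snd z)) \<in> measurable (restrict_space ?M {z\<in>space ?M. 0 < fst z}) (restrict_space borel {0<..} \<Otimes>\<^sub>M borel \<Otimes>\<^sub>M borel)"
      by (intro measurable_Pair measurable_restrict_space2 measurable_restrict_space1) (auto simp: space_restrict_space)
    from measurable_compose[OF this f]
    have "(\<lambda>z. f (fst z) (fst (snd z)) (snd (snd z))) \<in> borel_measurable (restrict_space ?M {z\<in>space ?M. 0 < fst z})"
      by (simp add: split_beta')
    then have "(\<lambda>z. if z \<in> {z\<in>space ?M. 0 < fst z} then f (fst z) (fst (snd z)) (snd (snd z)) else 0) \<in> borel_measurable ?M"
      using S by (subst measurable_If_restrict_space_iff) auto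
    then show ?thesis by (simp add: split_beta' space_pair_measure)
  qed
  show "(\<lambda>(s, x, y). q s x y) \<in> borel_measurable ?M" unfolding q_def by (rule ext[OF q_meas])
  have "(\<lambda>z. enn2real ((\<lambda>(s, x, y). if 0 < s then ennreal (p s x y) else 0) z)) \<in> borel_measurable ?M"
    using ext[OF p_meas] by measurable
  then show "(\<lambda>(s, x, y). p0 s x y) \<in> borel_measurable ?M"
    by (rule measurable_cong[THEN iffD1, rotated]) (auto simp: p0_def p_nonneg)
qed

lemma q_measurable [measurable (raw)]:
  assumes "f \<in> borel_measurable M" "g \<in> measurable M borel" "h \<in> measurable M borel"
  shows "(\<lambda>z. q (f z) (g z) (h z)) \<in> borel_measurable M"
  using measurable_compose[OF _ q_meas', of "\<lambda>z. (f z, g z, h z)" M] assms by simp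

lemma p0_measurable [measurable (raw)]:
  assumes "f \<in> borel_measurable M" "g \<in> measurable M borel" "h \<in> measurable M borel"
  shows "(\<lambda>z. p0 (f z) (g z) (h z)) \<in> borel_measurable M"
  using measurable_compose[OF _ p0_meas', of "\<lambda>z. (f z, g z, h z)" M] assms by simp

lemma q_sym: "q s x y = q s y x"
  by (simp add: q_def pbar_def mult.commute)

lemma q_eq_p0: "q s x y = (\<integral>\<^sup>+z. ennreal (p0 s x z) * ennreal (p0 s y z) \<partial>m)"
  by (simp add: q_def pbar_def p0_def mult.commute)

lemma q_semigroup: "0 < s \<Longrightarrow> 0 < r \<Longrightarrow> q (s + r) x y = (\<integral>\<^sup>+z. q s x z * q r z y \<partial>m)"
  by (simp add: q_def q_CK)

lemma q_total: "(\<integral>\<^sup>+y. q s x y \<partial>m) \<le> 1"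
  using q_mass[of s x] by (cases "0 < s") (simp_all add: q_def)

text \<open>Cauchy-Schwarz against a measure of mass at most 1 moves the square inside; Fubini and
  once more the bound on the mass finish. Symmetry lets the mass be bounded in either
  variable.\<close>

lemma q_contraction:
  assumes f[measurable]: "f \<in> borel_measurable borel"
  shows "(\<integral>\<^sup>+z. (\<integral>\<^sup>+y. f y * q r y z \<partial>m)\<^sup>2 \<partial>m) \<le> (\<integral>\<^sup>+y. (f y)\<^sup>2 \<partial>m)"
proof -
  have "(\<integral>\<^sup>+z. (\<integral>\<^sup>+y. f y * q r y z \<partial>m)\<^sup>2 \<partial>m) \<le> (\<integral>\<^sup>+z. (\<integral>\<^sup>+y. (f y)\<^sup>2 * q r y z \<partial>m) \<partial>m)"
  proof (intro nn_integral_mono)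
    fix z
    let ?k = "density m (\<lambda>y. q r y z)"
    have "(\<integral>\<^sup>+y. f y * 1 \<partial>?k)\<^sup>2 \<le> (\<integral>\<^sup>+y. (f y)\<^sup>2 \<partial>?k) * (\<integral>\<^sup>+y. 1\<^sup>2 \<partial>?k)"
      by (rule Cauchy_Schwarz_nn_integral) auto
    also have "(\<integral>\<^sup>+y. 1\<^sup>2 \<partial>?k) = (\<integral>\<^sup>+y. q r z y \<partial>m)"
      by (subst nn_integral_density) (simp_all add: q_sym[of r _ z])
    also have "(\<integral>\<^sup>+y. (f y)\<^sup>2 \<partial>?k) * \<dots> \<le> (\<integral>\<^sup>+y. (f y)\<^sup>2 \<partial>?k) * 1"
      by (intro mult_left_mono q_total) simp
    finally show "(\<integral>\<^sup>+y. f y * q r y z \<partial>m)\<^sup>2 \<le> (\<integral>\<^sup>+y. (f y)\<^sup>2 * q r y z \<partial>m)"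
      by (simp add: nn_integral_density mult.commute)
  qed
  also have "\<dots> = (\<integral>\<^sup>+y. (\<integral>\<^sup>+z. (f y)\<^sup>2 * q r y z \<partial>m) \<partial>m)"
  proof -
    interpret pair_sigma_finite m m ..
    show ?thesis by (rule Fubini') measurable
  qed
  also have "\<dots> \<le> (\<integral>\<^sup>+y. (f y)\<^sup>2 * 1 \<partial>m)"
    by (intro nn_integral_mono) (simp add: nn_integral_cmult mult_left_mono[OF q_total, of "(f _)\<^sup>2", simplified])
  finally show ?thesis by simp
qed

lemma q_half_square: "0 < s \<Longrightarrow> q s x x = (\<integral>\<^sup>+z. (q (s / 2) x z)\<^sup>2 \<partial>m)"
  using q_semigroup[of "s / 2" "s / 2" x x] q_sym[of "s / 2" x]
  by (simp add: power2_eq_square cong: nn_integral_cong)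

text \<open>The diagonal value at time \<open>s\<close> is the squared norm of the kernel at time
  s/2, and letting the semigroup run further contracts it.\<close>

lemma q_diag_decreasing:
  assumes "0 < s" "s \<le> s'"
  shows "q s' x x \<le> q s x x"
proof (cases "s = s'")
  case False
  let ?r = "(s' - s) / 2"
  have "q s' x x = (\<integral>\<^sup>+z. (q (s / 2 + ?r) x z)\<^sup>2 \<partial>m)"
    using q_half_square[of s' x] assms by (simp add: field_simps)
  also have "\<dots> = (\<integral>\<^sup>+z. (\<integral>\<^sup>+y. q (s / 2) x y * q ?r y z \<partial>m)\<^sup>2 \<partial>m)"
    using assms False by (subst q_semigroup) auto
  also have "\<dots> \<le> (\<integral>\<^sup>+y. (q (s / 2) x y)\<^sup>2 \<partial>m)" by (rule q_contraction) measurable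
  finally show ?thesis using q_half_square[OF assms(1)] by simp
qed simp

lemma ubar_eq: "ubar m p a x y = (\<integral>\<^sup>+s. ennreal (exp (- a * s)) * q s x y \<partial>lborel)"
  unfolding ubar_def by (intro nn_integral_cong) (auto simp: q_def indicator_def)

text \<open>An infinite value at one time would persist at all earlier times by monotonicity and
  make the resolvent density infinite.\<close>

lemma q_diag_finite: "q s x x < \<infinity>"
proof (cases "0 < s")
  case True
  show ?thesis
  proof (rule ccontr)
    assume "\<not> q s x x < \<infinity>"
    then have top: "q r x x = \<infinity>" if "0 < r" "r \<le> s" for r
      using q_diag_decreasing[OF that, of x] by (simp add: top_unique less_top[symmetric])
    have "(\<integral>\<^sup>+r. \<infinity> * indicator {0<..s} r \<partial>lborel) \<le> ubar m p \<beta> x x"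
      unfolding ubar_eq by (intro nn_integral_mono) (auto simp: top indicator_def ennreal_mult_top)
    moreover have "(\<integral>\<^sup>+r. \<infinity> * indicator {0<..s} r \<partial>lborel) = \<infinity>"
      using True by (subst nn_integral_cmult) (auto simp: ennreal_top_mult)
    ultimately show False using ubar_finite[of x x] by (simp add: top_unique)
  qed
qed (simp add: q_def)

lemma q_finite: "q s x y < \<infinity>"
proof -
  have "(q s x y)\<^sup>2 \<le> (\<integral>\<^sup>+z. (ennreal (p0 s x z))\<^sup>2 \<partial>m) * (\<integral>\<^sup>+z. (ennreal (p0 s y z))\<^sup>2 \<partial>m)"
    unfolding q_eq_p0 by (rule Cauchy_Schwarz_nn_integral) measurable
  also have "\<dots> = q s x x * q s y y" by (simp add: q_eq_p0 power2_eq_square)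
  also have "\<dots> < \<infinity>" using q_diag_finite by (simp add: ennreal_mult_less_top)
  finally have sq: "(q s x y)\<^sup>2 < \<infinity>" .
  show ?thesis
  proof (rule ccontr)
    assume "\<not> q s x y < \<infinity>"
    then have "q s x y = top" by (simp add: less_top[symmetric])
    then show False using sq by (simp add: power2_eq_square)
  qed
qed

definition pb :: "real \<Rightarrow> 'a \<Rightarrow> 'a \<Rightarrow> real" where "pb s x y = enn2real (q s x y)"

lemma q_eq_pb: "q s x y = ennreal (pb s x y)"
  using q_finite by (simp add: pb_def)

lemma pb_nonneg: "0 \<le> pb s x y" by (simp add: pb_def)

lemma pb_sym: "pb s x y = pb s y x" by (simp add: pb_def q_sym)

lemma pb_nonpos_time: "s \<le> 0 \<Longrightarrow> pb s x y = 0" by (simp add: pb_def q_def)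

lemma pb_measurable [measurable (raw)]:
  assumes "f \<in> borel_measurable M" "g \<in> measurable M borel" "h \<in> measurable M borel"
  shows "(\<lambda>z. pb (f z) (g z) (h z)) \<in> borel_measurable M"
  unfolding pb_def using assms by measurable

lemma p0_square_integrable: "integrable m (\<lambda>z. (p0 s x z)\<^sup>2)"
proof (rule integrableI_nonneg)
  have "(\<integral>\<^sup>+z. ennreal ((p0 s x z)\<^sup>2) \<partial>m) = q s x x"
    by (simp add: q_eq_p0 power2_eq_square ennreal_mult' p0_nonneg)
  then show "(\<integral>\<^sup>+z. ennreal ((p0 s x z)\<^sup>2) \<partial>m) < \<infinity>" using q_finite by simp
qed auto

lemma pb_eq_p0: "pb s x y = (LINT z|m. p0 s x z * p0 s y z)"
  unfolding pb_def q_eq_p0 by (subst integral_eq_nn_integral) (auto simp: ennreal_mult' p0_nonneg)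

lemma pb_half: "0 < s \<Longrightarrow> pb s x y = (LINT z|m. pb (s / 2) x z * pb (s / 2) y z)"
  using q_semigroup[of "s / 2" "s / 2" x y] unfolding pb_def[of s]
  by (subst integral_eq_nn_integral) (auto simp: ennreal_mult' pb_nonneg q_eq_pb[symmetric] q_sym[of _ y])

lemma pb_square_integrable: "integrable m (\<lambda>z. (pb s x z)\<^sup>2)"
proof (cases "0 < s")
  case True
  show ?thesis
  proof (rule integrableI_nonneg)
    have "(\<integral>\<^sup>+z. ennreal ((pb s x z)\<^sup>2) \<partial>m) = q (s + s) x x"
      using q_half_square[of "s + s" x] True
      by (simp add: power2_eq_square ennreal_mult' pb_nonneg q_eq_pb[symmetric])
    then show "(\<integral>\<^sup>+z. ennreal ((pb s x z)\<^sup>2) \<partial>m) < \<infinity>" using q_finite by simp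
  qed auto
qed (simp add: pb_nonpos_time)

lemma qform_pb_nonneg: "0 \<le> qform (pb s) F c c"
  by (subst qform_square_integral(2)[where f="p0 s" and M=m, symmetric]) (auto simp: p0_square_integrable pb_eq_p0)

lemma qform_pb_half:
  assumes "0 < s"
  shows "ennreal (qform (pb s) F c c) = (\<integral>\<^sup>+z. ennreal ((\<Sum>x\<in>F. c x * pb (s / 2) x z)\<^sup>2) \<partial>m)"
proof -
  note * = qform_square_integral[where f="pb (s/2)" and M=m and k="pb s" and F=F and c=c,
      OF _ pb_square_integrable pb_half[OF assms, symmetric], simplified]
  show ?thesis using *(1) by (subst *(2)[symmetric]) (subst nn_integral_eq_integral, auto)
qed

text \<open>As on the diagonal, but for a signed combination: \<open>q_contraction\<close> concerns
  nonnegative functions, so the absolute value is taken after splitting off the remaining time and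
  before contracting.\<close>

lemma qform_pb_decreasing:
  assumes "0 < s" "s \<le> s'"
  shows "qform (pb s') F c c \<le> qform (pb s) F c c"
proof (cases "s = s'")
  case False
  let ?r = "(s' - s) / 2"
  have r: "0 < ?r" using assms False by simp
  have CK: "pb (s' / 2) x z = (LINT y|m. pb (s / 2) x y * pb ?r y z)" "integrable m (\<lambda>y. pb (s / 2) x y * pb ?r y z)" for x z
  proof -
    have eq: "s' / 2 = s / 2 + ?r" by (simp add: field_simps)
    have "q (s' / 2) x z = (\<integral>\<^sup>+y. q (s / 2) x y * q ?r y z \<partial>m)"
      by (subst eq, rule q_semigroup) (use assms r in auto)
    also have "\<dots> = (\<integral>\<^sup>+y. ennreal (pb (s / 2) x y * pb ?r y z) \<partial>m)"
      by (simp add: q_eq_pb ennreal_mult' pb_nonneg)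
    finally have e: "q (s' / 2) x z = (\<integral>\<^sup>+y. ennreal (pb (s / 2) x y * pb ?r y z) \<partial>m)" .
    then show "pb (s' / 2) x z = (LINT y|m. pb (s / 2) x y * pb ?r y z)"
      unfolding pb_def[of "s'/2"] by (subst integral_eq_nn_integral) (auto simp: pb_nonneg)
    show "integrable m (\<lambda>y. pb (s / 2) x y * pb ?r y z)"
      by (rule integrableI_nonneg) (use e[symmetric] q_finite[of "s'/2" x z] in \<open>auto simp: pb_nonneg\<close>)
  qed
  let ?g = "\<lambda>y. \<Sum>x\<in>F. c x * pb (s / 2) x y"
  have "ennreal (qform (pb s') F c c) = (\<integral>\<^sup>+z. ennreal ((\<Sum>x\<in>F. c x * pb (s' / 2) x z)\<^sup>2) \<partial>m)"
    using assms by (intro qform_pb_half) simp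
  also have "\<dots> \<le> (\<integral>\<^sup>+z. (\<integral>\<^sup>+y. ennreal \<bar>?g y\<bar> * q ?r y z \<partial>m)\<^sup>2 \<partial>m)"
  proof (intro nn_integral_mono)
    fix z
    have eq: "(\<Sum>x\<in>F. c x * pb (s' / 2) x z) = (LINT y|m. ?g y * pb ?r y z)"
      using CK(2) by (simp add: CK(1) sum_distrib_right mult.assoc)
    have "ennreal \<bar>LINT y|m. ?g y * pb ?r y z\<bar> \<le> (\<integral>\<^sup>+y. ennreal \<bar>?g y * pb ?r y z\<bar> \<partial>m)"
      using integral_norm_bound_ennreal[of m "\<lambda>y. ?g y * pb ?r y z"] CK(2)
      by (auto simp: sum_distrib_right mult.assoc)
    also have "\<dots> = (\<integral>\<^sup>+y. ennreal \<bar>?g y\<bar> * q ?r y z \<partial>m)"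
      by (simp add: abs_mult ennreal_mult' q_eq_pb pb_nonneg)
    finally have "(ennreal \<bar>LINT y|m. ?g y * pb ?r y z\<bar>)\<^sup>2 \<le> (\<integral>\<^sup>+y. ennreal \<bar>?g y\<bar> * q ?r y z \<partial>m)\<^sup>2"
      by (intro power_mono) auto
    then show "ennreal ((\<Sum>x\<in>F. c x * pb (s' / 2) x z)\<^sup>2) \<le> (\<integral>\<^sup>+y. ennreal \<bar>?g y\<bar> * q ?r y z \<partial>m)\<^sup>2"
      unfolding eq by (simp add: ennreal_power)
  qed
  also have "\<dots> \<le> (\<integral>\<^sup>+y. (ennreal \<bar>?g y\<bar>)\<^sup>2 \<partial>m)" by (rule q_contraction) measurable
  also have "\<dots> = ennreal (qform (pb s) F c c)"
    unfolding qform_pb_half[OF assms(1)] by (simp add: ennreal_power)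
  finally show ?thesis by (simp add: qform_pb_nonneg)
qed simp

end

section \<open>Time weights and the covariances that they define\<close>

lemma nn_integral_exp_neg:
  assumes a: "0 < a"
  shows "(\<integral>\<^sup>+s. ennreal (exp (- a * s)) * indicator {0<..} s \<partial>lborel) = ennreal (1 / a)"
proof -
  let ?J = "\<integral>\<^sup>+s. ennreal (exp (- s * a)) * indicator {0..} s \<partial>lborel"
  have "(\<integral>\<^sup>+s. ennreal (exp (- s)) * indicator {0..} s \<partial>lborel) = ennreal a * ?J"
    using a nn_integral_real_affine[of "\<lambda>s. ennreal (exp (- s)) * indicator {0..} s" a 0]
    by (simp add: indicator_def zero_le_mult_iff mult.commute cong: if_cong)
  then have "ennreal a * ?J = 1" using nn_intergal_power_times_exp_Ici[of 0] by simp
  then have "ennreal (1 / a) * (ennreal a * ?J) = ennreal (1 / a)" by simp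
  then have "?J = ennreal (1 / a)" using a by (simp add: mult.assoc[symmetric] ennreal_mult[symmetric])
  moreover have "(\<integral>\<^sup>+s. ennreal (exp (- a * s)) * indicator {0<..} s \<partial>lborel) = ?J"
    using AE_lborel_singleton[of 0] by (intro nn_integral_cong_AE) (auto simp: indicator_def mult.commute)
  ultimately show ?thesis by simp
qed

text \<open>The bound is imposed at positive times only, because \<open>pb\<close> vanishes at the
  others. Boundedness near 0 and exponential decay are what the integrability of the heat kernel in
  time can pay for.\<close>

definition exp_dominated :: "(real \<Rightarrow> real) \<Rightarrow> bool" where
  "exp_dominated w \<longleftrightarrow> w \<in> borel_measurable borel \<and> (\<exists>K a. 0 < a \<and> (\<forall>s>0. \<bar>w s\<bar> \<le> K * exp (- a * s)))"

lemma exp_dominated_exp: "0 < a \<Longrightarrow> exp_dominated (\<lambda>s. exp (- a * s))"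
  unfolding exp_dominated_def by (intro conjI exI[of _ 1] exI[of _ a]) auto

lemma exp_dominated_mono:
  assumes "exp_dominated w" "v \<in> borel_measurable borel" "\<And>s. 0 < s \<Longrightarrow> \<bar>v s\<bar> \<le> \<bar>w s\<bar>"
  shows "exp_dominated v"
  using assms unfolding exp_dominated_def by (meson order_trans)

lemma exp_dominated_finite_horizon:
  assumes "w \<in> borel_measurable borel" "\<And>s. 0 < s \<Longrightarrow> s < t \<Longrightarrow> \<bar>w s\<bar> \<le> K" "\<And>s. t \<le> s \<Longrightarrow> w s = 0"
  shows "exp_dominated w"
  unfolding exp_dominated_def
proof (rule conjI[OF assms(1)], rule exI[of _ "\<bar>K\<bar> * exp t"], rule exI[of _ 1], intro conjI allI impI)
  fix s :: real assume s: "0 < s"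
  show "\<bar>w s\<bar> \<le> \<bar>K\<bar> * exp t * exp (- 1 * s)"
  proof (cases "s < t")
    case True
    have "\<bar>K\<bar> * 1 \<le> \<bar>K\<bar> * exp (t - s)" using True by (intro mult_left_mono) auto
    moreover have "\<bar>K\<bar> * exp t * exp (- 1 * s) = \<bar>K\<bar> * exp (t - s)" by (simp add: exp_diff exp_minus field_simps)
    ultimately show ?thesis using assms(2)[OF s True] abs_ge_self[of K] by linarith
  qed (simp add: assms)
qed simp

lemma exp_dominated_times_exp:
  assumes "0 < a"
  shows "exp_dominated (\<lambda>s. s * exp (- a * s))"
  unfolding exp_dominated_def
proof (rule conjI, measurable, rule exI[of _ "2 / a"], rule exI[of _ "a / 2"], intro conjI allI impI)
  fix s :: real assume s: "0 < s"
  \<comment> \<open>Half of the exponential decay absorbs the factor \<open>s\<close>.\<close>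
  have "a * s / 2 \<le> exp (a * s / 2)" using exp_ge_add_one_self[of "a * s / 2"] by linarith
  then have "s \<le> 2 / a * exp (a * s / 2)" using assms by (simp add: field_simps)
  then have "s * exp (- a * s) \<le> (2 / a * exp (a * s / 2)) * exp (- a * s)" by (rule mult_right_mono) simp
  also have "\<dots> = 2 / a * exp (- (a / 2) * s)" by (simp add: exp_add[symmetric] field_simps)
  finally show "\<bar>s * exp (- a * s)\<bar> \<le> 2 / a * exp (- (a / 2) * s)" using s by simp
qed (use assms in auto)

context bar_semigroup
begin

text \<open>Every covariance of the proof has this form: \<open>U\<close>, \<open>V\<close>,
  \<open>S\<close>, \<open>R\<close> and the target field, and likewise the resolvent density and
  its square, differ only in the weight.\<close>

definition cv :: "(real \<Rightarrow> real) \<Rightarrow> 'a \<Rightarrow> 'a \<Rightarrow> real" where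
  "cv w x y = (LINT s|lborel. w s * pb s x y)"

lemma cv_sym: "cv w x y = cv w y x"
  by (simp add: cv_def pb_sym)

lemma pb_le_diag: "pb s x y \<le> pb s x x + pb s y y"
proof -
  have "pb s x y \<le> (LINT z|m. (p0 s x z)\<^sup>2 + (p0 s y z)\<^sup>2)"
    unfolding pb_eq_p0
  proof (rule integral_mono)
    show "integrable m (\<lambda>z. p0 s x z * p0 s y z)"
      by (intro integrable_mult_of_squares p0_square_integrable) auto
    show "integrable m (\<lambda>z. (p0 s x z)\<^sup>2 + (p0 s y z)\<^sup>2)"
      by (intro Bochner_Integration.integrable_add p0_square_integrable)
    fix z
    have "2 * p0 s x z * p0 s y z \<le> (p0 s x z)\<^sup>2 + (p0 s y z)\<^sup>2" by (rule sum_squares_bound)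
    moreover have "0 \<le> p0 s x z * p0 s y z" by (simp add: p0_nonneg)
    ultimately show "p0 s x z * p0 s y z \<le> (p0 s x z)\<^sup>2 + (p0 s y z)\<^sup>2" by simp
  qed
  also have "\<dots> = pb s x x + pb s y y"
    by (subst Bochner_Integration.integral_add) (simp_all add: p0_square_integrable pb_eq_p0 flip: power2_eq_square)
  finally show ?thesis .
qed

text \<open>By monotonicity only the times in (0,1) matter, and there
  \<open>exp (- \<beta> * s)\<close> is bounded below; so finiteness of the resolvent density at
  \<open>\<beta>\<close> gives integrability for every exponent.\<close>

lemma exp_pb_diag_integrable:
  assumes "0 < a"
  shows "integrable lborel (\<lambda>s. exp (- a * s) * pb s x x)"
proof (rule integrableI_nonneg)
  have "(\<integral>\<^sup>+s. ennreal (exp (- a * s) * pb s x x) \<partial>lborel) =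
      (\<integral>\<^sup>+s. ennreal (exp (- a * s)) * q s x x * indicator {0<..} s \<partial>lborel)"
    by (intro nn_integral_cong) (auto simp: ennreal_mult' q_eq_pb indicator_def pb_nonpos_time)
  also have "\<dots> \<le> ennreal (1 + 1 / (a * 1)) * (\<integral>\<^sup>+s. q s x x * indicator {0<..<1} s \<partial>lborel)"
    by (rule nn_integral_exp_decay_bound) (use assms q_diag_decreasing in auto)
  also have "(\<integral>\<^sup>+s. q s x x * indicator {0<..<1} s \<partial>lborel) \<le>
      (\<integral>\<^sup>+s. ennreal (exp \<beta>) * (ennreal (exp (- \<beta> * s)) * q s x x) \<partial>lborel)"
  proof (intro nn_integral_mono)
    fix s :: real
    show "q s x x * indicator {0<..<1} s \<le> ennreal (exp \<beta>) * (ennreal (exp (- \<beta> * s)) * q s x x)"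
    proof (cases "0 < s \<and> s < 1")
      case True
      have "1 \<le> exp (\<beta> - \<beta> * s)" using True \<beta>_pos by simp
      then have "1 * q s x x \<le> ennreal (exp (\<beta> - \<beta> * s)) * q s x x"
        by (intro mult_right_mono) (auto simp: ennreal_leI simp flip: ennreal_1)
      then show ?thesis using True
        by (simp add: mult.assoc[symmetric] ennreal_mult[symmetric] exp_add[symmetric])
    qed auto
  qed
  also have "\<dots> = ennreal (exp \<beta>) * ubar m p \<beta> x x"
    unfolding ubar_eq by (rule nn_integral_cmult) measurable
  finally have "(\<integral>\<^sup>+s. ennreal (exp (- a * s) * pb s x x) \<partial>lborel)
      \<le> ennreal (1 + 1 / (a * 1)) * (ennreal (exp \<beta>) * ubar m p \<beta> x x)"
    by (simp add: mult_left_mono)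
  also have "\<dots> < \<infinity>" using ubar_finite[of x x] by (simp add: ennreal_mult_less_top)
  finally show "(\<integral>\<^sup>+s. ennreal (exp (- a * s) * pb s x x) \<partial>lborel) < \<infinity>" .
qed (auto simp: pb_nonneg)

lemma cv_integrable:
  assumes w: "exp_dominated w"
  shows "integrable lborel (\<lambda>s. w s * pb s x y)"
proof -
  obtain K a where a: "0 < a" and K: "\<And>s. 0 < s \<Longrightarrow> \<bar>w s\<bar> \<le> K * exp (- a * s)"
    and [measurable]: "w \<in> borel_measurable borel" using w by (auto simp: exp_dominated_def)
  show ?thesis
  proof (rule Bochner_Integration.integrable_bound)
    show "integrable lborel (\<lambda>s. K * (exp (- a * s) * pb s x x) + K * (exp (- a * s) * pb s y y))"
      by (intro Bochner_Integration.integrable_add integrable_mult_right exp_pb_diag_integrable a)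
    show "AE s in lborel. norm (w s * pb s x y) \<le> norm (K * (exp (- a * s) * pb s x x) + K * (exp (- a * s) * pb s y y))"
    proof (intro AE_I2)
      fix s
      show "norm (w s * pb s x y) \<le> norm (K * (exp (- a * s) * pb s x x) + K * (exp (- a * s) * pb s y y))"
      proof (cases "0 < s")
        case True
        have "\<bar>w s * pb s x y\<bar> \<le> (K * exp (- a * s)) * (pb s x x + pb s y y)"
          unfolding abs_mult using K[OF True] pb_le_diag[of s x y] pb_nonneg[of s x y]
          by (intro mult_mono) auto
        then show ?thesis by (simp add: algebra_simps)
      qed (simp add: pb_nonpos_time)
    qed
  qed measurable
qed

lemma qform_pb_measurable [measurable]: "(\<lambda>s. qform (pb s) F c c) \<in> borel_measurable borel"
  unfolding qform_def by measurable

lemma qform_cv: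
  assumes w: "exp_dominated w"
  shows "integrable lborel (\<lambda>s. w s * qform (pb s) F c c)"
    and "qform (cv w) F c c = (LINT s|lborel. w s * qform (pb s) F c c)"
proof -
  have eq: "w s * qform (pb s) F c c = (\<Sum>x\<in>F. \<Sum>y\<in>F. c x * c y * (w s * pb s x y))" for s
    by (simp add: qform_def sum_distrib_left mult_ac)
  have i: "integrable lborel (\<lambda>s. c x * c y * (w s * pb s x y))" for x y
    by (intro integrable_mult_right cv_integrable w)
  show "integrable lborel (\<lambda>s. w s * qform (pb s) F c c)"
    unfolding eq by (intro Bochner_Integration.integrable_sum i)
  have "(LINT s|lborel. w s * qform (pb s) F c c) = (\<Sum>x\<in>F. LINT s|lborel. (\<Sum>y\<in>F. c x * c y * (w s * pb s x y)))"
    unfolding eq by (intro Bochner_Integration.integral_sum Bochner_Integration.integrable_sum i)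
  also have "\<dots> = (\<Sum>x\<in>F. \<Sum>y\<in>F. LINT s|lborel. c x * c y * (w s * pb s x y))"
    by (intro sum.cong refl Bochner_Integration.integral_sum i)
  finally show "qform (cv w) F c c = (LINT s|lborel. w s * qform (pb s) F c c)"
    by (simp add: qform_def cv_def)
qed

lemma qform_pb_nonpos_time: "s \<le> 0 \<Longrightarrow> qform (pb s) F c c = 0"
  by (simp add: qform_def pb_nonpos_time)

lemma qform_cv_nn:
  assumes w: "exp_dominated w" and pos: "\<And>s. 0 < s \<Longrightarrow> 0 \<le> w s"
  shows "ennreal (qform (cv w) F c c) = (\<integral>\<^sup>+s. ennreal (w s * qform (pb s) F c c) \<partial>lborel)"
proof -
  have "0 \<le> w s * qform (pb s) F c c" for s
    using pos[of s] qform_pb_nonneg[of s F c] by (cases "0 < s") (auto simp: qform_pb_nonpos_time)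
  then show ?thesis
    unfolding qform_cv(2)[OF w] using qform_cv(1)[OF w, of F c] by (subst nn_integral_eq_integral) auto
qed

lemma qform_cv_nonneg:
  assumes w: "exp_dominated w" and pos: "\<And>s. 0 < s \<Longrightarrow> 0 \<le> w s"
  shows "0 \<le> qform (cv w) F c c"
  unfolding qform_cv(2)[OF w]
proof (rule integral_nonneg_AE, rule AE_I2)
  fix s show "0 \<le> w s * qform (pb s) F c c"
    using pos[of s] qform_pb_nonneg[of s F c] by (cases "0 < s") (auto simp: qform_pb_nonpos_time)
qed

lemma psd_cv:
  assumes "exp_dominated w" "\<And>s. 0 < s \<Longrightarrow> 0 \<le> w s"
  shows "psd_on (cv w) F"
  using qform_cv_nonneg[OF assms] cv_sym unfolding psd_on_def by blast

text \<open>\<open>v\<close> may vanish after \<open>t\<close>, and \<open>w\<close> may change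
  sign. Besides smoothness this yields the passage between different exponents, the continuity of
  all fields, and the domination of \<open>R\<close> by \<open>V\<close>.\<close>

lemma qform_cv_compare:
  assumes w: "exp_dominated w" and v: "exp_dominated v" and pos: "\<And>s. 0 < s \<Longrightarrow> 0 \<le> v s"
    and t: "0 < t" and k: "0 < k" "\<And>s. 0 < s \<Longrightarrow> s < t \<Longrightarrow> k \<le> v s"
  shows "\<exists>C\<ge>0. \<forall>F c. qform (cv w) F c c \<le> C * qform (cv v) F c c"
proof -
  obtain K a where a: "0 < a" and K: "\<And>s. 0 < s \<Longrightarrow> \<bar>w s\<bar> \<le> K * exp (- a * s)"
    and [measurable]: "w \<in> borel_measurable borel" using w by (auto simp: exp_dominated_def)
  have [measurable]: "v \<in> borel_measurable borel" using v by (auto simp: exp_dominated_def)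
  have "0 \<le> K * exp (- a * 1)" using K[of 1] by linarith
  then have K0: "0 \<le> K" by (simp add: zero_le_mult_iff)
  define C where "C = K * (1 + 1 / (a * t)) / k"
  have C0: "0 \<le> C" using K0 a t k by (simp add: C_def)
  have "qform (cv w) F c c \<le> C * qform (cv v) F c c" for F c
  proof -
    define Q where "Q s = qform (pb s) F c c" for s
    have [measurable]: "Q \<in> borel_measurable borel" unfolding Q_def by measurable
    have Q0: "0 \<le> Q s" for s by (simp add: Q_def qform_pb_nonneg)
    have Qn: "s \<le> 0 \<Longrightarrow> Q s = 0" for s by (simp add: Q_def qform_pb_nonpos_time)
    have "ennreal (qform (cv w) F c c) \<le> (\<integral>\<^sup>+s. ennreal \<bar>w s * Q s\<bar> \<partial>lborel)"
    proof -
      have "ennreal (qform (cv w) F c c) \<le> ennreal \<bar>LINT s|lborel. w s * Q s\<bar>"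
        unfolding qform_cv(2)[OF w] Q_def by (intro ennreal_leI) simp
      also have "\<dots> \<le> (\<integral>\<^sup>+s. ennreal \<bar>w s * Q s\<bar> \<partial>lborel)"
        using integral_norm_bound_ennreal[OF qform_cv(1)[OF w, of F c]] by (simp add: Q_def)
      finally show ?thesis .
    qed
    also have "\<dots> \<le> (\<integral>\<^sup>+s. ennreal K * (ennreal (exp (- a * s)) * ennreal (Q s) * indicator {0<..} s) \<partial>lborel)"
    proof (intro nn_integral_mono)
      fix s
      show "ennreal \<bar>w s * Q s\<bar> \<le> ennreal K * (ennreal (exp (- a * s)) * ennreal (Q s) * indicator {0<..} s)"
      proof (cases "0 < s")
        case True
        have "\<bar>w s * Q s\<bar> \<le> (K * exp (- a * s)) * Q s"
          unfolding abs_mult using K[OF True] Q0[of s] by (intro mult_mono) auto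
        then show ?thesis using True K0 Q0[of s]
          by (simp add: ennreal_mult'[symmetric] ennreal_leI mult.assoc)
      qed (simp add: Qn)
    qed
    also have "\<dots> = ennreal K * (\<integral>\<^sup>+s. ennreal (exp (- a * s)) * ennreal (Q s) * indicator {0<..} s \<partial>lborel)"
      by (rule nn_integral_cmult) measurable
    also have "\<dots> \<le> ennreal K * (ennreal (1 + 1 / (a * t)) * (\<integral>\<^sup>+s. ennreal (Q s) * indicator {0<..<t} s \<partial>lborel))"
      by (intro mult_left_mono nn_integral_exp_decay_bound a t)
         (auto simp: Q_def qform_pb_decreasing intro!: ennreal_leI)
    also have "(\<integral>\<^sup>+s. ennreal (Q s) * indicator {0<..<t} s \<partial>lborel) \<le> (\<integral>\<^sup>+s. ennreal (1 / k) * ennreal (v s * Q s) \<partial>lborel)"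
    proof (intro nn_integral_mono)
      fix s
      show "ennreal (Q s) * indicator {0<..<t} s \<le> ennreal (1 / k) * ennreal (v s * Q s)"
      proof (cases "0 < s \<and> s < t")
        case True
        then have "k * Q s \<le> v s * Q s" using k Q0[of s] by (intro mult_right_mono) auto
        then have "Q s \<le> 1 / k * (v s * Q s)" using k by (simp add: field_simps)
        then show ?thesis using True k by (simp add: ennreal_mult'[symmetric] ennreal_leI)
      qed auto
    qed
    also have "\<dots> = ennreal (1 / k) * ennreal (qform (cv v) F c c)"
      by (simp add: qform_cv_nn[OF v pos] nn_integral_cmult flip: Q_def)
    finally have "ennreal (qform (cv w) F c c) \<le> ennreal K * (ennreal (1 + 1 / (a * t)) * (ennreal (1 / k) * ennreal (qform (cv v) F c c)))"
      by (simp add: mult_left_mono)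
    also have "\<dots> = ennreal (C * qform (cv v) F c c)"
      using K0 a t k qform_cv_nonneg[OF v pos, of F c] by (simp add: C_def ennreal_mult[symmetric] del: ennreal_plus)
    finally show ?thesis
      using C0 qform_cv_nonneg[OF v pos, of F c] by (simp add: ennreal_le_iff)
  qed
  then show ?thesis using C0 by blast
qed

text \<open>The variance of an increment is the energy of a difference of two point masses, so
  comparisons of energies carry over to increments.\<close>

lemma cv_increment: "cv w x x + cv w y y - 2 * cv w x y =
  qform (cv w) {x, y} (\<lambda>z. of_bool (z = x) - of_bool (z = y)) (\<lambda>z. of_bool (z = x) - of_bool (z = y))"
  by (cases "x = y") (auto simp: qform_def cv_sym[of w y x])

lemma ubar_eq_cv:
  assumes "0 < a"
  shows "ubar m p a x y = ennreal (cv (\<lambda>s. exp (- a * s)) x y)"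
  unfolding ubar_eq cv_def using cv_integrable[OF exp_dominated_exp[OF assms], of x y]
  by (subst nn_integral_eq_integral[symmetric]) (auto simp: pb_nonneg q_eq_pb ennreal_mult')

lemma cv_nonneg: "(\<And>s. 0 < s \<Longrightarrow> 0 \<le> w s) \<Longrightarrow> 0 \<le> cv w x y"
  unfolding cv_def by (rule integral_nonneg_AE, rule AE_I2)
    (metis mult_nonneg_nonneg pb_nonneg mult_zero_right not_le order_refl pb_nonpos_time)

end

section \<open>Resolvent densities\<close>

context bar_semigroup
begin

definition ub :: "real \<Rightarrow> 'a \<Rightarrow> 'a \<Rightarrow> real" where
  "ub a = cv (\<lambda>s. exp (- a * s))"

lemma ubar_eq_ub: "0 < a \<Longrightarrow> ubar m p a x y = ennreal (ub a x y)"
  unfolding ub_def by (rule ubar_eq_cv)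

lemma ubar_measurable [measurable (raw)]:
  assumes [measurable]: "f \<in> measurable M borel" "g \<in> measurable M borel"
  shows "(\<lambda>z. ubar m p a (f z) (g z)) \<in> borel_measurable M"
  unfolding ubar_eq by measurable

lemma cv_measurable [measurable (raw)]:
  assumes [measurable]: "f \<in> measurable M borel" "g \<in> measurable M borel" and "exp_dominated w"
  shows "(\<lambda>z. cv w (f z) (g z)) \<in> borel_measurable M"
proof -
  have [measurable]: "w \<in> borel_measurable borel" using assms(3) by (simp add: exp_dominated_def)
  show ?thesis unfolding cv_def by measurable
qed

text \<open>The semigroup property with the substitution u = s + r; all terms are nonnegative, so
  Fubini needs no integrability. Equal exponents give \<open>ubar_square\<close>, different ones
  \<open>ubar_resolvent\<close>.\<close>

lemma ubar_convolution:
  "(\<integral>\<^sup>+z. ubar m p a x z * ubar m p b z y \<partial>m) =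
   (\<integral>\<^sup>+u. q u x y * (\<integral>\<^sup>+r. ennreal (exp (- a * (u - r) - b * r)) * indicator {0<..<u} r \<partial>lborel) \<partial>lborel)"
proof -
  interpret Lm: pair_sigma_finite lborel m ..
  let ?e = "\<lambda>s r. ennreal (exp (- a * s)) * ennreal (exp (- b * r))"
  have "(\<integral>\<^sup>+z. ubar m p a x z * ubar m p b z y \<partial>m) =
    (\<integral>\<^sup>+z. (\<integral>\<^sup>+s. (\<integral>\<^sup>+r. ?e s r * (q s x z * q r z y) \<partial>lborel) \<partial>lborel) \<partial>m)"
  proof (rule nn_integral_cong)
    fix z
    let ?A = "\<lambda>s. ennreal (exp (- a * s)) * q s x z" and ?B = "\<lambda>r. ennreal (exp (- b * r)) * q r z y"
    have "(\<integral>\<^sup>+s. (\<integral>\<^sup>+r. ?e s r * (q s x z * q r z y) \<partial>lborel) \<partial>lborel) = (\<integral>\<^sup>+s. (\<integral>\<^sup>+r. ?A s * ?B r \<partial>lborel) \<partial>lborel)"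
      by (simp only: mult_ac)
    also have "\<dots> = (\<integral>\<^sup>+s. ?A s * (\<integral>\<^sup>+r. ?B r \<partial>lborel) \<partial>lborel)"
      by (intro arg_cong2[where f=nn_integral] ext refl nn_integral_cmult) measurable
    also have "\<dots> = (\<integral>\<^sup>+s. ?A s \<partial>lborel) * (\<integral>\<^sup>+r. ?B r \<partial>lborel)"
      by (rule nn_integral_multc) measurable
    finally show "ubar m p a x z * ubar m p b z y = (\<integral>\<^sup>+s. (\<integral>\<^sup>+r. ?e s r * (q s x z * q r z y) \<partial>lborel) \<partial>lborel)"
      unfolding ubar_eq ..
  qed
  also have "\<dots> = (\<integral>\<^sup>+s. (\<integral>\<^sup>+z. (\<integral>\<^sup>+r. ?e s r * (q s x z * q r z y) \<partial>lborel) \<partial>m) \<partial>lborel)"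
    by (rule Lm.Fubini') measurable
  also have "\<dots> = (\<integral>\<^sup>+s. (\<integral>\<^sup>+r. (\<integral>\<^sup>+z. ?e s r * (q s x z * q r z y) \<partial>m) \<partial>lborel) \<partial>lborel)"
    by (intro nn_integral_cong Lm.Fubini') measurable
  also have "\<dots> = (\<integral>\<^sup>+s. (\<integral>\<^sup>+r. ?e s r * (indicator {0<..} s * indicator {0<..} r * q (s + r) x y) \<partial>lborel) \<partial>lborel)"
  proof (rule nn_integral_cong, rule nn_integral_cong)
    fix s r :: real
    have "(\<integral>\<^sup>+z. q s x z * q r z y \<partial>m) = indicator {0<..} s * indicator {0<..} r * q (s + r) x y"
      by (cases "0 < s \<and> 0 < r") (auto simp: q_semigroup q_def[of s] q_def[of r])
    then show "(\<integral>\<^sup>+z. ?e s r * (q s x z * q r z y) \<partial>m) = ?e s r * (indicator {0<..} s * indicator {0<..} r * q (s + r) x y)"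
      by (simp add: nn_integral_cmult)
  qed
  also have "\<dots> = (\<integral>\<^sup>+r. (\<integral>\<^sup>+s. ?e s r * (indicator {0<..} s * indicator {0<..} r * q (s + r) x y) \<partial>lborel) \<partial>lborel)"
    by (rule lborel_pair.Fubini') measurable
  also have "\<dots> = (\<integral>\<^sup>+r. (\<integral>\<^sup>+u. ?e (u - r) r * (indicator {0<..} (u - r) * indicator {0<..} r * q u x y) \<partial>lborel) \<partial>lborel)"
  proof (rule nn_integral_cong)
    fix r :: real
    show "(\<integral>\<^sup>+s. ?e s r * (indicator {0<..} s * indicator {0<..} r * q (s + r) x y) \<partial>lborel) =
      (\<integral>\<^sup>+u. ?e (u - r) r * (indicator {0<..} (u - r) * indicator {0<..} r * q u x y) \<partial>lborel)"
      by (subst nn_integral_real_affine[where c=1 and t="- r"]) (auto simp: algebra_simps)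
  qed
  also have "\<dots> = (\<integral>\<^sup>+u. (\<integral>\<^sup>+r. ?e (u - r) r * (indicator {0<..} (u - r) * indicator {0<..} r * q u x y) \<partial>lborel) \<partial>lborel)"
    by (rule lborel_pair.Fubini') measurable
  also have "\<dots> = (\<integral>\<^sup>+u. (\<integral>\<^sup>+r. q u x y * (ennreal (exp (- a * (u - r) - b * r)) * indicator {0<..<u} r) \<partial>lborel) \<partial>lborel)"
  proof (intro nn_integral_cong)
    fix u r :: real
    have "?e (u - r) r = ennreal (exp (- a * (u - r) - b * r))"
      by (simp add: ennreal_mult[symmetric] exp_add[symmetric])
    then show "?e (u - r) r * (indicator {0<..} (u - r) * indicator {0<..} r * q u x y) =
       q u x y * (ennreal (exp (- a * (u - r) - b * r)) * indicator {0<..<u} r)"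
      by (auto simp: indicator_def mult.commute)
  qed
  finally show ?thesis by (simp add: nn_integral_cmult)
qed

text \<open>For equal exponents the inner time integral is \<open>u * exp (- a * u)\<close>. Its
  factor \<open>u\<close> matches the order of the weight of \<open>R\<close> at time 0, which ties
  the covariance of \<open>R\<close> to the square of the resolvent density.\<close>

lemma ubar_square:
  assumes a: "0 < a"
  shows "(\<integral>\<^sup>+z. ubar m p a x z * ubar m p a z y \<partial>m) = ennreal (cv (\<lambda>s. s * exp (- a * s)) x y)"
proof -
  have "(\<integral>\<^sup>+z. ubar m p a x z * ubar m p a z y \<partial>m) = (\<integral>\<^sup>+u. ennreal (u * exp (- a * u) * pb u x y) \<partial>lborel)"
    unfolding ubar_convolution
  proof (intro nn_integral_cong)
    fix u :: real
    have eq: "- a * (u - r) - a * r = - a * u" for r by (simp add: algebra_simps)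
    show "q u x y * (\<integral>\<^sup>+r. ennreal (exp (- a * (u - r) - a * r)) * indicator {0<..<u} r \<partial>lborel) = ennreal (u * exp (- a * u) * pb u x y)"
    proof (cases "0 < u")
      case True
      have "(\<integral>\<^sup>+r. ennreal (exp (- a * u)) * indicator {0<..<u} r \<partial>lborel) = ennreal (exp (- a * u)) * ennreal u"
        using True by (subst nn_integral_cmult) auto
      then show ?thesis
        unfolding eq using True by (simp add: q_eq_pb ennreal_mult[symmetric] pb_nonneg mult_ac)
    qed (simp add: q_def pb_nonpos_time)
  qed
  also have "\<dots> = ennreal (cv (\<lambda>s. s * exp (- a * s)) x y)"
  proof -
    have "0 \<le> s * exp (- a * s) * pb s x y" for s
      by (cases "0 < s") (auto simp: pb_nonneg pb_nonpos_time)
    then show ?thesis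
      unfolding cv_def using cv_integrable[OF exp_dominated_times_exp[OF a], of x y]
      by (subst nn_integral_eq_integral) auto
  qed
  finally show ?thesis .
qed

text \<open>The resolvent equation, with all terms added so that no extended reals are subtracted.
  The inner time integral has an explicit primitive, and its boundary values are the two
  exponentials.\<close>

lemma ubar_resolvent:
  assumes a: "0 < a" and b: "0 < b"
  shows "ubar m p a x y = ubar m p (a + b) x y + ennreal b * (\<integral>\<^sup>+z. ubar m p (a + b) x z * ubar m p a z y \<partial>m)"
proof -
  have inner: "ennreal b * (\<integral>\<^sup>+r. ennreal (exp (- (a + b) * (u - r) - a * r)) * indicator {0<..<u} r \<partial>lborel)
     = ennreal (exp (- a * u) - exp (- (a + b) * u))" if u: "0 < u" for u
  proof -
    let ?f = "\<lambda>r. b * exp (- (a + b) * (u - r) - a * r)"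
    have "ennreal b * (\<integral>\<^sup>+r. ennreal (exp (- (a + b) * (u - r) - a * r)) * indicator {0<..<u} r \<partial>lborel)
      = (\<integral>\<^sup>+r. ennreal (?f r) * indicator {0<..<u} r \<partial>lborel)"
      using b by (simp add: nn_integral_cmult[symmetric] ennreal_mult mult.assoc)
    also have "\<dots> = (\<integral>\<^sup>+r. ennreal (?f r) * indicator {0..u} r \<partial>lborel)"
      using AE_lborel_singleton[of 0] AE_lborel_singleton[of u]
      by (intro nn_integral_cong_AE) (auto simp: indicator_def elim!: eventually_elim2)
    also have "\<dots> = ennreal (exp (- (a + b) * (u - u) - a * u) - exp (- (a + b) * (u - 0) - a * 0))"
      by (rule nn_integral_FTC_Icc) (use u b in \<open>auto intro!: derivative_eq_intros simp: algebra_simps\<close>)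
    finally show ?thesis by simp
  qed
  have meas: "(\<lambda>u. \<integral>\<^sup>+r. ennreal (exp (- (a + b) * (u - r) - a * r)) * indicator {0<..<u} r \<partial>lborel) \<in> borel_measurable borel"
  proof -
    have "indicator {0<..<u} r = (indicator {0<..} (u - r) * indicator {0<..} r :: ennreal)" for u r :: real
      by (auto simp: indicator_def)
    then show ?thesis by (simp only:) measurable
  qed
  have "ennreal b * (\<integral>\<^sup>+z. ubar m p (a + b) x z * ubar m p a z y \<partial>m) =
    (\<integral>\<^sup>+u. ennreal b * (q u x y * (\<integral>\<^sup>+r. ennreal (exp (- (a + b) * (u - r) - a * r)) * indicator {0<..<u} r \<partial>lborel)) \<partial>lborel)"
    unfolding ubar_convolution
    by (rule nn_integral_cmult[symmetric], rule borel_measurable_times_ennreal, measurable) (simp add: meas)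
  also have "\<dots> = (\<integral>\<^sup>+u. q u x y * ennreal (exp (- a * u) - exp (- (a + b) * u)) \<partial>lborel)"
  proof (intro nn_integral_cong)
    fix u :: real
    show "ennreal b * (q u x y * (\<integral>\<^sup>+r. ennreal (exp (- (a + b) * (u - r) - a * r)) * indicator {0<..<u} r \<partial>lborel)) =
      q u x y * ennreal (exp (- a * u) - exp (- (a + b) * u))"
    proof (cases "0 < u")
      case True
      then show ?thesis using inner[OF True] by (simp only: mult.left_commute[of "ennreal b"])
    qed (simp add: q_def)
  qed
  finally have "ubar m p (a + b) x y + ennreal b * (\<integral>\<^sup>+z. ubar m p (a + b) x z * ubar m p a z y \<partial>m) =
    (\<integral>\<^sup>+u. ennreal (exp (- (a + b) * u)) * q u x y + q u x y * ennreal (exp (- a * u) - exp (- (a + b) * u)) \<partial>lborel)"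
    unfolding ubar_eq[of "a + b" x y] by (simp add: nn_integral_add)
  also have "\<dots> = ubar m p a x y"
    unfolding ubar_eq
  proof (intro nn_integral_cong)
    fix u :: real
    show "ennreal (exp (- (a + b) * u)) * q u x y + q u x y * ennreal (exp (- a * u) - exp (- (a + b) * u)) = ennreal (exp (- a * u)) * q u x y"
    proof (cases "0 < u")
      case True
      then have "exp (- (a + b) * u) \<le> exp (- a * u)" using b by (simp add: algebra_simps)
      then have "ennreal (exp (- a * u)) = ennreal (exp (- (a + b) * u)) + ennreal (exp (- a * u) - exp (- (a + b) * u))"
        by (simp add: ennreal_plus[symmetric] del: ennreal_plus)
      then show ?thesis by (simp add: distrib_left mult.commute)
    qed (simp add: q_def)
  qed
  finally show ?thesis by simp
qed

lemma ubar_total: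
  assumes a: "0 < a"
  shows "(\<integral>\<^sup>+z. ubar m p a x z \<partial>m) \<le> ennreal (1 / a)"
proof -
  interpret Lm: pair_sigma_finite lborel m ..
  have "(\<integral>\<^sup>+z. ubar m p a x z \<partial>m) = (\<integral>\<^sup>+s. (\<integral>\<^sup>+z. ennreal (exp (- a * s)) * q s x z \<partial>m) \<partial>lborel)"
    unfolding ubar_eq by (rule Lm.Fubini') measurable
  also have "\<dots> \<le> (\<integral>\<^sup>+s. ennreal (exp (- a * s)) * indicator {0<..} s \<partial>lborel)"
  proof (intro nn_integral_mono)
    fix s :: real
    show "(\<integral>\<^sup>+z. ennreal (exp (- a * s)) * q s x z \<partial>m) \<le> ennreal (exp (- a * s)) * indicator {0<..} s"
    proof (cases "0 < s")
      case True
      then show ?thesis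
        using mult_left_mono[OF q_total[of s x], of "ennreal (exp (- a * s))"] by (simp add: nn_integral_cmult)
    qed (simp add: q_def)
  qed
  also have "\<dots> = ennreal (1 / a)" by (rule nn_integral_exp_neg[OF a])
  finally show ?thesis .
qed

lemma ub_measurable [measurable (raw)]:
  assumes "0 < a" "f \<in> measurable M borel" "g \<in> measurable M borel"
  shows "(\<lambda>z. ub a (f z) (g z)) \<in> borel_measurable M"
  unfolding ub_def using assms by (intro cv_measurable exp_dominated_exp)

lemma ub_nonneg: "0 \<le> ub a x y"
  unfolding ub_def by (rule cv_nonneg) simp

lemma ub_total:
  assumes a: "0 < a"
  shows "integrable m (ub a x)" "(LINT z|m. ub a x z) \<le> 1 / a"
proof -
  note [measurable (raw)] = ub_measurable[OF a]
  have n: "(\<integral>\<^sup>+z. ennreal (ub a x z) \<partial>m) \<le> ennreal (1 / a)"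
    using ubar_total[OF a, of x] by (simp add: ubar_eq_ub[OF a])
  then have "(\<integral>\<^sup>+z. ennreal (ub a x z) \<partial>m) < \<infinity>" by (rule order_le_less_trans) simp
  then show i: "integrable m (ub a x)"
    by (intro integrableI_nonneg) (auto simp: ub_nonneg)
  show "(LINT z|m. ub a x z) \<le> 1 / a"
    using n a nn_integral_eq_integral[OF i] ub_nonneg by (auto simp: ennreal_le_iff)
qed

end

section \<open>The maximum principle for signed densities\<close>

context bar_semigroup
begin

lemma ub_resolvent:
  assumes b: "0 < b"
  shows "integrable m (\<lambda>w. ub (\<beta> + b) z w * ub \<beta> w y)"
    and "ub \<beta> z y = ub (\<beta> + b) z y + b * (LINT w|m. ub (\<beta> + b) z w * ub \<beta> w y)"
proof -
  have bb: "0 < \<beta> + b" using b \<beta>_pos by simp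
  note [measurable (raw)] = ub_measurable[OF bb] ub_measurable[OF \<beta>_pos]
  have R: "ennreal (ub \<beta> z y) = ennreal (ub (\<beta> + b) z y) + ennreal b * (\<integral>\<^sup>+w. ennreal (ub (\<beta> + b) z w * ub \<beta> w y) \<partial>m)"
    using ubar_resolvent[OF \<beta>_pos b, of z y]
    by (simp only: ubar_eq_ub[OF bb] ubar_eq_ub[OF \<beta>_pos] ennreal_mult' ub_nonneg)
  have fin: "(\<integral>\<^sup>+w. ennreal (ub (\<beta> + b) z w * ub \<beta> w y) \<partial>m) < \<infinity>"
  proof (rule ccontr)
    assume "\<not> ?thesis"
    then have "(\<integral>\<^sup>+w. ennreal (ub (\<beta> + b) z w * ub \<beta> w y) \<partial>m) = top" by (simp only: less_top[symmetric] infinity_ennreal_def not_not)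
    then have "ennreal (ub \<beta> z y) = top" unfolding R using b by (simp add: ennreal_mult_top)
    then show False by simp
  qed
  show i: "integrable m (\<lambda>w. ub (\<beta> + b) z w * ub \<beta> w y)"
    by (rule integrableI_nonneg[OF _ _ fin], measurable) (simp add: ub_nonneg)
  have n: "(\<integral>\<^sup>+w. ennreal (ub (\<beta> + b) z w * ub \<beta> w y) \<partial>m) = ennreal (LINT w|m. ub (\<beta> + b) z w * ub \<beta> w y)"
    using i by (rule nn_integral_eq_integral) (simp add: ub_nonneg)
  have L0: "0 \<le> (LINT w|m. ub (\<beta> + b) z w * ub \<beta> w y)" by (simp add: ub_nonneg)
  have "ennreal (ub \<beta> z y) = ennreal (ub (\<beta> + b) z y + b * (LINT w|m. ub (\<beta> + b) z w * ub \<beta> w y))"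
    unfolding R n using b L0 ub_nonneg[of "\<beta> + b" z y] by (simp add: ennreal_mult[symmetric] ennreal_plus[symmetric] del: ennreal_plus)
  then show "ub \<beta> z y = ub (\<beta> + b) z y + b * (LINT w|m. ub (\<beta> + b) z w * ub \<beta> w y)"
    using b L0 ub_nonneg[of \<beta> z y] ub_nonneg[of "\<beta> + b" z y] by (subst (asm) ennreal_inj) auto
qed

lemma bounded_density_integrable:
  assumes a: "0 < a" and [measurable]: "g \<in> borel_measurable borel" and g: "\<And>y. \<bar>g y\<bar> \<le> B"
  shows "integrable m (\<lambda>y. ub a z y * g y)" "\<bar>LINT y|m. ub a z y * g y\<bar> \<le> B / a"
proof -
  note [measurable (raw)] = ub_measurable[OF a]
  have le: "\<bar>ub a z y * g y\<bar> \<le> B * ub a z y" for y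
    unfolding abs_mult using g[of y] mult_right_mono[OF g[of y], of "ub a z y"] ub_nonneg[of a z y] by (simp add: mult.commute)
  have i: "integrable m (\<lambda>y. B * ub a z y)" using ub_total(1)[OF a] by simp
  show ii: "integrable m (\<lambda>y. ub a z y * g y)"
    by (rule Bochner_Integration.integrable_bound[OF i], measurable) (use le in \<open>simp add: abs_ge_self order_trans[OF _ abs_ge_self]\<close>)
  have B0: "0 \<le> B" using g[of z] by linarith
  have "\<bar>LINT y|m. ub a z y * g y\<bar> \<le> (LINT y|m. B * ub a z y)"
    using integral_abs_bound[of m "\<lambda>y. ub a z y * g y"] integral_mono[OF integrable_abs[OF ii] i le] by linarith
  also have "\<dots> = B * (LINT y|m. ub a z y)" by simp
  also have "\<dots> \<le> B * (1 / a)" using ub_total(2)[OF a] B0 by (intro mult_left_mono)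
  finally show "\<bar>LINT y|m. ub a z y * g y\<bar> \<le> B / a" by simp
qed

text \<open>This form of the resolvent equation puts the potential \<open>h\<close> next to a
  supermedian function, for which \<open>b\<close> times the resolvent at \<open>\<beta> + b\<close>
  decreases values: the two relations are subtracted in the maximum principle.\<close>

lemma ub_density_resolvent:
  assumes b: "0 < b" and [measurable]: "f \<in> borel_measurable borel" and f: "\<And>y. \<bar>f y\<bar> \<le> B"
  defines "h \<equiv> \<lambda>z. LINT y|m. ub \<beta> z y * f y"
  shows "h z = (LINT y|m. ub (\<beta> + b) z y * (f y + b * h y))"
proof -
  have bb: "0 < \<beta> + b" using b \<beta>_pos by simp
  note [measurable (raw)] = ub_measurable[OF bb] ub_measurable[OF \<beta>_pos]
  interpret mm: pair_sigma_finite m m ..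
  have B0: "0 \<le> B" using f[of z] by linarith
  have hm[measurable]: "h \<in> borel_measurable borel" unfolding h_def by measurable
  have hb: "\<bar>h y\<bar> \<le> B / \<beta>" for y unfolding h_def by (rule bounded_density_integrable[OF \<beta>_pos _ f]) measurable
  have int: "integrable (m \<Otimes>\<^sub>M m) (case_prod (\<lambda>w y. ub (\<beta> + b) z w * (ub \<beta> w y * f y)))"
  proof (rule integrableI_bounded)
    have "(\<integral>\<^sup>+wy. ennreal (norm (case_prod (\<lambda>w y. ub (\<beta> + b) z w * (ub \<beta> w y * f y)) wy)) \<partial>(m \<Otimes>\<^sub>M m)) =
      (\<integral>\<^sup>+w. (\<integral>\<^sup>+y. ennreal (norm (ub (\<beta> + b) z w * (ub \<beta> w y * f y))) \<partial>m) \<partial>m)"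
      by (subst m.nn_integral_fst[symmetric]) auto
    also have "\<dots> \<le> (\<integral>\<^sup>+w. ennreal (ub (\<beta> + b) z w) * (ennreal B * ennreal (1 / \<beta>)) \<partial>m)"
    proof (rule nn_integral_mono)
      fix w
      have "(\<integral>\<^sup>+y. ennreal (norm (ub (\<beta> + b) z w * (ub \<beta> w y * f y))) \<partial>m) \<le>
        (\<integral>\<^sup>+y. ennreal (ub (\<beta> + b) z w) * (ennreal B * ubar m p \<beta> w y) \<partial>m)"
      proof (rule nn_integral_mono)
        fix y
        have "norm (ub (\<beta> + b) z w * (ub \<beta> w y * f y)) \<le> ub (\<beta> + b) z w * (B * ub \<beta> w y)"
          using f[of y] ub_nonneg[of "\<beta> + b" z w] ub_nonneg[of \<beta> w y]
          by (simp add: abs_mult) (metis mult.commute mult_left_mono)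
        then show "ennreal (norm (ub (\<beta> + b) z w * (ub \<beta> w y * f y))) \<le> ennreal (ub (\<beta> + b) z w) * (ennreal B * ubar m p \<beta> w y)"
          unfolding ubar_eq_ub[OF \<beta>_pos] using B0 ub_nonneg[of "\<beta> + b" z w] ub_nonneg[of \<beta> w y]
          by (simp add: ennreal_mult[symmetric] ennreal_leI)
      qed
      also have "\<dots> = ennreal (ub (\<beta> + b) z w) * (ennreal B * (\<integral>\<^sup>+y. ubar m p \<beta> w y \<partial>m))"
        by (simp add: nn_integral_cmult)
      also have "\<dots> \<le> ennreal (ub (\<beta> + b) z w) * (ennreal B * ennreal (1 / \<beta>))"
        by (intro mult_left_mono ubar_total \<beta>_pos) auto
      finally show "(\<integral>\<^sup>+y. ennreal (norm (ub (\<beta> + b) z w * (ub \<beta> w y * f y))) \<partial>m) \<le> ennreal (ub (\<beta> + b) z w) * (ennreal B * ennreal (1 / \<beta>))" .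
    qed
    also have "\<dots> = (\<integral>\<^sup>+w. ubar m p (\<beta> + b) z w \<partial>m) * (ennreal B * ennreal (1 / \<beta>))"
      unfolding ubar_eq_ub[OF bb] by (rule nn_integral_multc) measurable
    also have "\<dots> \<le> ennreal (1 / (\<beta> + b)) * (ennreal B * ennreal (1 / \<beta>))"
      by (intro mult_right_mono ubar_total bb) auto
    also have "\<dots> < \<infinity>" by (simp add: ennreal_mult_less_top)
    finally show "(\<integral>\<^sup>+wy. ennreal (norm (case_prod (\<lambda>w y. ub (\<beta> + b) z w * (ub \<beta> w y * f y)) wy)) \<partial>(m \<Otimes>\<^sub>M m)) < \<infinity>" .
  qed measurable
  have i1: "integrable m (\<lambda>y. ub (\<beta> + b) z y * f y)" by (rule bounded_density_integrable(1)[OF bb _ f]) measurable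
  have i2: "integrable m (\<lambda>y. ub (\<beta> + b) z y * h y)" by (rule bounded_density_integrable(1)[OF bb _ hb]) measurable
  have i3: "integrable m (\<lambda>y. (LINT w|m. ub (\<beta> + b) z w * ub \<beta> w y) * f y)"
    using mm.integrable_snd[OF int] by (simp add: mult.assoc[symmetric])
  have "h z = (LINT y|m. ub (\<beta> + b) z y * f y + b * ((LINT w|m. ub (\<beta> + b) z w * ub \<beta> w y) * f y))"
    unfolding h_def by (rule Bochner_Integration.integral_cong[OF refl]) (subst ub_resolvent(2)[OF b], simp add: distrib_right)
  also have "\<dots> = (LINT y|m. ub (\<beta> + b) z y * f y) + b * (LINT y|m. (LINT w|m. ub (\<beta> + b) z w * ub \<beta> w y) * f y)"
    using i1 i3 by simp
  also have "(LINT y|m. (LINT w|m. ub (\<beta> + b) z w * ub \<beta> w y) * f y) = (LINT y|m. (LINT w|m. ub (\<beta> + b) z w * (ub \<beta> w y * f y)))"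
    by (simp add: mult.assoc[symmetric])
  also have "\<dots> = (LINT w|m. (LINT y|m. ub (\<beta> + b) z w * (ub \<beta> w y * f y)))"
    by (rule mm.Fubini_integral[OF int])
  also have "\<dots> = (LINT w|m. ub (\<beta> + b) z w * h w)" by (simp add: h_def)
  also have "(LINT y|m. ub (\<beta> + b) z y * f y) + b * (LINT w|m. ub (\<beta> + b) z w * h w) = (LINT y|m. ub (\<beta> + b) z y * (f y + b * h y))"
    using i1 i2 by (simp add: distrib_left mult.left_commute[of _ b])
  finally show ?thesis .
qed

text \<open>Deny's argument: with \<open>u\<close> the difference of the two sides, the resolvent equation for large \<open>b\<close> gives
  \<open>sup u\<^sup>+ \<le> b / (\<beta> + b) \<cdot> sup u\<^sup>+\<close>.\<close>

lemma maximum_principle_density: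
  assumes [measurable]: "f \<in> borel_measurable borel" and f: "\<And>y. \<bar>f y\<bar> \<le> B"
    and [measurable]: "\<phi> \<in> borel_measurable borel" and \<phi>0: "\<And>y. 0 \<le> \<phi> y"
    and superm: "\<And>b z. 0 < b \<Longrightarrow> ennreal b * (\<integral>\<^sup>+y. ubar m p (\<beta> + b) z y * ennreal (\<phi> y) \<partial>m) \<le> ennreal (\<phi> z)"
    and \<delta>: "0 < \<delta>" and neg: "\<And>y. 0 < f y \<Longrightarrow> (LINT w|m. ub \<beta> y w * f w) - \<phi> y \<le> - \<delta>"
  shows "(LINT y|m. ub \<beta> z y * f y) \<le> \<phi> z"
proof -
  define h where "h z = (LINT y|m. ub \<beta> z y * f y)" for z
  have B0: "0 \<le> B" using f[of z] by linarith
  \<comment> \<open>So large that, where \<open>f\<close> is positive, the loss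
    \<open>b * \<delta>\<close> exceeds the bound \<open>B\<close> of \<open>f\<close>; the
    integrand in \<open>step\<close> is then nonpositive there.\<close>
  define b where "b = (B + 1) / \<delta>"
  have b: "0 < b" using B0 \<delta> by (simp add: b_def)
  have bb: "0 < \<beta> + b" using b \<beta>_pos by simp
  note [measurable (raw)] = ub_measurable[OF bb] ub_measurable[OF \<beta>_pos]
  have hm[measurable]: "h \<in> borel_measurable borel" unfolding h_def by measurable
  have hb: "\<bar>h y\<bar> \<le> B / \<beta>" for y unfolding h_def by (rule bounded_density_integrable[OF \<beta>_pos _ f]) measurable
  define \<rho> where "\<rho> = b / (\<beta> + b)"
  have \<rho>: "0 \<le> \<rho>" "\<rho> < 1" using b \<beta>_pos by (auto simp: \<rho>_def)
  have \<phi>int: "integrable m (\<lambda>y. ub (\<beta> + b) z y * \<phi> y)" "b * (LINT y|m. ub (\<beta> + b) z y * \<phi> y) \<le> \<phi> z" for z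
  proof -
    let ?I = "\<integral>\<^sup>+y. ennreal (ub (\<beta> + b) z y * \<phi> y) \<partial>m"
    have le: "ennreal b * ?I \<le> ennreal (\<phi> z)"
      using superm[OF b, of z] by (simp only: ubar_eq_ub[OF bb] ennreal_mult' ub_nonneg)
    have fin: "?I < \<infinity>"
    proof (rule ccontr)
      assume "\<not> ?I < \<infinity>"
      then have "?I = top" by (simp only: less_top[symmetric] infinity_ennreal_def not_not)
      then show False using le b by (simp add: ennreal_mult_top top_unique)
    qed
    show i: "integrable m (\<lambda>y. ub (\<beta> + b) z y * \<phi> y)"
      by (rule integrableI_nonneg[OF _ _ fin], measurable) (simp add: ub_nonneg \<phi>0)
    have "?I = ennreal (LINT y|m. ub (\<beta> + b) z y * \<phi> y)"
      using i by (rule nn_integral_eq_integral) (simp add: ub_nonneg \<phi>0)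
    then show "b * (LINT y|m. ub (\<beta> + b) z y * \<phi> y) \<le> \<phi> z"
      using le b \<phi>0[of z] by (simp add: ennreal_mult'[symmetric] ennreal_le_iff)
  qed
  have step: "h z - \<phi> z \<le> \<rho> * s" if s0: "0 \<le> s" and s: "\<And>y. h y - \<phi> y \<le> s" for z and s :: real
  proof -
    have i1: "integrable m (\<lambda>y. ub (\<beta> + b) z y * (f y + b * h y))"
    proof (rule bounded_density_integrable(1)[OF bb])
      fix y
      have "\<bar>b * h y\<bar> \<le> b * (B / \<beta>)" using b mult_left_mono[OF hb[of y], of b] by (simp add: abs_mult)
      then show "\<bar>f y + b * h y\<bar> \<le> B + b * (B / \<beta>)" using f[of y] by linarith
    qed measurable
    have pw: "f y + b * h y - b * \<phi> y \<le> b * s" for y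
    proof (cases "0 < f y")
      case True
      have "b * (h y - \<phi> y) \<le> b * (- \<delta>)" using neg[OF True] b by (intro mult_left_mono) (auto simp: h_def)
      also have "\<dots> = - (B + 1)" using \<delta> by (simp add: b_def)
      finally have "f y + b * h y - b * \<phi> y \<le> 0" using f[of y] by (simp add: algebra_simps)
      then show ?thesis using b s0 by (meson mult_nonneg_nonneg less_imp_le order_trans)
    next
      case False
      have "b * (h y - \<phi> y) \<le> b * s" using s[of y] b by (intro mult_left_mono) auto
      then show ?thesis using False by (simp add: algebra_simps)
    qed
    have "h z - \<phi> z \<le> (LINT y|m. ub (\<beta> + b) z y * (f y + b * h y)) - b * (LINT y|m. ub (\<beta> + b) z y * \<phi> y)"
      using \<phi>int(2)[of z] ub_density_resolvent[where z=z, OF b _ f] by (simp add: h_def)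
    also have "\<dots> = (LINT y|m. ub (\<beta> + b) z y * (f y + b * h y) - b * (ub (\<beta> + b) z y * \<phi> y))"
      using i1 \<phi>int(1) by simp
    also have "\<dots> \<le> (LINT y|m. ub (\<beta> + b) z y * (b * s))"
    proof (rule integral_mono)
      show "integrable m (\<lambda>y. ub (\<beta> + b) z y * (f y + b * h y) - b * (ub (\<beta> + b) z y * \<phi> y))"
        using i1 \<phi>int(1) by simp
      show "integrable m (\<lambda>y. ub (\<beta> + b) z y * (b * s))" using ub_total(1)[OF bb] by simp
      fix y
      show "ub (\<beta> + b) z y * (f y + b * h y) - b * (ub (\<beta> + b) z y * \<phi> y) \<le> ub (\<beta> + b) z y * (b * s)"
        using mult_left_mono[OF pw[of y] ub_nonneg[of "\<beta> + b" z y]] by (simp add: algebra_simps)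
    qed
    also have "\<dots> = (b * s) * (LINT y|m. ub (\<beta> + b) z y)" by simp
    also have "\<dots> \<le> (b * s) * (1 / (\<beta> + b))" using ub_total(2)[OF bb, of z] b s0 by (intro mult_left_mono) auto
    finally show ?thesis by (simp add: \<rho>_def)
  qed
  \<comment> \<open>Instead of taking a supremum, the bound is iterated from the trivial one, in
    which the potential is at most \<open>B / \<beta>\<close>.\<close>
  have iter: "h z - \<phi> z \<le> \<rho> ^ n * (B / \<beta>)" for n z
  proof (induction n arbitrary: z)
    case 0
    then show ?case using hb[of z] \<phi>0[of z] by simp
  next
    case (Suc n)
    show ?case using step[where s="\<rho> ^ n * (B / \<beta>)" and z=z, OF _ Suc.IH] \<rho> B0 \<beta>_pos by (simp add: mult.assoc)
  qed
  have "(\<lambda>n. \<rho> ^ n * (B / \<beta>)) \<longlonglongrightarrow> 0 * (B / \<beta>)"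
    using \<rho> by (intro tendsto_intros LIMSEQ_power_zero) auto
  then have "h z - \<phi> z \<le> 0 * (B / \<beta>)" by (rule LIMSEQ_le_const) (use iter in auto)
  then show ?thesis by (simp add: h_def)
qed

end

section \<open>The domination principle for finite combinations of point masses\<close>

context bar_semigroup
begin

lemma ub_continuous: "continuous_on UNIV (\<lambda>z. ub \<beta> (fst z) (snd z))"
  using ubar_cont by (simp add: ubar_eq_ub[OF \<beta>_pos] ub_nonneg split_beta')

lemma ub_near:
  assumes "0 < e"
  shows "\<forall>\<^sub>F r in at_right 0. \<forall>w\<in>ball x r. \<forall>y\<in>ball x' r. \<bar>ub \<beta> w y - ub \<beta> x x'\<bar> < e"
proof -
  have "isCont (\<lambda>z. ub \<beta> (fst z) (snd z)) (x, x')"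
    using ub_continuous by (simp add: continuous_on_eq_continuous_at)
  from this[unfolded continuous_at_eps_delta, rule_format, OF assms]
  obtain d where d: "0 < d" "\<And>z. dist z (x, x') < d \<Longrightarrow> \<bar>ub \<beta> (fst z) (snd z) - ub \<beta> x x'\<bar> < e"
    by (auto simp: dist_real_def)
  have "\<bar>ub \<beta> w y - ub \<beta> x x'\<bar> < e" if r: "r < d / 2" and w: "w \<in> ball x r" and y: "y \<in> ball x' r" for r w y
  proof -
    have "dist (w, y) (x, x') \<le> dist w x + dist y x'"
      unfolding dist_Pair_Pair by (rule sqrt_sum_squares_le_sum) auto
    also have "\<dots> < d" using r w y by (simp add: dist_commute)
    finally show ?thesis using d(2)[of "(w, y)"] by simp
  qed
  then show ?thesis
    unfolding eventually_at_right_field using d(1) by (intro exI[of _ "d / 2"]) auto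
qed

text \<open>The point masses are replaced by uniform distributions on small balls.\<close>

lemma domination_principle:
  assumes F: "finite F"
    and \<phi>m[measurable]: "\<phi> \<in> borel_measurable borel" and \<phi>0: "\<And>y. 0 \<le> \<phi> y"
    and superm: "\<And>b z. 0 < b \<Longrightarrow> ennreal b * (\<integral>\<^sup>+y. ubar m p (\<beta> + b) z y * ennreal (\<phi> y) \<partial>m) \<le> ennreal (\<phi> z)"
    and cont: "\<And>x. x \<in> F \<Longrightarrow> isCont \<phi> x"
    and lt: "\<And>y. y \<in> F \<Longrightarrow> (\<Sum>x\<in>F. c x * ub \<beta> x y) < \<phi> y"
  shows "(\<Sum>x\<in>F. c x * ub \<beta> x z) \<le> \<phi> z"
proof (cases "F = {}")
  case True
  then show ?thesis using \<phi>0 by simp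
next
  case False
  note [measurable (raw)] = ub_measurable[OF \<beta>_pos]
  define h where "h y = (\<Sum>x\<in>F. c x * ub \<beta> x y)" for y
  define g where "g = Min ((\<lambda>y. \<phi> y - h y) ` F)"
  have g: "0 < g" unfolding g_def using F False lt by (subst Min_gr_iff) (auto simp: h_def)
  have gle: "h y + g \<le> \<phi> y" if "y \<in> F" for y
  proof -
    have "g \<le> \<phi> y - h y" unfolding g_def using F that by (intro Min_le) auto
    then show ?thesis by simp
  qed
  define S where "S = (\<Sum>x\<in>F. \<bar>c x\<bar>)"
  have S0: "0 \<le> S" by (simp add: S_def sum_nonneg)
  have "h z \<le> \<phi> z + \<eta>" if \<eta>: "0 < \<eta>" for \<eta>
  proof -
    \<comment> \<open>Smearing the point masses moves the potential by at most \<open>S * e\<close>: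
      half of the gap \<open>g\<close> on the balls, and \<open>\<eta>\<close> at \<open>z\<close>.
      Of the remaining half, \<open>g / 4\<close> pays for the oscillation of \<open>\<phi>\<close>,
      and \<open>g / 4\<close> is the margin that the maximum principle asks for.\<close>
    define e where "e = min (g / (2 * (S + 1))) (\<eta> / (S + 1))"
    have e: "0 < e" using g \<eta> S0 by (simp add: e_def)
    have "S * e \<le> S * (g / (2 * (S + 1)))" using S0 by (intro mult_left_mono) (auto simp: e_def)
    also have "\<dots> \<le> g / 2" using S0 g by (simp add: field_simps)
    finally have Se1: "S * e \<le> g / 2" .
    have "S * e \<le> S * (\<eta> / (S + 1))" using S0 by (intro mult_left_mono) (auto simp: e_def)
    also have "\<dots> \<le> \<eta>" using S0 \<eta> by (simp add: field_simps)
    finally have Se2: "S * e \<le> \<eta>" .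
    have ev1: "\<forall>\<^sub>F r in at_right 0. \<forall>x\<in>F. \<forall>x'\<in>F. \<forall>w\<in>ball x r. \<forall>y\<in>ball x' r. \<bar>ub \<beta> w y - ub \<beta> x x'\<bar> < e"
      using F ub_near[OF e] by (simp add: eventually_ball_finite_distrib)
    have ev2: "\<forall>\<^sub>F r in at_right 0. \<forall>x\<in>F. \<forall>w\<in>ball x r. \<forall>y\<in>ball z r. \<bar>ub \<beta> w y - ub \<beta> x z\<bar> < e"
      using F ub_near[OF e] by (simp add: eventually_ball_finite_distrib)
    have "\<forall>\<^sub>F r in at_right 0. \<forall>w\<in>ball x r. \<phi> x - g / 4 < \<phi> w" if xF: "x \<in> F" for x
    proof -
      obtain d where d: "0 < d" "\<And>w. dist w x < d \<Longrightarrow> \<bar>\<phi> w - \<phi> x\<bar> < g / 4"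
        using cont[OF xF, unfolded continuous_at_eps_delta, rule_format, of "g / 4"] g by (auto simp: dist_real_def)
      have "\<phi> x - g / 4 < \<phi> w" if "r < d" "w \<in> ball x r" for r w
      proof -
        have "dist w x < d" using that by (simp add: dist_commute)
        then have "\<bar>\<phi> w - \<phi> x\<bar> < g / 4" by (rule d(2))
        then show ?thesis by linarith
      qed
      then show ?thesis
        unfolding eventually_at_right_field using d(1) by (intro exI[of _ d]) auto
    qed
    then have ev3: "\<forall>\<^sub>F r in at_right 0. \<forall>x\<in>F. \<forall>w\<in>ball x r. \<phi> x - g / 4 < \<phi> w"
      using F by (simp add: eventually_ball_finite_distrib)
    have "\<forall>\<^sub>F r in at_right 0. emeasure m (ball x r) < \<infinity>" for x
    proof -
      obtain d where d: "0 < d" "emeasure m (ball x d) < \<infinity>" using locally_finite by blast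
      have "emeasure m (ball x r) < \<infinity>" if "r < d" for r
      proof -
        have "emeasure m (ball x r) \<le> emeasure m (ball x d)" using that by (intro emeasure_mono) auto
        then show ?thesis using d(2) by simp
      qed
      then show ?thesis
        unfolding eventually_at_right_field using d(1) by (intro exI[of _ d]) auto
    qed
    then have ev4: "\<forall>\<^sub>F r in at_right 0. \<forall>x\<in>F. emeasure m (ball x r) < \<infinity>"
      using F by (simp add: eventually_ball_finite_distrib)
    have ev5: "\<forall>\<^sub>F r in at_right (0::real). 0 < r" by (rule eventually_at_right_less)
    have "\<exists>r. (\<forall>x\<in>F. \<forall>x'\<in>F. \<forall>w\<in>ball x r. \<forall>y\<in>ball x' r. \<bar>ub \<beta> w y - ub \<beta> x x'\<bar> < e) \<and>
        (\<forall>x\<in>F. \<forall>w\<in>ball x r. \<forall>y\<in>ball z r. \<bar>ub \<beta> w y - ub \<beta> x z\<bar> < e) \<and>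
        (\<forall>x\<in>F. \<forall>w\<in>ball x r. \<phi> x - g / 4 < \<phi> w) \<and> (\<forall>x\<in>F. emeasure m (ball x r) < \<infinity>) \<and> 0 < r"
      by (rule eventually_happens'[OF trivial_limit_at_right_real[of 0]]) (intro eventually_conj ev1 ev2 ev3 ev4 ev5)
    then obtain r where R: "\<forall>x\<in>F. \<forall>x'\<in>F. \<forall>w\<in>ball x r. \<forall>y\<in>ball x' r. \<bar>ub \<beta> w y - ub \<beta> x x'\<bar> < e"
        "\<forall>x\<in>F. \<forall>w\<in>ball x r. \<forall>y\<in>ball z r. \<bar>ub \<beta> w y - ub \<beta> x z\<bar> < e"
        "\<forall>x\<in>F. \<forall>w\<in>ball x r. \<phi> x - g / 4 < \<phi> w" "\<forall>x\<in>F. emeasure m (ball x r) < \<infinity>" and r: "0 < r"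
      by (elim exE conjE)
    note r1 = R(1)[rule_format] and r2 = R(2)[rule_format] and r3 = R(3)[rule_format] and r4 = R(4)[rule_format]
    define \<mu> where "\<mu> x = measure m (ball x r)" for x
    have \<mu>: "0 < \<mu> x" if "x \<in> F" for x
      using open_pos[of "ball x r" x] r r4[OF that] by (simp add: \<mu>_def measure_def enn2real_positive_iff)
    define f where "f y = (\<Sum>x\<in>F. c x * (indicator (ball x r) y / \<mu> x))" for y
    have [measurable]: "f \<in> borel_measurable borel" 
      unfolding f_def by (intro borel_measurable_sum borel_measurable_times borel_measurable_divide
        borel_measurable_const borel_measurable_indicator) auto
    have fB: "\<bar>f y\<bar> \<le> (\<Sum>x\<in>F. \<bar>c x\<bar> / \<mu> x)" for y
      unfolding f_def
    proof (rule order_trans[OF sum_abs sum_mono])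
      fix x assume "x \<in> F"
      then show "\<bar>c x * (indicator (ball x r) y / \<mu> x)\<bar> \<le> \<bar>c x\<bar> / \<mu> x"
        using \<mu>[of x] by (auto simp: indicator_def abs_mult)
    qed
    define A where "A x y = (LINT w|m. ub \<beta> y w * (indicator (ball x r) w / \<mu> x))" for x y
    have Ai: "integrable m (\<lambda>w. ub \<beta> y w * (indicator (ball x r) w / \<mu> x))" if "x \<in> F" for x y
      by (rule bounded_density_integrable(1)[OF \<beta>_pos, where B="1 / \<mu> x"])
         (use \<mu>[OF that] in \<open>auto simp: indicator_def\<close>)
    have A: "\<bar>A x y - v\<bar> \<le> e" if x: "x \<in> F" and near: "\<And>w. w \<in> ball x r \<Longrightarrow> \<bar>ub \<beta> w y - v\<bar> < e" for x y v
    proof -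
      have one: "integrable m (\<lambda>w. indicator (ball x r) w / \<mu> x)" "(LINT w|m. indicator (ball x r) w / \<mu> x) = 1"
        using \<mu>[OF x] r4[OF x] by (auto simp: \<mu>_def)
      have "A x y - v = (LINT w|m. ub \<beta> y w * (indicator (ball x r) w / \<mu> x)) - (LINT w|m. v * (indicator (ball x r) w / \<mu> x))"
        using one by (simp add: A_def)
      also have "\<dots> = (LINT w|m. (ub \<beta> y w - v) * (indicator (ball x r) w / \<mu> x))"
        using one(1) Ai[OF x, of y] by (simp add: left_diff_distrib del: times_divide_eq_right)
      finally have "\<bar>A x y - v\<bar> \<le> (LINT w|m. \<bar>(ub \<beta> y w - v) * (indicator (ball x r) w / \<mu> x)\<bar>)"
        using integral_abs_bound by metis
      also have "\<dots> \<le> (LINT w|m. e * (indicator (ball x r) w / \<mu> x))"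
      proof (rule integral_mono)
        show "integrable m (\<lambda>w. \<bar>(ub \<beta> y w - v) * (indicator (ball x r) w / \<mu> x)\<bar>)"
          using one(1) Ai[OF x, of y] by (intro integrable_abs) (simp add: left_diff_distrib del: times_divide_eq_right)
        show "integrable m (\<lambda>w. e * (indicator (ball x r) w / \<mu> x))" using one(1) by (rule integrable_mult_right)
        fix w
        show "\<bar>(ub \<beta> y w - v) * (indicator (ball x r) w / \<mu> x)\<bar> \<le> e * (indicator (ball x r) w / \<mu> x)"
          using near[of w] \<mu>[OF x] cv_sym[of "\<lambda>s. exp (- \<beta> * s)" y w]
          by (auto simp: indicator_def abs_mult ub_def intro!: divide_right_mono)
      qed
      also have "\<dots> = e" using one(2) by (simp del: times_divide_eq_right)
      finally show ?thesis .
    qed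
    have hf: "(LINT w|m. ub \<beta> y w * f w) = (\<Sum>x\<in>F. c x * A x y)" for y
    proof -
      have "(LINT w|m. ub \<beta> y w * f w) = (LINT w|m. (\<Sum>x\<in>F. c x * (ub \<beta> y w * (indicator (ball x r) w / \<mu> x))))"
        by (intro Bochner_Integration.integral_cong refl) (simp only: f_def sum_distrib_left mult.left_commute)
      also have "\<dots> = (\<Sum>x\<in>F. LINT w|m. c x * (ub \<beta> y w * (indicator (ball x r) w / \<mu> x)))"
        by (intro Bochner_Integration.integral_sum integrable_mult_right Ai)
      finally show ?thesis by (simp only: A_def integral_mult_right_zero)
    qed
    have close: "\<bar>(\<Sum>x\<in>F. c x * A x y) - (\<Sum>x\<in>F. c x * v x)\<bar> \<le> S * e"
      if "\<And>x. x \<in> F \<Longrightarrow> \<bar>A x y - v x\<bar> \<le> e" for y v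
    proof -
      have "\<bar>(\<Sum>x\<in>F. c x * A x y) - (\<Sum>x\<in>F. c x * v x)\<bar> = \<bar>\<Sum>x\<in>F. c x * (A x y - v x)\<bar>"
        by (simp add: sum_subtractf right_diff_distrib)
      also have "\<dots> \<le> (\<Sum>x\<in>F. \<bar>c x\<bar> * e)"
        by (rule order_trans[OF sum_abs sum_mono]) (auto simp: abs_mult intro!: mult_left_mono that)
      finally show ?thesis by (simp add: S_def sum_distrib_right)
    qed
    have "(LINT y|m. ub \<beta> z y * f y) \<le> \<phi> z"
    proof (rule maximum_principle_density[OF _ fB \<phi>m \<phi>0 superm])
      show "0 < g / 4" using g by simp
      fix y assume "0 < f y"
      \<comment> \<open>The weights may have either sign; it is enough that \<open>f\<close>
        vanishes outside the balls.\<close>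
      have "\<exists>x\<in>F. y \<in> ball x r"
      proof (rule ccontr)
        assume "\<not> ?thesis"
        then have "f y = 0" unfolding f_def by (intro sum.neutral) (auto simp: indicator_def)
        then show False using \<open>0 < f y\<close> by simp
      qed
      then obtain x where x: "x \<in> F" "y \<in> ball x r" by blast
      have "\<bar>(\<Sum>x'\<in>F. c x' * A x' y) - h x\<bar> \<le> S * e"
        unfolding h_def by (intro close A) (use x r1 in auto)
      then have "(\<Sum>x'\<in>F. c x' * A x' y) \<le> h x + g / 2" using Se1 by linarith
      then show "(LINT w|m. ub \<beta> y w * f w) - \<phi> y \<le> - (g / 4)"
        unfolding hf using r3[OF x] gle[OF x(1)] by linarith
    qed simp_all
    moreover have "\<bar>(\<Sum>x\<in>F. c x * A x z) - h z\<bar> \<le> S * e"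
      unfolding h_def by (intro close A) (use r2 r in auto)
    ultimately show ?thesis unfolding hf using Se2 by linarith
  qed
  then show ?thesis unfolding h_def by (rule field_le_epsilon)
qed

end

text \<open>The projection of the point mass at \<open>z\<close> onto the span of those in
  \<open>F\<close>. The Gram matrix may be singular, so the weights come from an orthonormal system
  and not from an inverse matrix.\<close>

lemma psd_projection:
  assumes F: "finite F" and psd: "psd_on k (insert z F)"
  shows "\<exists>\<pi>. \<forall>x\<in>F. (\<Sum>y\<in>F. \<pi> y * k y x) = k z x"
proof (cases "z \<in> F")
  case True
  then show ?thesis using F by (intro exI[of _ "\<lambda>y. of_bool (y = z)"] ballI) (simp only: sum_of_bool_eq_mult)
next
  case False
  let ?G = "insert z F"
  have fin: "finite ?G" using F by simp
  obtain n :: nat and d where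
    on: "\<And>i j. i < n \<Longrightarrow> j < n \<Longrightarrow> qform k F (d i) (d j) = of_bool (i = j)"
    and supp: "\<And>i w. i < n \<Longrightarrow> w \<notin> F \<Longrightarrow> d i w = 0"
    and rep: "\<And>x y. x \<in> F \<Longrightarrow> y \<in> F \<Longrightarrow> k x y = (\<Sum>i<n. (\<Sum>w\<in>F. d i w * k w x) * (\<Sum>w\<in>F. d i w * k w y))"
    using gram_schmidt[OF F psd_on_subset[OF psd _ fin]] by blast
  define g where "g i x = (\<Sum>w\<in>?G. d i w * k w x)" for i x
  have gF: "(\<Sum>w\<in>F. d i w * k w x) = g i x" if "i < n" for i x
    using supp[OF that False] False F by (simp add: g_def)
  have onG: "qform k ?G (d i) (d j) = of_bool (i = j)" if "i < n" "j < n" for i j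
    using on[OF that] supp[OF that(1) False] supp[OF that(2) False] False F by (simp add: qform_def)
  show ?thesis
  proof (intro exI[of _ "\<lambda>y. \<Sum>i<n. g i z * d i y"] ballI)
    fix x assume x: "x \<in> F"
    have "k x z = (\<Sum>i<n. g i x * g i z)"
      unfolding g_def
      by (rule qform_representation[OF fin psd _ _ onG]) (use x rep in \<open>simp_all add: gF flip: g_def\<close>)
    moreover have "k z x = k x z" using psd x unfolding psd_on_def by blast
    moreover have "(\<Sum>y\<in>F. (\<Sum>i<n. g i z * d i y) * k y x) = (\<Sum>i<n. g i z * g i x)"
    proof -
      have "(\<Sum>y\<in>F. (\<Sum>i<n. g i z * d i y) * k y x) = (\<Sum>i<n. g i z * (\<Sum>y\<in>F. d i y * k y x))"
        unfolding sum_distrib_left sum_distrib_right by (subst sum.swap) (simp only: mult.assoc)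
      then show ?thesis by (simp add: gF)
    qed
    ultimately show "(\<Sum>y\<in>F. (\<Sum>i<n. g i z * d i y) * k y x) = k z x" by (simp add: mult.commute)
  qed
qed

section \<open>Potentials of compact sets and the trace bound\<close>

context bar_semigroup
begin

lemma ub_sym: "ub a x y = ub a y x"
  unfolding ub_def by (rule cv_sym)

lemma ub_diag_pos: "0 < ub \<beta> x x"
proof -
  obtain s where s: "0 < s" "0 < pbar m p s x x" using q_pos by blast
  then have qs: "0 < q s x x" by (simp add: q_def)
  have "(\<integral>\<^sup>+r. ennreal (exp (- \<beta> * s)) * q s x x * indicator {0<..<s} r \<partial>lborel) \<le> ubar m p \<beta> x x"
    unfolding ubar_eq
  proof (intro nn_integral_mono)
    fix r :: real
    show "ennreal (exp (- \<beta> * s)) * q s x x * indicator {0<..<s} r \<le> ennreal (exp (- \<beta> * r)) * q r x x"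
    proof (cases "0 < r \<and> r < s")
      case True
      then have "exp (- \<beta> * s) \<le> exp (- \<beta> * r)" using \<beta>_pos by simp
      then have "ennreal (exp (- \<beta> * s)) * q s x x \<le> ennreal (exp (- \<beta> * r)) * q r x x"
        using True by (intro mult_mono ennreal_leI q_diag_decreasing) auto
      then show ?thesis using True by simp
    qed auto
  qed
  moreover have "0 < (\<integral>\<^sup>+r. ennreal (exp (- \<beta> * s)) * q s x x * indicator {0<..<s} r \<partial>lborel)"
    using s(1) qs by (subst nn_integral_cmult) (auto simp: ennreal_zero_less_mult_iff)
  ultimately have "0 < ubar m p \<beta> x x" by (rule less_le_trans[rotated])
  then show ?thesis by (simp add: ubar_eq_ub[OF \<beta>_pos])
qed

text \<open>The domination principle for one point mass with a constant majorant, which is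
  supermedian because the total mass is at most 1; \<open>\<eta>\<close> supplies the strict
  inequality. Positive definiteness alone would only give the geometric mean of the two diagonal
  values.\<close>

lemma ub_le_diag: "ub \<beta> z x \<le> ub \<beta> x x"
proof (rule field_le_epsilon)
  fix \<eta> :: real assume \<eta>: "0 < \<eta>"
  define k where "k = ub \<beta> x x + \<eta>"
  have k: "0 < k" "ub \<beta> x x < k" using \<eta> ub_nonneg[of \<beta> x x] by (auto simp: k_def)
  have "(\<Sum>x\<in>{x}. 1 * ub \<beta> x z) \<le> (\<lambda>_. k) z"
  proof (rule domination_principle)
    fix b z assume b: "0 < (b::real)"
    have bb: "0 < \<beta> + b" using b \<beta>_pos by simp
    have "ennreal b * (\<integral>\<^sup>+y. ubar m p (\<beta> + b) z y * ennreal k \<partial>m) = ennreal b * ((\<integral>\<^sup>+y. ubar m p (\<beta> + b) z y \<partial>m) * ennreal k)"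
      by (simp add: nn_integral_multc)
    also have "\<dots> \<le> ennreal b * (ennreal (1 / (\<beta> + b)) * ennreal k)"
      by (intro mult_left_mono mult_right_mono ubar_total bb) auto
    also have "\<dots> = ennreal (b / (\<beta> + b) * k)" using b bb k by (simp add: ennreal_mult[symmetric])
    also have "\<dots> \<le> ennreal k"
    proof (rule ennreal_leI)
      have "b / (\<beta> + b) \<le> 1" using b \<beta>_pos by simp
      then show "b / (\<beta> + b) * k \<le> k" using k mult_right_mono[of "b / (\<beta> + b)" 1 k] by simp
    qed
    finally show "ennreal b * (\<integral>\<^sup>+y. ubar m p (\<beta> + b) z y * ennreal k \<partial>m) \<le> ennreal k" .
  qed (use k in auto)
  then show "ub \<beta> z x \<le> ub \<beta> x x + \<eta>" by (simp add: k_def ub_sym[of \<beta> z])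
qed

lemma ub_continuous_right: "isCont (\<lambda>y. ub \<beta> x y) y"
proof -
  have "continuous_on UNIV (\<lambda>y. ub \<beta> (fst (x, y)) (snd (x, y)))"
    by (rule continuous_on_compose2[OF ub_continuous]) (auto intro!: continuous_intros)
  then show ?thesis by (simp add: continuous_on_eq_continuous_at)
qed

lemma ub_continuous_diag: "continuous_on UNIV (\<lambda>x. ub \<beta> x x)"
proof -
  have "continuous_on UNIV (\<lambda>y. ub \<beta> (fst (y, y)) (snd (y, y)))"
    by (rule continuous_on_compose2[OF ub_continuous]) (auto intro!: continuous_intros)
  then show ?thesis by simp
qed

text \<open>The potential of the point mass at \<open>x\<close>, divided by half its value at
  \<open>x\<close>, exceeds 1 near \<open>x\<close>; finitely many of these cover \<open>A\<close>.
  Their sum is supermedian by the resolvent equation and integrable because each potential has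
  integral at most a multiple of \<open>1 / \<beta>\<close>.\<close>

lemma compact_supermedian_majorant:
  assumes A: "compact A"
  shows "\<exists>\<phi>. \<phi> \<in> borel_measurable borel \<and> (\<forall>y. 0 \<le> \<phi> y) \<and> (\<forall>x. isCont \<phi> x) \<and> (\<forall>x\<in>A. 1 \<le> \<phi> x) \<and>
     integrable m \<phi> \<and> (\<forall>b z. 0 < b \<longrightarrow> ennreal b * (\<integral>\<^sup>+y. ubar m p (\<beta> + b) z y * ennreal (\<phi> y) \<partial>m) \<le> ennreal (\<phi> z))"
proof -
  note [measurable (raw)] = ub_measurable[OF \<beta>_pos]
  define N where "N x = {y. ub \<beta> x x / 2 < ub \<beta> x y}" for x
  have N: "open (N x)" "x \<in> N x" for x
  proof -
    have "continuous_on UNIV (\<lambda>y. ub \<beta> x y)" by (simp add: continuous_on_eq_continuous_at ub_continuous_right)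
    then show "open (N x)" unfolding N_def by (intro open_Collect_less continuous_on_const)
    show "x \<in> N x" using ub_diag_pos[of x] by (simp add: N_def)
  qed
  have "A \<subseteq> (\<Union>x\<in>A. N x)" using N(2) by blast
  from compactE_image[OF A N(1) this]
  obtain D where D: "D \<subseteq> A" "finite D" "A \<subseteq> (\<Union>x\<in>D. N x)" by metis
  define k where "k x = 2 / ub \<beta> x x" for x
  have k: "0 < k x" for x using ub_diag_pos[of x] by (simp add: k_def)
  define \<phi> where "\<phi> y = (\<Sum>x\<in>D. k x * ub \<beta> x y)" for y
  have t0: "0 \<le> k x * ub \<beta> x y" for x y using k[of x] ub_nonneg by (simp add: less_imp_le)
  have e: "ennreal (\<phi> y) = (\<Sum>x\<in>D. ennreal (k x) * ubar m p \<beta> y x)" for y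
    unfolding \<phi>_def ubar_eq_ub[OF \<beta>_pos] using k t0
    by (subst sum_ennreal[symmetric]) (auto simp: ennreal_mult' less_imp_le ub_sym[of \<beta> y])
  have "ennreal b * (\<integral>\<^sup>+y. ubar m p (\<beta> + b) z y * ennreal (\<phi> y) \<partial>m) \<le> ennreal (\<phi> z)" if b: "0 < b" for b z
  proof -
    have "ennreal b * (\<integral>\<^sup>+y. ubar m p (\<beta> + b) z y * ennreal (\<phi> y) \<partial>m) =
      ennreal b * (\<integral>\<^sup>+y. (\<Sum>x\<in>D. ennreal (k x) * (ubar m p (\<beta> + b) z y * ubar m p \<beta> y x)) \<partial>m)"
      unfolding e by (simp only: sum_distrib_left mult.left_commute)
    also have "\<dots> = (\<Sum>x\<in>D. ennreal (k x) * (ennreal b * (\<integral>\<^sup>+y. ubar m p (\<beta> + b) z y * ubar m p \<beta> y x \<partial>m)))"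
      by (subst nn_integral_sum) (auto simp: nn_integral_cmult sum_distrib_left mult.left_commute)
    also have "\<dots> \<le> (\<Sum>x\<in>D. ennreal (k x) * ubar m p \<beta> z x)"
    proof (intro sum_mono mult_left_mono)
      fix x show "ennreal b * (\<integral>\<^sup>+y. ubar m p (\<beta> + b) z y * ubar m p \<beta> y x \<partial>m) \<le> ubar m p \<beta> z x"
        by (subst ubar_resolvent[OF \<beta>_pos b, of z x]) simp
    qed simp
    finally show ?thesis unfolding e .
  qed
  moreover have "1 \<le> \<phi> x" if x: "x \<in> A" for x
  proof -
    obtain y where y: "y \<in> D" "x \<in> N y" using D x by blast
    have "1 \<le> k y * ub \<beta> y x" using y(2) ub_diag_pos[of y] by (simp add: k_def N_def field_simps)
    also have "\<dots> \<le> \<phi> x" unfolding \<phi>_def using D(2) y(1) t0 by (intro member_le_sum) auto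
    finally show ?thesis .
  qed
  moreover have "integrable m \<phi>"
    unfolding \<phi>_def by (intro Bochner_Integration.integrable_sum integrable_mult_right ub_total(1) \<beta>_pos)
  moreover have "\<phi> \<in> borel_measurable borel" unfolding \<phi>_def by measurable
  moreover have "isCont \<phi> x" for x
    unfolding \<phi>_def by (intro continuous_sum continuous_mult continuous_const ub_continuous_right)
  moreover have "0 \<le> \<phi> y" for y unfolding \<phi>_def by (intro sum_nonneg t0)
  ultimately show ?thesis by blast
qed

lemma qform_ub_square:
  shows "integrable m (\<lambda>z. (\<Sum>x\<in>F. c x * ub \<beta> x z)\<^sup>2)"
    and "qform (cv (\<lambda>s. s * exp (- \<beta> * s))) F c c = (LINT z|m. (\<Sum>x\<in>F. c x * ub \<beta> x z)\<^sup>2)"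
proof -
  note [measurable (raw)] = ub_measurable[OF \<beta>_pos]
  have eq: "(\<integral>\<^sup>+z. ennreal (ub \<beta> x z * ub \<beta> y z) \<partial>m) = ennreal (cv (\<lambda>s. s * exp (- \<beta> * s)) x y)" for x y
    using ubar_square[OF \<beta>_pos, of x y]
    by (simp add: ubar_eq_ub[OF \<beta>_pos] ub_nonneg ennreal_mult' ub_sym[of \<beta> _ y])
  have i: "integrable m (\<lambda>z. (ub \<beta> x z)\<^sup>2)" for x
  proof (rule integrableI_nonneg)
    show "(\<integral>\<^sup>+z. ennreal ((ub \<beta> x z)\<^sup>2) \<partial>m) < \<infinity>" using eq[of x x] by (simp add: power2_eq_square)
  qed auto
  have "(LINT z|m. ub \<beta> x z * ub \<beta> y z) = cv (\<lambda>s. s * exp (- \<beta> * s)) x y" for x y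
  proof -
    have "0 \<le> cv (\<lambda>s. s * exp (- \<beta> * s)) x y" by (rule cv_nonneg) simp
    then show ?thesis using eq[of x y] by (subst integral_eq_nn_integral) (auto simp: ub_nonneg)
  qed
  from qform_square_integral[where f="ub \<beta>" and M=m, OF _ i this]
  show "integrable m (\<lambda>z. (\<Sum>x\<in>F. c x * ub \<beta> x z)\<^sup>2)"
    "qform (cv (\<lambda>s. s * exp (- \<beta> * s))) F c c = (LINT z|m. (\<Sum>x\<in>F. c x * ub \<beta> x z)\<^sup>2)" by simp_all
qed

text \<open>The trace density at \<open>z\<close> is the squared norm, relative to the form of
  \<open>v\<close>, of the functional sending a combination of the \<open>e i\<close> to its
  potential at \<open>z\<close>. This functional is the pairing with the projection of the point
  mass at \<open>z\<close>, whose energy is controlled by domination. The resulting integral depends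
  on \<open>A\<close> but not on \<open>F\<close>, \<open>n\<close> or \<open>e\<close>.\<close>

lemma trace_bound:
  assumes A: "compact A"
    and v: "exp_dominated v" "\<And>s. 0 < s \<Longrightarrow> 0 \<le> v s" and t: "0 < t"
    and k: "0 < k" "\<And>s. 0 < s \<Longrightarrow> s < t \<Longrightarrow> k \<le> v s"
    and r: "exp_dominated r" "0 \<le> R" "\<And>s. 0 < s \<Longrightarrow> r s \<le> R * (s * exp (- \<beta> * s))"
  shows "\<exists>T. \<forall>F (n::nat) e. finite F \<and> F \<subseteq> A \<and>
     (\<forall>i<n. \<forall>j<n. qform (cv v) F (e i) (e j) = of_bool (i = j)) \<longrightarrow> (\<Sum>i<n. qform (cv r) F (e i) (e i)) \<le> T"
proof -
  obtain \<phi> where \<phi>m: "\<phi> \<in> borel_measurable borel" and \<phi>0: "\<And>y. 0 \<le> \<phi> y" and \<phi>c: "\<And>x. isCont \<phi> x"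
    and \<phi>1: "\<And>x. x \<in> A \<Longrightarrow> 1 \<le> \<phi> x" and \<phi>i: "integrable m \<phi>"
    and \<phi>s: "\<And>b z. 0 < b \<Longrightarrow> ennreal b * (\<integral>\<^sup>+y. ubar m p (\<beta> + b) z y * ennreal (\<phi> y) \<partial>m) \<le> ennreal (\<phi> z)"
    using compact_supermedian_majorant[OF A] by blast
  obtain C where C0: "0 \<le> C" and C: "\<And>F c. qform (ub \<beta>) F c c \<le> C * qform (cv v) F c c"
    using qform_cv_compare[OF exp_dominated_exp[OF \<beta>_pos] v t k] unfolding ub_def by blast
  have "compact ((\<lambda>x. ub \<beta> x x) ` A)"
    using A by (intro compact_continuous_image continuous_on_subset[OF ub_continuous_diag]) auto
  then have "bounded ((\<lambda>x. ub \<beta> x x) ` A)" by (rule compact_imp_bounded)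
  then obtain M where M: "\<And>x. x \<in> A \<Longrightarrow> ub \<beta> x x \<le> M" "0 < M"
    unfolding bounded_pos by (auto simp: ub_nonneg)
  define M0 where "M0 = M + 1"
  have M0: "0 < M0" "\<And>x. x \<in> A \<Longrightarrow> ub \<beta> x x < M0" using M by (force simp: M0_def)+
  have psd: "psd_on (ub \<beta>) G" for G unfolding ub_def by (intro psd_cv exp_dominated_exp \<beta>_pos) simp
  have pointwise: "(\<Sum>i<n. (\<Sum>x\<in>F. e i x * ub \<beta> x z)\<^sup>2) \<le> C * M0 * \<phi> z"
    if F: "finite F" "F \<subseteq> A" and on: "\<And>i j. i < n \<Longrightarrow> j < n \<Longrightarrow> qform (cv v) F (e i) (e j) = of_bool (i = j)"
    for F and n :: nat and e z
  proof -
    define h where "h i = (\<Sum>x\<in>F. e i x * ub \<beta> x z)" for i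
    define K where "K = (\<Sum>i<n. (h i)\<^sup>2)"
    \<comment> \<open>The combination representing evaluation of the potential at \<open>z\<close>:
      its \<open>v\<close>-energy and its potential at \<open>z\<close> both equal \<open>K\<close>,
      which makes Cauchy-Schwarz an inequality for \<open>K\<close> alone.\<close>
    define c where "c = (\<lambda>x. \<Sum>i<n. h i * e i x)"
    obtain \<pi> where \<pi>: "\<And>x. x \<in> F \<Longrightarrow> (\<Sum>y\<in>F. \<pi> y * ub \<beta> y x) = ub \<beta> z x"
      using psd_projection[OF F(1) psd] by blast
    have vc: "qform (cv v) F c c = K"
    proof -
      have "qform (cv v) F c c = (\<Sum>i<n. h i * (\<Sum>j<n. h j * of_bool (i = j)))"
        unfolding c_def qform_sum_left qform_sum_right by (intro sum.cong refl) (simp add: on del: of_bool_eq_0_iff)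
      also have "\<dots> = K"
        unfolding K_def power2_eq_square using sum_of_bool_eq_mult[of "{..<n}" _ "\<lambda>j. h j"]
        by (intro sum.cong refl arg_cong2[where f="(*)"]) (simp add: mult.commute eq_commute)
      finally show ?thesis .
    qed
    have "K = (\<Sum>x\<in>F. c x * ub \<beta> x z)"
    proof -
      have "(\<Sum>x\<in>F. c x * ub \<beta> x z) = (\<Sum>i<n. h i * (\<Sum>x\<in>F. e i x * ub \<beta> x z))"
        unfolding c_def sum_distrib_left sum_distrib_right by (subst sum.swap) (simp only: mult.assoc)
      then show ?thesis by (simp add: K_def h_def power2_eq_square)
    qed
    also have "\<dots> = qform (ub \<beta>) F \<pi> c"
      unfolding qform_alt by (intro sum.cong refl) (simp only: \<pi> ub_sym[of \<beta> _ z])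
    finally have K1: "K = qform (ub \<beta>) F \<pi> c" .
    have \<pi>\<pi>: "qform (ub \<beta>) F \<pi> \<pi> = (\<Sum>x\<in>F. \<pi> x * ub \<beta> x z)"
      unfolding qform_alt by (intro sum.cong refl) (simp only: \<pi> ub_sym[of \<beta> _ z])
    \<comment> \<open>The weights \<open>\<pi>\<close> may be negative, but on \<open>F\<close>
      their potential is that of the point mass at \<open>z\<close>, at most \<open>M\<close>. The
      extra 1 in \<open>M0\<close> gives the strict inequality required by
      \<open>domination_principle\<close>.\<close>
    have dom: "(\<Sum>x\<in>F. \<pi> x * ub \<beta> x z) \<le> M0 * \<phi> z"
    proof (rule domination_principle[OF F(1)])
      show "(\<lambda>y. M0 * \<phi> y) \<in> borel_measurable borel" using \<phi>m by simp
      show "0 \<le> M0 * \<phi> y" for y using M0 \<phi>0 by simp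
      show "isCont (\<lambda>y. M0 * \<phi> y) x" for x by (intro continuous_mult continuous_const \<phi>c)
      show "ennreal b * (\<integral>\<^sup>+y. ubar m p (\<beta> + b) z y * ennreal (M0 * \<phi> y) \<partial>m) \<le> ennreal (M0 * \<phi> z)" if "0 < b" for b z
      proof -
        have [measurable]: "\<phi> \<in> borel_measurable borel" by (rule \<phi>m)
        have "ennreal b * (\<integral>\<^sup>+y. ubar m p (\<beta> + b) z y * ennreal (M0 * \<phi> y) \<partial>m) =
          ennreal M0 * (ennreal b * (\<integral>\<^sup>+y. ubar m p (\<beta> + b) z y * ennreal (\<phi> y) \<partial>m))"
          using M0 by (simp add: ennreal_mult' mult.left_commute nn_integral_cmult)
        also have "\<dots> \<le> ennreal M0 * ennreal (\<phi> z)" by (intro mult_left_mono \<phi>s that) simp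
        finally show ?thesis using M0 by (simp add: ennreal_mult')
      qed
      fix y assume y: "y \<in> F"
      have "ub \<beta> z y \<le> ub \<beta> y y" by (rule ub_le_diag)
      also have "\<dots> < M0" using y F M0 by auto
      also have "\<dots> \<le> M0 * \<phi> y" using \<phi>1[of y] y F M0 by auto
      finally show "(\<Sum>x\<in>F. \<pi> x * ub \<beta> x y) < M0 * \<phi> y" unfolding \<pi>[OF y] .
    qed
    have "K\<^sup>2 \<le> qform (ub \<beta>) F \<pi> \<pi> * qform (ub \<beta>) F c c"
      unfolding K1 by (rule qform_Cauchy_Schwarz[OF psd])
    also have "\<dots> \<le> (M0 * \<phi> z) * (C * K)"
      using dom C[of F c] psd[of F] M0 \<phi>0[of z] unfolding \<pi>\<pi> vc by (intro mult_mono) (auto simp: psd_on_def)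
    finally have "K * K \<le> (C * M0 * \<phi> z) * K" by (simp add: power2_eq_square mult_ac)
    moreover have "0 \<le> K" unfolding K_def by (intro sum_nonneg) simp
    moreover have "0 \<le> C * M0 * \<phi> z" using C0 M0 \<phi>0 by simp
    ultimately have "K \<le> C * M0 * \<phi> z" by (cases "K = 0") auto
    then show ?thesis by (simp add: K_def h_def)
  qed
  show ?thesis
  proof (intro exI[of _ "R * (LINT z|m. C * M0 * \<phi> z)"] allI impI, elim conjE)
    fix F and n :: nat and e
    assume F: "finite F" "F \<subseteq> A" and "\<forall>i<n. \<forall>j<n. qform (cv v) F (e i) (e j) = of_bool (i = j)"
    then have on: "\<And>i j. i < n \<Longrightarrow> j < n \<Longrightarrow> qform (cv v) F (e i) (e j) = of_bool (i = j)" by blast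
    have le: "qform (cv r) F c c \<le> R * (LINT z|m. (\<Sum>x\<in>F. c x * ub \<beta> x z)\<^sup>2)" for c
    proof -
      have "qform (cv r) F c c \<le> (LINT s|lborel. R * ((s * exp (- \<beta> * s)) * qform (pb s) F c c))"
        unfolding qform_cv(2)[OF r(1)]
      proof (rule integral_mono)
        show "integrable lborel (\<lambda>s. r s * qform (pb s) F c c)" by (rule qform_cv(1)[OF r(1)])
        show "integrable lborel (\<lambda>s. R * ((s * exp (- \<beta> * s)) * qform (pb s) F c c))"
          by (intro integrable_mult_right qform_cv(1) exp_dominated_times_exp \<beta>_pos)
        fix s
        show "r s * qform (pb s) F c c \<le> R * ((s * exp (- \<beta> * s)) * qform (pb s) F c c)"
        proof (cases "0 < s")
          case True
          from mult_right_mono[OF r(3)[OF True] qform_pb_nonneg[of s F c]] show ?thesis by (simp add: mult.assoc)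
        qed (simp add: qform_pb_nonpos_time)
      qed
      also have "\<dots> = R * qform (cv (\<lambda>s. s * exp (- \<beta> * s))) F c c"
        unfolding qform_cv(2)[OF exp_dominated_times_exp[OF \<beta>_pos]] by (rule integral_mult_right_zero)
      finally show ?thesis by (simp only: qform_ub_square(2))
    qed
    have "(\<Sum>i<n. qform (cv r) F (e i) (e i)) \<le> (\<Sum>i<n. R * (LINT z|m. (\<Sum>x\<in>F. e i x * ub \<beta> x z)\<^sup>2))"
      by (intro sum_mono le)
    also have "\<dots> = R * (LINT z|m. (\<Sum>i<n. (\<Sum>x\<in>F. e i x * ub \<beta> x z)\<^sup>2))"
      by (subst Bochner_Integration.integral_sum) (simp_all add: qform_ub_square(1) sum_distrib_left)
    also have "\<dots> \<le> R * (LINT z|m. C * M0 * \<phi> z)"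
      by (intro mult_left_mono integral_mono pointwise F on Bochner_Integration.integrable_sum qform_ub_square(1)
          integrable_mult_right \<phi>i r(2))
    finally show "(\<Sum>i<n. qform (cv r) F (e i) (e i)) \<le> R * (LINT z|m. C * M0 * \<phi> z)" .
  qed
qed

end

section \<open>Fields driven by the noise\<close>

text \<open>Reversing time on \<open>(0,t)\<close> only, the noise on \<open>(0,t)\<close> drives \<open>U\<close> and \<open>V\<close>, and the noise on \<open>(t,\<infinity>)\<close> is left
  for \<open>S\<close>; the map preserves Lebesgue measure.\<close>

definition fold_time :: "real \<Rightarrow> real \<Rightarrow> real" where
  "fold_time t s = (if s < t then t - s else s)"

lemma fold_time_measurable [measurable]: "fold_time t \<in> borel_measurable borel"
  unfolding fold_time_def[abs_def] by measurable

lemma nn_integral_fold_time: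
  assumes [measurable]: "g \<in> borel_measurable borel" and t: "0 \<le> t"
  shows "(\<integral>\<^sup>+s. g (fold_time t s) * indicator {0..} s \<partial>lborel) = (\<integral>\<^sup>+s. g s * indicator {0<..} s \<partial>lborel)"
proof -
  have "(\<integral>\<^sup>+s. g (fold_time t s) * indicator {0..} s \<partial>lborel) =
     (\<integral>\<^sup>+s. g (t - s) * indicator {0<..<t} s + g s * indicator {t<..} s \<partial>lborel)"
  proof (rule nn_integral_cong_AE)
    show "AE s in lborel. g (fold_time t s) * indicator {0..} s = g (t - s) * indicator {0<..<t} s + g s * indicator {t<..} s"
      using AE_lborel_singleton[of 0] AE_lborel_singleton[of t]
      by eventually_elim (use t in \<open>auto simp: fold_time_def indicator_def\<close>)
  qed
  also have "\<dots> = (\<integral>\<^sup>+s. g (t - s) * indicator {0<..<t} s \<partial>lborel) + (\<integral>\<^sup>+s. g s * indicator {t<..} s \<partial>lborel)"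
    by (rule nn_integral_add) measurable
  also have "(\<integral>\<^sup>+s. g (t - s) * indicator {0<..<t} s \<partial>lborel) = (\<integral>\<^sup>+s. g s * indicator {0<..<t} s \<partial>lborel)"
    by (subst nn_integral_real_affine[where c="-1" and t=t]) (auto simp: indicator_def intro!: nn_integral_cong)
  also have "\<dots> + (\<integral>\<^sup>+s. g s * indicator {t<..} s \<partial>lborel) = (\<integral>\<^sup>+s. g s * indicator {0<..<t} s + g s * indicator {t<..} s \<partial>lborel)"
    by (rule nn_integral_add[symmetric]) measurable
  also have "\<dots> = (\<integral>\<^sup>+s. g s * indicator {0<..} s \<partial>lborel)"
  proof (rule nn_integral_cong_AE)
    show "AE s in lborel. g s * indicator {0<..<t} s + g s * indicator {t<..} s = g s * indicator {0<..} s"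
      using AE_lborel_singleton[of t]
      by eventually_elim (use t in \<open>auto simp: indicator_def\<close>)
  qed
  finally show ?thesis .
qed

section \<open>Wiener integrals with time weights\<close>

context bar_semigroup
begin

text \<open>Noise before time \<open>t\<close> is used with age t - s, as in the mild solution, and
  later noise with age s. The folding preserves Lebesgue measure on the half-line, so the covariance
  of two such integrals is \<open>cv\<close> of the product of their weights.\<close>

definition nk :: "real \<Rightarrow> (real \<Rightarrow> real) \<Rightarrow> 'a \<Rightarrow> real \<times> 'a \<Rightarrow> real" where
  "nk t w x z = w (fold_time t (fst z)) * p0 (fold_time t (fst z)) x (snd z)"

lemma space_time_fst [measurable]: "fst \<in> borel_measurable (space_time m)"
proof -
  have "fst \<in> measurable (space_time m) (restrict_space lborel {0..})" unfolding space_time_def by (rule measurable_fst)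
  moreover have "(\<lambda>x. x) \<in> measurable (restrict_space lborel {0..}) (borel :: real measure)"
    by (intro measurable_restrict_space1) simp
  ultimately show ?thesis by (rule measurable_compose)
qed

lemma space_time_snd [measurable]: "snd \<in> measurable (space_time m) borel"
  unfolding space_time_def using measurable_snd[of "restrict_space lborel {0..}" m] by (simp cong: measurable_cong_sets)

lemma nk_measurable [measurable]:
  assumes [measurable]: "w \<in> borel_measurable borel"
  shows "nk t w x \<in> borel_measurable (space_time m)"
  unfolding nk_def[abs_def] by measurable

lemma nk_integral_nn:
  assumes t: "0 \<le> t" and w: "w \<in> borel_measurable borel" "\<And>s. 0 \<le> w s" and w': "w' \<in> borel_measurable borel" "\<And>s. 0 \<le> w' s"
    and dom: "exp_dominated (\<lambda>s. w s * w' s)"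
  shows "(\<integral>\<^sup>+z. ennreal (nk t w x z * nk t w' y z) \<partial>space_time m) = ennreal (cv (\<lambda>s. w s * w' s) x y)"
proof -
  note [measurable] = w(1) w'(1)
  let ?g = "\<lambda>u. ennreal (w u * w' u) * q u x y"
  have "(\<integral>\<^sup>+z. ennreal (nk t w x z * nk t w' y z) \<partial>space_time m) =
    (\<integral>\<^sup>+s. (\<integral>\<^sup>+z. ennreal (nk t w x (s, z) * nk t w' y (s, z)) \<partial>m) \<partial>restrict_space lborel {0..})"
  proof -
    have "(\<lambda>z. ennreal (nk t w x z * nk t w' y z)) \<in> borel_measurable (space_time m)" by measurable
    then show ?thesis unfolding space_time_def by (rule m.nn_integral_fst[symmetric])
  qed
  also have "\<dots> = (\<integral>\<^sup>+s. ?g (fold_time t s) \<partial>restrict_space lborel {0..})"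
  proof (rule nn_integral_cong)
    fix s
    let ?u = "fold_time t s"
    have "(\<integral>\<^sup>+z. ennreal (nk t w x (s, z) * nk t w' y (s, z)) \<partial>m) =
      (\<integral>\<^sup>+z. ennreal (w ?u * w' ?u) * (ennreal (p0 ?u x z) * ennreal (p0 ?u y z)) \<partial>m)"
      by (intro nn_integral_cong) (simp add: nk_def ennreal_mult'[symmetric] p0_nonneg w w' mult_ac)
    also have "\<dots> = ?g ?u" unfolding q_eq_p0 by (rule nn_integral_cmult) measurable
    finally show "(\<integral>\<^sup>+z. ennreal (nk t w x (s, z) * nk t w' y (s, z)) \<partial>m) = ?g ?u" .
  qed
  also have "\<dots> = (\<integral>\<^sup>+s. ?g (fold_time t s) * indicator {0..} s \<partial>lborel)"
    by (rule nn_integral_restrict_space) simp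
  also have "\<dots> = (\<integral>\<^sup>+s. ?g s * indicator {0<..} s \<partial>lborel)"
    by (rule nn_integral_fold_time[OF _ t]) measurable
  also have "\<dots> = (\<integral>\<^sup>+s. ennreal (w s * w' s * pb s x y) \<partial>lborel)"
    by (intro nn_integral_cong) (auto simp: indicator_def q_eq_pb ennreal_mult' pb_nonneg pb_nonpos_time w w')
  also have "\<dots> = ennreal (cv (\<lambda>s. w s * w' s) x y)"
    unfolding cv_def by (rule nn_integral_eq_integral[OF cv_integrable[OF dom]]) (simp add: pb_nonneg w w')
  finally show ?thesis .
qed

lemma nk_nonneg: "(\<And>s. 0 \<le> w s) \<Longrightarrow> 0 \<le> nk t w x z"
  by (simp add: nk_def p0_nonneg)

lemma nk_L2:
  assumes "0 \<le> t" "w \<in> borel_measurable borel" "\<And>s. 0 \<le> w s" "exp_dominated (\<lambda>s. w s * w s)"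
  shows "nk t w x \<in> L2 (space_time m)"
proof -
  note [measurable] = assms(2)
  have "integrable (space_time m) (\<lambda>z. (nk t w x z)\<^sup>2)"
  proof (rule integrableI_nonneg)
    show "(\<integral>\<^sup>+z. ennreal ((nk t w x z)\<^sup>2) \<partial>space_time m) < \<infinity>"
      using nk_integral_nn[OF assms(1) assms(2,3) assms(2,3) assms(4), of x x] by (simp add: power2_eq_square)
  qed simp_all
  then show ?thesis by (simp add: L2_def)
qed

lemma nk_integral:
  assumes "0 \<le> t" "w \<in> borel_measurable borel" "\<And>s. 0 \<le> w s" "w' \<in> borel_measurable borel" "\<And>s. 0 \<le> w' s"
    "exp_dominated (\<lambda>s. w s * w' s)"
  shows "(LINT z|space_time m. nk t w x z * nk t w' y z) = cv (\<lambda>s. w s * w' s) x y"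
proof -
  note [measurable] = assms(2,4)
  have "0 \<le> cv (\<lambda>s. w s * w' s) x y" using assms by (intro cv_nonneg) simp
  then show ?thesis
    using nk_integral_nn[OF assms, of x y] assms by (subst integral_eq_nn_integral) (auto simp: nk_nonneg)
qed

text \<open>The weight may depend on the index, so fields with different weights driven by one noise
  can be treated as a single Gaussian field; this is how \<open>S\<close> and \<open>V\<close> are
  handled jointly.\<close>

lemma noise_field:
  assumes W: "white_noise M (space_time m) W" and t: "0 \<le> t"
    and w: "\<And>i. w i \<in> borel_measurable borel" "\<And>i s. 0 \<le> w i s" "\<And>i j. exp_dominated (\<lambda>s. w i s * w j s)"
  shows "centered_gaussian_process M UNIV (\<lambda>i. W (nk t (w i) (x i)))"
    and "(LINT \<omega>|M. W (nk t (w i) (x i)) \<omega> * W (nk t (w j) (x j)) \<omega>) = cv (\<lambda>s. w i s * w j s) (x i) (x j)"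
    and "gaussian_char M UNIV (\<lambda>i. W (nk t (w i) (x i))) (\<lambda>i j. cv (\<lambda>s. w i s * w j s) (x i) (x j))"
proof -
  have L2: "nk t (w i) (x i) \<in> L2 (space_time m)" for i using t w by (intro nk_L2)
  have "centered_gaussian_process M (L2 (space_time m)) W" using W by (simp add: white_noise_def)
  then show G: "centered_gaussian_process M UNIV (\<lambda>i. W (nk t (w i) (x i)))"
    by (rule centered_gaussian_process_reindex) (rule L2)
  show cov: "(LINT \<omega>|M. W (nk t (w i) (x i)) \<omega> * W (nk t (w j) (x j)) \<omega>) = cv (\<lambda>s. w i s * w j s) (x i) (x j)" for i j
    unfolding white_noise_covariance[OF W L2 L2] by (rule nk_integral[OF t w(1,2) w(1,2) w(3)])
  show "gaussian_char M UNIV (\<lambda>i. W (nk t (w i) (x i))) (\<lambda>i j. cv (\<lambda>s. w i s * w j s) (x i) (x j))"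
    by (rule centered_gaussian_process_char[OF G cov])
qed

lemma increment_ub_tendsto: "((\<lambda>y. ub \<beta> x x + ub \<beta> y y - 2 * ub \<beta> x y) \<longlongrightarrow> 0) (at x)"
proof -
  have "((\<lambda>y. ub \<beta> y y) \<longlongrightarrow> ub \<beta> x x) (at x)"
    using ub_continuous_diag by (simp add: continuous_on_def)
  moreover have "((\<lambda>y. ub \<beta> x y) \<longlongrightarrow> ub \<beta> x x) (at x)"
    using ub_continuous_right[of x x] by (simp add: isCont_def)
  ultimately have "((\<lambda>y. ub \<beta> x x + ub \<beta> y y - 2 * ub \<beta> x y) \<longlongrightarrow> ub \<beta> x x + ub \<beta> x x - 2 * ub \<beta> x x) (at x)"
    by (intro tendsto_intros)
  then show ?thesis by simp
qed

lemma field_increment: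
  assumes G: "centered_gaussian_process M UNIV G" and cov: "\<And>x y. (LINT \<omega>|M. G x \<omega> * G y \<omega>) = cv w x y"
  shows "(LINT \<omega>|M. (G x \<omega> - G y \<omega>)\<^sup>2) = cv w x x + cv w y y - 2 * cv w x y"
proof -
  note sq = centered_gaussian_process_square_integrable[OF G UNIV_I]
  have i: "integrable M (\<lambda>\<omega>. G x \<omega> * G y \<omega>)" for x y by (intro integrable_mult_of_squares sq)
  have "(G x \<omega> - G y \<omega>)\<^sup>2 = G x \<omega> * G x \<omega> + G y \<omega> * G y \<omega> - 2 * (G x \<omega> * G y \<omega>)" for \<omega>
    by (simp add: power2_eq_square algebra_simps)
  then show ?thesis using i by (simp add: cov)
qed

text \<open>Increments are bounded by those for \<open>ub \<beta>\<close>, which vanish in the limit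
  by the assumed continuity; so every admissible weight gives a continuous field.\<close>

lemma field_L2_continuous:
  assumes G: "centered_gaussian_process M UNIV G" and cov: "\<And>x y. (LINT \<omega>|M. G x \<omega> * G y \<omega>) = cv w x y"
    and w: "exp_dominated w"
  shows "L2_continuous M G"
  unfolding L2_continuous_def
proof
  fix x
  obtain C where C: "\<And>F c. qform (cv w) F c c \<le> C * qform (ub \<beta>) F c c"
    using qform_cv_compare[OF w exp_dominated_exp[OF \<beta>_pos], of 1 "exp (- \<beta>)"] \<beta>_pos unfolding ub_def by auto
  have le: "(LINT \<omega>|M. (G y \<omega> - G x \<omega>)\<^sup>2) \<le> C * (ub \<beta> x x + ub \<beta> y y - 2 * ub \<beta> x y)" for y
  proof -
    have "(LINT \<omega>|M. (G y \<omega> - G x \<omega>)\<^sup>2) = (LINT \<omega>|M. (G x \<omega> - G y \<omega>)\<^sup>2)"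
      by (simp add: power2_commute)
    then show ?thesis
      unfolding field_increment[OF G cov] unfolding cv_increment ub_def by (simp only: C[unfolded ub_def])
  qed
  have "((\<lambda>y. C * (ub \<beta> x x + ub \<beta> y y - 2 * ub \<beta> x y)) \<longlongrightarrow> C * 0) (at x)"
    by (intro tendsto_mult tendsto_const increment_ub_tendsto)
  then have lim: "((\<lambda>y. C * (ub \<beta> x x + ub \<beta> y y - 2 * ub \<beta> x y)) \<longlongrightarrow> 0) (at x)"
    by (simp only: mult_zero_right)
  have "((\<lambda>y. LINT \<omega>|M. (G y \<omega> - G x \<omega>)\<^sup>2) \<longlongrightarrow> 0) (at x)"
    by (rule tendsto_sandwich[OF _ _ tendsto_const lim]; intro always_eventually allI le) simp
  then have "((\<lambda>y. sqrt (LINT \<omega>|M. (G y \<omega> - G x \<omega>)\<^sup>2)) \<longlongrightarrow> sqrt 0) (at x)" by (rule tendsto_real_sqrt)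
  then show "((\<lambda>y. L2_norm M (\<lambda>\<omega>. G y \<omega> - G x \<omega>)) \<longlongrightarrow> 0) (at x)" by (simp add: L2_norm_def)
qed

lemma field_smoother:
  assumes G: "centered_gaussian_process M UNIV G" "\<And>x y. (LINT \<omega>|M. G x \<omega> * G y \<omega>) = cv w x y" "exp_dominated w"
    and H: "centered_gaussian_process M UNIV H" "\<And>x y. (LINT \<omega>|M. H x \<omega> * H y \<omega>) = cv v x y" "exp_dominated v"
    and v: "\<And>s. 0 < s \<Longrightarrow> 0 \<le> v s" "0 < t" "0 < k" "\<And>s. 0 < s \<Longrightarrow> s < t \<Longrightarrow> k \<le> v s"
  shows "smoother_than M G H"
proof -
  obtain C where C: "\<And>F c. qform (cv w) F c c \<le> C * qform (cv v) F c c"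
    using qform_cv_compare[OF G(3) H(3) v] by blast
  have "(LINT \<omega>|M. \<bar>G x \<omega> - G y \<omega>\<bar>\<^sup>2) \<le> C * (LINT \<omega>|M. \<bar>H x \<omega> - H y \<omega>\<bar>\<^sup>2)" for x y
    unfolding power2_abs field_increment[OF G(1,2)] field_increment[OF H(1,2)] cv_increment by (rule C)
  then show ?thesis
    unfolding smoother_than_def using field_L2_continuous[OF G] field_L2_continuous[OF H] G(1) H(1) by blast
qed

lemma cv_cong_AE:
  assumes [measurable]: "w \<in> borel_measurable borel" "v \<in> borel_measurable borel"
    and "\<And>s. 0 < s \<Longrightarrow> s \<noteq> t \<Longrightarrow> w s = v s"
  shows "cv w x y = cv v x y"
  unfolding cv_def
proof (rule integral_cong_AE)
  show "AE s in lborel. w s * pb s x y = v s * pb s x y"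
    using AE_lborel_singleton[of t]
  proof eventually_elim
    case (elim s)
    then show ?case using assms(3)[of s] by (cases "0 < s") (auto simp: pb_nonpos_time)
  qed
qed measurable

lemma cv_add:
  assumes "exp_dominated w" "exp_dominated v"
  shows "cv (\<lambda>s. w s + v s) x y = cv w x y + cv v x y"
  unfolding cv_def using cv_integrable[OF assms(1)] cv_integrable[OF assms(2)] by (simp add: distrib_right)

lemma laws_mutually_abs_cont_compact:
  assumes A: "compact A" and t: "0 < t"
    and v: "exp_dominated v" "\<And>s. 0 < s \<Longrightarrow> 0 \<le> v s" "0 < k" "\<And>s. 0 < s \<Longrightarrow> s < t \<Longrightarrow> k \<le> v s"
    and r: "exp_dominated r" "0 \<le> R0" "\<And>s. 0 < s \<Longrightarrow> r s \<le> R0 * (s * exp (- \<beta> * s))"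
    and V: "gaussian_char M UNIV V (cv v)" and U: "gaussian_char M UNIV U (\<lambda>x y. cv v x y + cv r x y)"
    and R: "centered_gaussian_process M UNIV R" "\<And>x y. (LINT \<omega>|M. R x \<omega> * R y \<omega>) = cv r x y"
  shows "laws_mutually_abs_cont M V M U A"
proof (rule laws_mutually_abs_cont_of_cylinder_bounds)
  show "prob_space M" using V by (rule gaussian_charD)
  then show "prob_space M" .
  show "V x \<in> borel_measurable M" "U x \<in> borel_measurable M" for x
    using gaussian_charD(2)[OF V] gaussian_charD(2)[OF U] by auto
  obtain C0 where C0: "\<And>F c. qform (cv r) F c c \<le> C0 * qform (cv v) F c c"
    using qform_cv_compare[OF r(1) v(1,2) t v(3,4)] by blast
  obtain T where T: "\<And>F (n::nat) e. finite F \<Longrightarrow> F \<subseteq> A \<Longrightarrow>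
     (\<And>i j. i < n \<Longrightarrow> j < n \<Longrightarrow> qform (cv v) F (e i) (e j) = of_bool (i = j)) \<Longrightarrow> (\<Sum>i<n. qform (cv r) F (e i) (e i)) \<le> T"
  proof -
    obtain T where "\<forall>F (n::nat) e. finite F \<and> F \<subseteq> A \<and>
     (\<forall>i<n. \<forall>j<n. qform (cv v) F (e i) (e j) = of_bool (i = j)) \<longrightarrow> (\<Sum>i<n. qform (cv r) F (e i) (e i)) \<le> T"
      by (rule exE[OF trace_bound[OF A v(1) _ t v(3) _ r(1,2)]]) (use v(2,4) r(3) in auto)
    note * = this[rule_format]
    show ?thesis by (rule that[of T], rule *) simp
  qed
  fix \<epsilon> :: real assume \<epsilon>: "0 < \<epsilon>"
  \<comment> \<open>\<open>K\<close> makes the Markov term at most \<open>\<epsilon> / 2\<close>,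
    and then \<open>l\<close> makes \<open>exp K / l\<close> equal to \<open>\<epsilon> / 2\<close>.
    Both depend on \<open>A\<close> through \<open>T\<close> only, not on \<open>F\<close>.\<close>
  define K where "K = 2 * (\<bar>T\<bar> + 1) / \<epsilon>"
  define l where "l = 2 * exp K / \<epsilon>"
  have K: "0 < K" and l: "0 < l" using \<epsilon> by (auto simp: K_def l_def)
  have "T \<le> \<epsilon> / 2 * K" using \<epsilon> by (simp add: K_def)
  then have TK: "T / K \<le> \<epsilon> / 2" using K by (simp add: field_simps)
  have lK: "exp K / l = \<epsilon> / 2" using \<epsilon> by (simp add: l_def)
  show "\<exists>l\<ge>0. \<forall>F D. finite F \<and> F \<subseteq> A \<and> D \<in> sets (PiM F (\<lambda>_. borel)) \<longrightarrow>
       measure M (cylinder M F V D) \<le> \<epsilon> + l * measure M (cylinder M F U D) \<and>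
       measure M (cylinder M F U D) \<le> \<epsilon> + l * measure M (cylinder M F V D)"
  proof (intro exI[of _ l] conjI allI impI less_imp_le[OF l])
    fix F D assume *: "finite F \<and> F \<subseteq> A \<and> D \<in> sets (PiM F (\<lambda>_. borel :: real measure))"
    then have F: "finite F" "F \<subseteq> A" and D: "D \<in> sets (PiM F (\<lambda>_. borel))" by auto
    note RF = centered_gaussian_process_reindex[OF R(1), of F "\<lambda>x. x", OF UNIV_I]
    have psd: "psd_on (cv v) F" by (rule psd_cv[OF v(1)]) (rule v(2))
    note cmp = gaussian_finite_comparison[OF F(1) psd C0 gaussian_char_subset[OF V subset_UNIV]
        gaussian_char_subset[OF U subset_UNIV] RF R(2) _ K l D]
    have "measure M (cylinder M F V D) \<le>
        T / K + exp K / l + l * measure M (cylinder M F U D)"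
      by (rule cmp(2)) (rule T[OF F], simp)
    then show "measure M (cylinder M F V D) \<le> \<epsilon> + l * measure M (cylinder M F U D)"
      using TK lK by linarith
    have "measure M (cylinder M F U D) \<le>
        T / K + exp K / l + l * measure M (cylinder M F V D)"
      by (rule cmp(1)) (rule T[OF F], simp)
    then show "measure M (cylinder M F U D) \<le> \<epsilon> + l * measure M (cylinder M F V D)"
      using TK lK by linarith
  qed
qed

end

section \<open>The damped field and its independent complement\<close>

context bar_semigroup
begin

lemma mild_kernel_eq_nk:
  "(\<lambda>(s, y). indicator {0<..<t} s * p (t - s) x y) = nk t (indicator {0<..<t}) x"
  by (auto simp: fun_eq_iff nk_def fold_time_def p0_def indicator_def)

lemma exp_dominated_indicator: "exp_dominated (\<lambda>s. indicator {0<..<t} s * indicator {0<..<t} s)"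
  by (rule exp_dominated_finite_horizon[where K=1 and t=t]) (auto simp: indicator_def)

lemma mild_solutionD:
  assumes "mild_solution M m p W U" "0 \<le> s"
  shows "U s x \<in> borel_measurable M" "AE \<omega> in M. U s x \<omega> = W (nk s (indicator {0<..<s}) x) \<omega>"
  using assms unfolding mild_solution_def mild_kernel_eq_nk by auto

lemma mild_solution_exists:
  assumes W: "white_noise M (space_time m) W"
  shows "mild_solution M m p W (\<lambda>s x. W (nk s (indicator {0<..<s}) x))"
  unfolding mild_solution_def mild_kernel_eq_nk
proof (intro allI impI conjI)
  fix s :: real and x assume s: "0 \<le> s"
  show L2: "nk s (indicator {0<..<s}) x \<in> L2 (space_time m)"
    by (rule nk_L2[OF s _ _ exp_dominated_indicator]) auto
  have "centered_gaussian_process M (L2 (space_time m)) W" using W by (simp add: white_noise_def)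
  then show "W (nk s (indicator {0<..<s}) x) \<in> borel_measurable M"
    by (rule centered_gaussian_process_square_integrable(1)) (rule L2)
qed simp

lemma mild_solution_unique:
  assumes "mild_solution M m p W U" "mild_solution M m p W U'" "0 \<le> s"
  shows "AE \<omega> in M. U s x \<omega> = U' s x \<omega>"
  using mild_solutionD(2)[OF assms(1,3), of x] mild_solutionD(2)[OF assms(2,3), of x]
  by eventually_elim simp

lemma damped_field_decomposition:
  fixes W :: "(real \<times> 'a \<Rightarrow> real) \<Rightarrow> 'w \<Rightarrow> real" and M :: "'w measure"
  assumes W: "white_noise M (space_time m) W" and \<alpha>: "0 < \<alpha>" and t: "0 < t" and U: "mild_solution M m p W U"
  shows "\<exists>V :: real \<Rightarrow> 'a \<Rightarrow> 'w \<Rightarrow> real.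
     (\<forall>s\<ge>0. \<forall>x. V s x \<in> borel_measurable M) \<and>
     (\<forall>A. compact A \<longrightarrow> laws_mutually_abs_cont M (V t) M (U t) A) \<and>
     (\<exists>S :: real \<Rightarrow> 'a \<Rightarrow> 'w \<Rightarrow> real.
        indep_fields M (S t) (V t) \<and> smoother_than M (S t) (V t) \<and>
        (\<forall>(N :: 'n measure) \<eta>. centered_gaussian_with_cov N \<eta> (\<lambda>x y. enn2real (ubar m p \<alpha> x y)) \<longrightarrow>
           field_law M (\<lambda>x \<omega>. S t x \<omega> + V t x \<omega>) = field_law N \<eta>))"
proof -
  interpret M: prob_space M using W by (simp add: white_noise_def centered_gaussian_process_def)
  \<comment> \<open>Covariances see products of weights, so these are square roots. The squares of
    \<open>aV t\<close> and \<open>aR\<close> add up to the weight 1 of \<open>U\<close> on (0,t);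
    those of \<open>aV t\<close> and \<open>aS t\<close> add up to
    \<open>exp (- \<alpha> * u)\<close> at all positive times except \<open>t\<close>.\<close>
  define aV where "aV s u = indicator {0<..<s} u * exp (- \<alpha> * u / 2)" for s u :: real
  define aS where "aS s u = indicator {s<..} u * exp (- \<alpha> * u / 2)" for s u :: real
  define aR where "aR u = indicator {0<..<t} u * sqrt (1 - exp (- \<alpha> * u))" for u :: real
  have [measurable]: "aV s \<in> borel_measurable borel" "aS s \<in> borel_measurable borel" "aR \<in> borel_measurable borel" for s
    unfolding aV_def aS_def aR_def by measurable
  have aV0: "0 \<le> aV s u" and aS0: "0 \<le> aS s u" for s u by (auto simp: aV_def aS_def)
  have aR0: "0 \<le> aR u" for u
    using \<alpha> by (auto simp: aR_def indicator_def)
  have half: "exp (- (\<alpha> * u / 2)) * exp (- (\<alpha> * u / 2)) = exp (- (\<alpha> * u))" for u by (simp add: exp_add[symmetric])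
  have aR2: "aR u * aR u = indicator {0<..<t} u * (1 - exp (- \<alpha> * u))" for u
    using \<alpha> by (auto simp: aR_def indicator_def)
  have aV2: "aV s u * aV s u = indicator {0<..<s} u * exp (- \<alpha> * u)" for s u
    by (auto simp: aV_def half indicator_def)
  have aS2: "aS s u * aS s u = indicator {s<..} u * exp (- \<alpha> * u)" for s u
    by (auto simp: aS_def half indicator_def)
  have aSV: "aS s u * aV s u = 0" "aV s u * aS s u = 0" for s u
    by (auto simp: aS_def aV_def indicator_def)
  have dV: "exp_dominated (\<lambda>u. aV s u * aV s u)" for s
    by (rule exp_dominated_mono[OF exp_dominated_exp[OF \<alpha>]], measurable) (auto simp: aV2 indicator_def)
  have dS: "exp_dominated (\<lambda>u. aS s u * aS s u)" for s
    by (rule exp_dominated_mono[OF exp_dominated_exp[OF \<alpha>]], measurable) (auto simp: aS2 indicator_def)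
  have d0: "exp_dominated (\<lambda>u. 0)"
    by (rule exp_dominated_mono[OF exp_dominated_exp[OF \<alpha>]]) auto
  have dR: "exp_dominated (\<lambda>u. aR u * aR u)"
    by (rule exp_dominated_finite_horizon[where K=1 and t=t], measurable) (use \<alpha> in \<open>auto simp: aR2 indicator_def\<close>)
  have dSum: "exp_dominated (\<lambda>u. (aS t u + aV t u) * (aS t u + aV t u))"
    by (rule exp_dominated_mono[OF exp_dominated_exp[OF \<alpha>]], measurable)
       (auto simp: distrib_left distrib_right aS2 aV2 aSV indicator_def)
  define V where "V s x = W (nk s (aV s) x)" for s x
  define S where "S s x = W (nk s (aS s) x)" for s x
  \<comment> \<open>Driven by the same noise as \<open>V\<close>, and so need not be independent of
    it; only the law of \<open>R\<close> is used, and the independent copy is formed on a product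
    space in \<open>gaussian_finite_comparison\<close>.\<close>
  define R where "R x = W (nk t aR x)" for x
  have t0: "0 \<le> t" using t by simp
  note nfV = noise_field[OF W _ _ aV0 dV, where x="\<lambda>x. x"]
  note nfS = noise_field[OF W _ _ aS0 dS, where x="\<lambda>x. x"]
  note nfR = noise_field[OF W t0 _ aR0 dR, where x="\<lambda>x. x"]
  have V: "centered_gaussian_process M UNIV (V t)" "\<And>x y. (LINT \<omega>|M. V t x \<omega> * V t y \<omega>) = cv (\<lambda>u. aV t u * aV t u) x y"
      "gaussian_char M UNIV (V t) (cv (\<lambda>u. aV t u * aV t u))"
    unfolding V_def using nfV[OF t0] by simp_all
  have S: "centered_gaussian_process M UNIV (S t)" "\<And>x y. (LINT \<omega>|M. S t x \<omega> * S t y \<omega>) = cv (\<lambda>u. aS t u * aS t u) x y"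
      "gaussian_char M UNIV (S t) (cv (\<lambda>u. aS t u * aS t u))"
    unfolding S_def using nfS[OF t0] by simp_all
  have R: "centered_gaussian_process M UNIV R" "\<And>x y. (LINT \<omega>|M. R x \<omega> * R y \<omega>) = cv (\<lambda>u. aR u * aR u) x y"
    unfolding R_def using nfR by simp_all
  have kV: "exp (- \<alpha> * t) \<le> aV t u * aV t u" if "0 < u" "u < t" for u
    using that \<alpha> by (simp add: aV2)
  have aVaV0: "0 \<le> aV t u * aV t u" for u using aV0 by simp
  have smooth: "smoother_than M (S t) (V t)"
    by (rule field_smoother[OF S(1,2) dS V(1,2) dV _ t _ kV]) (use aVaV0 in auto)
  have indep: "indep_fields M (S t) (V t)"
  proof (rule gaussian_char_uncorrelated_indep[OF S(3) V(3)])
    \<comment> \<open>One noise drives both fields, so they are jointly Gaussian; the weights have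
      disjoint supports in time, so all mixed moments vanish.\<close>
    let ?w = "\<lambda>i::bool \<times> 'a. if fst i then aS t else aV t"
    have "gaussian_char M UNIV (\<lambda>i. W (nk t (?w i) (snd i))) (\<lambda>i j. cv (\<lambda>s. ?w i s * ?w j s) (snd i) (snd j))"
      by (rule noise_field(3)[OF W t0]) (auto simp: aS0 aV0 dS dV aSV d0)
    moreover have "(\<lambda>i. W (nk t (?w i) (snd i))) = (\<lambda>i. if fst i then S t (snd i) else V t (snd i))"
      by (auto simp: S_def V_def fun_eq_iff)
    ultimately show "gaussian_char M UNIV (\<lambda>i. if fst i then S t (snd i) else V t (snd i))
        (\<lambda>i j. cv (\<lambda>s. ?w i s * ?w j s) (snd i) (snd j))" by simp
  qed (auto simp: aSV cv_def)
  have mac: "laws_mutually_abs_cont M (V t) M (U t) A" if A: "compact A" for A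
  proof (rule laws_mutually_abs_cont_compact[OF A t dV _ _ kV dR _ _ V(3) _ R])
    show "0 \<le> aV t u * aV t u" for u by (rule aVaV0)
    show "0 < exp (- \<alpha> * t)" by simp
    show "0 \<le> \<alpha> * exp (\<beta> * t)" using \<alpha> by simp
    \<comment> \<open>The weight is at most \<open>\<alpha> * u\<close> on (0,t), and inserting the
      factor \<open>exp (- \<beta> * u)\<close> there costs at most
      \<open>exp (\<beta> * t)\<close>.\<close>
    show "aR u * aR u \<le> \<alpha> * exp (\<beta> * t) * (u * exp (- \<beta> * u))" if u: "0 < u" for u
    proof (cases "u < t")
      case True
      have "1 - exp (- \<alpha> * u) \<le> \<alpha> * u" using exp_ge_add_one_self[of "- \<alpha> * u"] by simp
      also have "\<dots> \<le> \<alpha> * u * exp (\<beta> * t - \<beta> * u)"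
        using \<alpha> u True \<beta>_pos by simp
      finally show ?thesis using u True by (simp add: aR2 exp_diff exp_minus field_simps)
    qed (use \<alpha> u in \<open>simp add: aR2\<close>)
    have "gaussian_char M UNIV (\<lambda>x. W (nk t (indicator {0<..<t}) x)) (cv (\<lambda>s. indicator {0<..<t} s * indicator {0<..<t} s))"
      using noise_field(3)[OF W t0 _ _ exp_dominated_indicator, where x="\<lambda>x. x"] by simp
    moreover have "cv (\<lambda>s. indicator {0<..<t} s * indicator {0<..<t} s) = (\<lambda>x y. cv (\<lambda>u. aV t u * aV t u) x y + cv (\<lambda>u. aR u * aR u) x y)"
    proof (intro ext)
      fix x y
      have "(\<lambda>s. indicator {0<..<t} s * indicator {0<..<t} s) = (\<lambda>s. aV t s * aV t s + aR s * aR s)"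
        by (auto simp: fun_eq_iff aV2 aR2 indicator_def)
      then show "cv (\<lambda>s. indicator {0<..<t} s * indicator {0<..<t} s) x y = cv (\<lambda>u. aV t u * aV t u) x y + cv (\<lambda>u. aR u * aR u) x y"
        by (simp only: cv_add[OF dV dR])
    qed
    ultimately have "gaussian_char M UNIV (\<lambda>x. W (nk t (indicator {0<..<t}) x)) (\<lambda>x y. cv (\<lambda>u. aV t u * aV t u) x y + cv (\<lambda>u. aR u * aR u) x y)"
      by simp
    then show "gaussian_char M UNIV (U t) (\<lambda>x y. cv (\<lambda>u. aV t u * aV t u) x y + cv (\<lambda>u. aR u * aR u) x y)"
    proof (rule gaussian_char_cong_AE)
      show "U t x \<in> borel_measurable M" for x by (rule mild_solutionD(1)[OF U t0])
      show "AE \<omega> in M. W (nk t (indicator {0<..<t}) x) \<omega> = U t x \<omega>" for x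
        using mild_solutionD(2)[OF U t0, of x] by eventually_elim simp
    qed
  qed
  have law: "field_law M (\<lambda>x \<omega>. S t x \<omega> + V t x \<omega>) = field_law N \<eta>"
    if \<eta>: "centered_gaussian_with_cov N \<eta> (\<lambda>x y. enn2real (ubar m p \<alpha> x y))" for N :: "'n measure" and \<eta>
  proof -
    let ?w = "\<lambda>u. aS t u + aV t u"
    have "gaussian_char M UNIV (\<lambda>x. W (nk t ?w x)) (cv (\<lambda>s. ?w s * ?w s))"
      using noise_field(3)[OF W t0 _ _ dSum, where x="\<lambda>x. x"] aS0 aV0 by simp
    moreover have "cv (\<lambda>s. ?w s * ?w s) = (\<lambda>x y. enn2real (ubar m p \<alpha> x y))"
    proof (intro ext)
      fix x y
      have "cv (\<lambda>s. ?w s * ?w s) x y = cv (\<lambda>s. exp (- \<alpha> * s)) x y"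
        by (rule cv_cong_AE[where t=t], measurable) (use t in \<open>auto simp: distrib_left distrib_right aS2 aV2 aSV indicator_def\<close>)
      then show "cv (\<lambda>s. ?w s * ?w s) x y = enn2real (ubar m p \<alpha> x y)"
        by (simp add: ubar_eq_cv[OF \<alpha>] cv_nonneg)
    qed
    ultimately have "gaussian_char M UNIV (\<lambda>x. W (nk t ?w x)) (\<lambda>x y. enn2real (ubar m p \<alpha> x y))" by simp
    then have SV: "gaussian_char M UNIV (\<lambda>x \<omega>. S t x \<omega> + V t x \<omega>) (\<lambda>x y. enn2real (ubar m p \<alpha> x y))"
    proof (rule gaussian_char_cong_AE)
      fix x
      show "(\<lambda>\<omega>. S t x \<omega> + V t x \<omega>) \<in> borel_measurable M"
        using gaussian_charD(2)[OF S(3)] gaussian_charD(2)[OF V(3)] by simp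
      have "nk t (aS t) x \<in> L2 (space_time m)" "nk t (aV t) x \<in> L2 (space_time m)"
        by (auto intro!: nk_L2 t0 aS0 aV0 dS dV)
      then have "AE \<omega> in M. W (\<lambda>z. 1 * nk t (aS t) x z + 1 * nk t (aV t) x z) \<omega> = 1 * W (nk t (aS t) x) \<omega> + 1 * W (nk t (aV t) x) \<omega>"
        using W unfolding white_noise_def by blast
      moreover have "(\<lambda>z. 1 * nk t (aS t) x z + 1 * nk t (aV t) x z) = nk t ?w x"
        by (simp add: fun_eq_iff nk_def distrib_right)
      ultimately show "AE \<omega> in M. W (nk t ?w x) \<omega> = S t x \<omega> + V t x \<omega>"
        by (simp add: S_def V_def)
    qed
    have "gaussian_char N UNIV \<eta> (\<lambda>x y. enn2real (ubar m p \<alpha> x y))"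
      using \<eta> unfolding centered_gaussian_with_cov_def by (intro centered_gaussian_process_char) auto
    from gaussian_char_law_eq[OF SV this] show ?thesis by (simp add: field_law_def restrict_def)
  qed
  have Vm: "V s x \<in> borel_measurable M" if "0 \<le> s" for s x
    unfolding V_def
    using centered_gaussian_process_square_integrable(1)[OF noise_field(1)[OF W that _ aV0 dV, where x="\<lambda>x. x"] UNIV_I]
    by simp
  show ?thesis
    by (rule exI[of _ V], intro conjI allI impI Vm mac, assumption+, rule exI[of _ S], intro conjI allI impI indep smooth law)
qed

text \<open>The square root of the weight \<open>exp (- \<alpha> * s)\<close> is integrated against
  all of the noise; with folding time 0, \<open>fold_time\<close> is the identity on nonnegative
  times.\<close>

lemma associated_gaussian_field_exists:
  assumes W: "white_noise M (space_time m) W" and \<alpha>: "0 < \<alpha>"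
  shows "\<exists>\<eta>. centered_gaussian_with_cov M \<eta> (\<lambda>x y. enn2real (ubar m p \<alpha> x y))"
proof -
  let ?w = "\<lambda>u. exp (- \<alpha> * u / 2)"
  have w: "(\<lambda>s. ?w s * ?w s) = (\<lambda>s. exp (- \<alpha> * s))" by (simp add: exp_add[symmetric] mult.commute)
  have d: "exp_dominated (\<lambda>s. ?w s * ?w s)" unfolding w by (rule exp_dominated_exp[OF \<alpha>])
  have "centered_gaussian_with_cov M (\<lambda>x. W (nk 0 ?w x)) (\<lambda>x y. enn2real (ubar m p \<alpha> x y))"
    using noise_field(1,2)[OF W order_refl _ _ d, where x="\<lambda>x. x", unfolded w]
    by (simp add: centered_gaussian_with_cov_def ubar_eq_cv[OF \<alpha>] cv_nonneg)
  then show ?thesis by blast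
qed

end

section \<open>State space and processes\<close>

lemma radon_ball_finite:
  fixes m :: "'a::{metric_space, second_countable_topology} measure"
  assumes "locally_compact_space (euclidean :: 'a topology)" "radon_measure m"
  shows "\<exists>r>0. emeasure m (ball x r) < \<infinity>"
proof -
  have "\<exists>U. open U \<and> (\<exists>K. compact K \<and> x \<in> U \<and> U \<subseteq> K)"
    using assms(1) by (simp add: locally_compact_space_def)
  then obtain U K where U: "open U" "x \<in> U" "U \<subseteq> K" "compact K" by blast
  obtain r where r: "0 < r" "ball x r \<subseteq> U" using U open_contains_ball by blast
  have "K \<in> sets m" using assms(2) borel_compact[OF U(4)] by (simp add: radon_measure_def)
  then have "emeasure m (ball x r) \<le> emeasure m K" using r U by (intro emeasure_mono) auto
  also have "\<dots> < \<infinity>" using assms(2) U by (simp add: radon_measure_def)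
  finally show ?thesis using r by blast
qed

text \<open>Every point has a ball of finite measure, and by Lindelof's theorem countably many open
  sets of finite measure cover the space.\<close>

lemma radon_sigma_finite:
  fixes m :: "'a::{metric_space, second_countable_topology} measure"
  assumes "locally_compact_space (euclidean :: 'a topology)" "radon_measure m"
  shows "sigma_finite_measure m"
proof -
  have s: "sets m = sets borel" using assms(2) by (simp add: radon_measure_def)
  then have sp: "space m = UNIV" using sets_eq_imp_space_eq by fastforce
  define \<B> where "\<B> = {B. open B \<and> emeasure m B < (\<infinity>::ennreal)}"
  have "\<And>B. B \<in> \<B> \<Longrightarrow> open B" by (simp add: \<B>_def)
  then obtain \<B>' where B: "\<B>' \<subseteq> \<B>" "countable \<B>'" "\<Union>\<B>' = \<Union>\<B>" by (rule Lindelof)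
  have "x \<in> \<Union>\<B>" for x
  proof -
    obtain r where r: "0 < r" "emeasure m (ball x r) < \<infinity>" using radon_ball_finite[OF assms] by blast
    then have "ball x r \<in> \<B>" "x \<in> ball x r" by (auto simp: \<B>_def)
    then show ?thesis by blast
  qed
  then have "\<Union>\<B>' = space m" unfolding B(3) sp by blast
  moreover have "\<B>' \<subseteq> sets m" using B(1) by (auto simp: \<B>_def s)
  moreover have "\<forall>a\<in>\<B>'. emeasure m a \<noteq> \<infinity>" using B(1) by (auto simp: \<B>_def)
  ultimately show ?thesis using B(2) unfolding sigma_finite_measure_def by blast
qed

text \<open>A path started at \<open>x\<close> stays in \<open>G\<close> for a short time by right
  continuity. If no \<open>K t x\<close> charged \<open>G\<close>, almost every path would avoid
  \<open>G\<close> at the times 1/(n+1), which tend to 0.\<close>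

lemma right_process_charges_open:
  assumes X: "borel_right_process K X" and G: "open G" "x \<in> G"
  shows "\<exists>t>0. 0 < emeasure (K t x) G"
proof (rule ccontr)
  assume "\<not> ?thesis"
  then have null: "emeasure (K t x) G = 0" if "0 < t" for t using that by (auto simp: zero_less_iff_neq_zero)
  have mp: "markov_process K X" using X by (simp add: borel_right_process_def)
  note c2 = mp[unfolded markov_process_def, THEN conjunct2]
  note c5 = c2[THEN conjunct2, THEN conjunct2, THEN conjunct2]
  note c8 = c5[THEN conjunct2, THEN conjunct2, THEN conjunct2]
  note sets = c2[THEN conjunct1, rule_format, THEN conjunct2, of x] and pr = c2[THEN conjunct1, rule_format, THEN conjunct1, of x]
    and sub = c2[THEN conjunct2, THEN conjunct1, rule_format] and ev = c5[THEN conjunct1, rule_format]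
    and start = c8[THEN conjunct1, rule_format, of x] and mk = c8[THEN conjunct2, rule_format, of _ _ _ _ x]
  interpret prob_space "law X x" by (rule pr)
  have sp: "space (law X x) = space (base X)" using sets by (rule sets_eq_imp_space_eq)
  have Gb: "G \<in> sets borel" using G by simp
  have "AE \<omega> in law X x. traj X (inverse (real (Suc n))) \<omega> \<notin> Some ` G" for n
  proof -
    let ?t = "inverse (real (Suc n))"
    let ?N = "{\<omega>\<in>space (base X). traj X ?t \<omega> \<in> Some ` G}"
    have "space (base X) \<in> sets (filt X 0)" using sub[of 0] unfolding subalgebra_def by (metis order_refl sets.top)
    from mk[OF order_refl _ this Gb, of ?t]
    have "emeasure (law X x) ?N = (\<integral>\<^sup>+\<omega>\<in>space (base X). cem_ext (\<lambda>y. emeasure (K ?t y) G) (traj X 0 \<omega>) \<partial>law X x)"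
      by simp
    also have "\<dots> = (\<integral>\<^sup>+\<omega>. 0 \<partial>law X x)"
    proof (rule nn_integral_cong_AE)
      show "AE \<omega> in law X x. cem_ext (\<lambda>y. emeasure (K ?t y) G) (traj X 0 \<omega>) * indicator (space (base X)) \<omega> = 0"
        using start by eventually_elim (simp add: cem_ext_def null del: of_nat_Suc)
    qed
    finally have "emeasure (law X x) ?N = 0" by simp
    moreover have "?N \<in> sets (law X x)" using ev[of ?t, OF _ Gb] sub[of ?t] unfolding sets subalgebra_def by auto
    ultimately have "?N \<in> null_sets (law X x)" by auto
    then show ?thesis by (rule AE_I') (auto simp: sp)
  qed
  then have never: "AE \<omega> in law X x. \<forall>n. traj X (inverse (real (Suc n))) \<omega> \<notin> Some ` G" by (simp add: AE_all_countable)
  have path: "\<exists>n. traj X (inverse (real (Suc n))) \<omega> \<in> Some ` G"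
    if "\<omega> \<in> space (base X)" "traj X 0 \<omega> = Some x" for \<omega>
  proof -
    have ev0: "\<forall>\<^sub>F s in at_right 0. traj X s \<omega> \<in> Some ` G"
      using X that G unfolding borel_right_process_def by blast
    have "filterlim (\<lambda>n. inverse (real (Suc n))) (at_right 0) sequentially"
      by (rule tendsto_imp_filterlim_at_right[OF LIMSEQ_inverse_real_of_nat]) simp
    from eventually_happens'[OF sequentially_bot eventually_compose_filterlim[OF ev0 this]] show ?thesis .
  qed
  have "AE \<omega> in law X x. False"
    using never start AE_space[of "law X x"] unfolding sp by eventually_elim (use path in blast)
  then show False by simp
qed

theorem theorem1p1:
  fixes m :: "'a::{metric_space, second_countable_topology} measure"
    and P Pstar Pbar :: "real \<Rightarrow> 'a \<Rightarrow> 'a measure"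
    and X :: "('x, 'a) markov_system"
    and Xstar :: "('y, 'a) markov_system"
    and Xbar :: "('z, 'a) markov_system"
    and p :: "real \<Rightarrow> 'a \<Rightarrow> 'a \<Rightarrow> real"
    and M :: "'w measure"
    and W :: "(real \<times> 'a \<Rightarrow> real) \<Rightarrow> 'w \<Rightarrow> real"
    and \<alpha> t :: real
  assumes locally_compact: "locally_compact_space (euclidean :: 'a topology)"
    and radon: "radon_measure m"
    and X: "borel_right_process P X"
    and p_nonneg: "\<And>s x y. 0 < s \<Longrightarrow> 0 \<le> p s x y"
    and p: "regular_transition_functions m (\<lambda>s x y. ennreal (p s x y)) P"
    and Xstar: "markov_process Pstar Xstar"
    and dual: "dual_semigroups m P Pstar"
    and commute: "commuting_semigroups m P Pstar"
    and Xbar: "borel_right_process Pbar Xbar"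
    and Pbar: "\<And>s f. 0 \<le> s \<Longrightarrow> f \<in> L2 m \<Longrightarrow>
                 AE x in m. kernel_op (Pbar s) f x = bar_op P Pstar s f x"
    and pbar: "regular_transition_functions m (pbar m p) Pbar"
    and dense: "dense_in_L2 m (generator_domain m (bar_op P Pstar))"
    and ubar: "\<exists>\<beta>>0. (\<forall>x y. ubar m p \<beta> x y < \<infinity>) \<and>
                 continuous_on UNIV (\<lambda>(x, y). enn2real (ubar m p \<beta> x y))"
    and W: "white_noise M (space_time m) W"
    and \<alpha>: "0 < \<alpha>"
    and t: "0 < t"
  shows
    "(\<exists>U. mild_solution M m p W U) \<and>
     (\<forall>U U'. mild_solution M m p W U \<and> mild_solution M m p W U' \<longrightarrow>
        (\<forall>s\<ge>0. \<forall>x. AE \<omega> in M. U s x \<omega> = U' s x \<omega>)) \<and>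
     (\<exists>\<eta> :: 'a \<Rightarrow> 'w \<Rightarrow> real.
        centered_gaussian_with_cov M \<eta> (\<lambda>x y. enn2real (ubar m p \<alpha> x y))) \<and>
     (\<forall>U. mild_solution M m p W U \<longrightarrow>
        (\<exists>V :: real \<Rightarrow> 'a \<Rightarrow> 'w \<Rightarrow> real.
           (\<forall>s\<ge>0. \<forall>x. V s x \<in> borel_measurable M) \<and>
           (\<forall>A. compact A \<longrightarrow> laws_mutually_abs_cont M (V t) M (U t) A) \<and>
           (\<exists>S :: real \<Rightarrow> 'a \<Rightarrow> 'w \<Rightarrow> real.
              indep_fields M (S t) (V t) \<and>
              smoother_than M (S t) (V t) \<and>
              (\<forall>(N :: 'n measure) \<eta>.
                 centered_gaussian_with_cov N \<eta> (\<lambda>x y. enn2real (ubar m p \<alpha> x y)) \<longrightarrow>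
                 field_law M (\<lambda>x \<omega>. S t x \<omega> + V t x \<omega>) = field_law N \<eta>))))"
proof -
  have sets_m: "sets m = sets borel" using radon by (simp add: radon_measure_def)
  note [measurable_cong] = sets_m
  have nonneg_meas: "(\<lambda>(s, x, y). ennreal (p s x y)) \<in>
       borel_measurable (restrict_space borel {0<..} \<Otimes>\<^sub>M borel \<Otimes>\<^sub>M borel)"
    and P_int: "\<And>s f x. 0 < s \<Longrightarrow> f \<in> borel_measurable borel \<Longrightarrow>
        (\<integral>\<^sup>+y. f y \<partial>P s x) = (\<integral>\<^sup>+y. ennreal (p s x y) * f y \<partial>m)"
    using p by (auto simp: regular_transition_functions_def)
  have q_meas: "(\<lambda>(s, x, y). pbar m p s x y) \<in>
       borel_measurable (restrict_space borel {0<..} \<Otimes>\<^sub>M borel \<Otimes>\<^sub>M borel)"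
    and Pbar_int: "\<And>s f x. 0 < s \<Longrightarrow> f \<in> borel_measurable borel \<Longrightarrow>
        (\<integral>\<^sup>+y. f y \<partial>Pbar s x) = (\<integral>\<^sup>+y. pbar m p s x y * f y \<partial>m)"
    and CK: "\<And>s r x y. 0 < s \<Longrightarrow> 0 < r \<Longrightarrow> pbar m p (s + r) x y = (\<integral>\<^sup>+z. pbar m p s x z * pbar m p r z y \<partial>m)"
    using pbar by (auto simp: regular_transition_functions_def)
  have p_section: "(\<lambda>y. ennreal (p s x y)) \<in> borel_measurable borel" if "0 < s" for s x
  proof -
    have "(\<lambda>y. (s, x, y)) \<in> measurable borel (restrict_space borel {0<..} \<Otimes>\<^sub>M borel \<Otimes>\<^sub>M borel)"
      using that by (intro measurable_Pair measurable_const) (auto simp: space_restrict_space)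
    from measurable_compose[OF this nonneg_meas] show ?thesis by simp
  qed
  \<comment> \<open>This one fact about the paths gives both the positivity of \<open>pbar\<close>
    on the diagonal and the full support of \<open>m\<close>.\<close>
  have charges: "\<exists>s>0. 0 < (\<integral>\<^sup>+y. ennreal (p s x y) * indicator G y \<partial>m)" if G: "open G" "x \<in> G" for G x
  proof -
    obtain s where s: "0 < s" "0 < emeasure (P s x) G" using right_process_charges_open[OF X G] by blast
    have "P s \<in> borel \<rightarrow>\<^sub>M subprob_algebra borel"
      using X s(1) by (auto simp: borel_right_process_def markov_process_def transition_semigroup_def)
    from sets_kernel[OF this, of x] have "sets (P s x) = sets borel" by simp
    then have "emeasure (P s x) G = (\<integral>\<^sup>+y. indicator G y \<partial>P s x)" using G by simp
    then show ?thesis using s P_int[OF s(1), of "indicator G" x] G by auto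
  qed
  obtain \<beta> where \<beta>: "0 < \<beta>" "\<And>x y. ubar m p \<beta> x y < \<infinity>"
    "continuous_on UNIV (\<lambda>(x, y). enn2real (ubar m p \<beta> x y))"
    using ubar by blast
  interpret bar_semigroup m p \<beta>
  proof (rule bar_semigroup.intro)
    show "sets m = sets borel" by (rule sets_m)
    show "sigma_finite_measure m" by (rule radon_sigma_finite[OF locally_compact radon])
    show "\<exists>r>0. emeasure m (ball x r) < \<infinity>" for x by (rule radon_ball_finite[OF locally_compact radon])
    show "(\<integral>\<^sup>+y. pbar m p s x y \<partial>m) \<le> 1" if s: "0 < s" for s x
    proof -
      have "Pbar s \<in> borel \<rightarrow>\<^sub>M subprob_algebra borel"
        using Xbar s by (auto simp: borel_right_process_def markov_process_def transition_semigroup_def)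
      from measurable_space[OF this, of x] have "subprob_space (Pbar s x)" by (simp add: space_subprob_algebra)
      then have "emeasure (Pbar s x) (space (Pbar s x)) \<le> 1" by (rule subprob_space.emeasure_space_le_1)
      then show ?thesis using Pbar_int[OF s, of "\<lambda>_. 1" x] by simp
    qed
    show "\<exists>s>0. 0 < pbar m p s x x" for x
    proof -
      obtain s where s: "0 < s" "0 < (\<integral>\<^sup>+y. ennreal (p s x y) * indicator UNIV y \<partial>m)"
        using charges[of UNIV x] by auto
      note [measurable] = p_section[OF s(1)]
      \<comment> \<open>The diagonal value is the integral of the square of \<open>p s x\<close>,
        which vanishes only if \<open>P s x\<close> has no mass.\<close>
      have "pbar m p s x x \<noteq> 0"
      proof
        assume "pbar m p s x x = 0"
        then have "AE y in m. ennreal (p s x y) = 0"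
          unfolding pbar_def by (subst (asm) nn_integral_0_iff_AE) auto
        then have "(\<integral>\<^sup>+y. ennreal (p s x y) * indicator UNIV y \<partial>m) = (\<integral>\<^sup>+y. 0 \<partial>m)"
          by (intro nn_integral_cong_AE) auto
        then show False using s(2) by simp
      qed
      then show ?thesis using s(1) by (auto simp: zero_less_iff_neq_zero)
    qed
    show "0 < emeasure m G" if G: "open G" "x \<in> G" for G x
    proof (rule ccontr)
      assume "\<not> ?thesis"
      then have "emeasure m G = 0" by (simp add: zero_less_iff_neq_zero)
      then have "G \<in> null_sets m" using G by (auto simp: sets_m)
      then have "AE y in m. y \<notin> G" by (rule AE_not_in)
      then have "(\<integral>\<^sup>+y. ennreal (p s x y) * indicator G y \<partial>m) = (\<integral>\<^sup>+y. 0 \<partial>m)" for s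
        by (intro nn_integral_cong_AE) (auto simp: indicator_def)
      then show False using charges[OF G] by simp
    qed
  qed (fact p_nonneg nonneg_meas q_meas CK \<beta>)+
  show ?thesis
  proof (intro conjI allI impI, goal_cases)
    case 1
    show ?case using mild_solution_exists[OF W] by blast
  next
    case (2 U U' s x)
    then show ?case using mild_solution_unique by blast
  next
    case 3
    show ?case by (rule associated_gaussian_field_exists[OF W \<alpha>])
  next
    case (4 U)
    show ?case by (rule damped_field_decomposition[OF W \<alpha> t 4])
  qed
qed

end
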